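(* Let $\mathfrak{g}=\oplus_t\mathfrak{g}_t$ be an involutive symbolic system of pure order $k\ge1$ on an $n$-dimensional vector space $T$ with values in a finite-dimensional vector space $N$. Let $s_0=\dim N$, let $s_1,\dots,s_n$ be its Cartan characters, and let $h_0=\dim H^{0,0}(\mathfrak{g})=\dim N$ and $h_i=\dim H^{k-1,i}(\mathfrak{g})$ for $1\le i\le n$. Then $s_0=h_0$ and $$s_l=\binom{n+k-l-1}{k-1}h_0+\sum_{i=n-l+1}^n(-1)^{n-l-i}\binom{i-1}{n-l}h_i,\qquad l=1,\dots,n.$$
   Context: A symbolic system of order $k$ is a sequence $\mathfrak{g}_i=S^iT^*\otimes N$ for $i<k$, a subspace $\mathfrak{g}_k\subset S^kT^*\otimes N$, and $\mathfrak{g}_i=(\mathfrak{g}_k\otimes S^{i-k}T^* )\cap(S^iT^*\otimes N)$ for $i>k$. The Spencer $\delta$-complex is $$0\to \mathfrak{g}_t\to \mathfrak{g}_{t-1}\otimes T^*\xrightarrow{\delta}\mathfrak{g}_{t-2}\otimes\Lambda^2T^*\xrightarrow{\delta}\cdots,$$ with $\delta(p^i\otimes v\otimes\omega)=i\,p^{i-1}\otimes v\otimes(p\wedge\omega)$ for $p\in T^*$, $v\in N$, $\omega\in\Lambda^jT^*$, and $H^{i,j}(\mathfrak{g})$ is its cohomology at $\mathfrak{g}_i\otimes\Lambda^jT^*$. The system is involutive if $H^{i,j}(\mathfrak{g})=0$ for all $i\ne k-1$ with $i+j>0$. Cartan characters: for a generic complete flag $0=V_n^*\subset V_{n-1}^*\subset\dots\subset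 V_0^*=T^*$ (consecutive dimensions differ by 1), $$s_i=\dim(\mathfrak{g}_k\cap S^kV_{i-1}^*\otimes N)-\dim(\mathfrak{g}_k\cap S^kV_i^*\otimes N),\quad 1\le i\le n.$$ It is known that involutivity is equivalent to the Cartan test $\dim\mathfrak{g}_{k+1}=s_1+2s_2+\dots+ns_n$. *)

theory Defs
  imports Complex_Main "HOL-Library.Function_Algebras" "HOL-Library.Multiset"
    "HOL-Combinatorics.Permutations"
begin

text \<open>
  \<open>sT\<close> and \<open>sN\<close> are the scalar multiplications of the vector spaces \<open>T\<close> and \<open>N\<close>, each of which is
  a whole type. Tensors are modelled by multilinear maps: an \<open>m\<close>-linear map on \<open>T\<close> is a function on
  lists which vanishes on lists of length other than \<open>m\<close>, so that a tensor is a single function and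
  the linear structure is pointwise. An element of \<open>S\<^sup>iT* \<otimes> N \<otimes> \<Lambda>\<^sup>jT*\<close> is a function \<open>\<omega> ys xs\<close>,
  alternating in the list \<open>ys\<close> (of length \<open>j\<close>) and symmetric in the list \<open>xs\<close> (of length \<open>i\<close>).
\<close>

definition fun_scale :: "('a \<Rightarrow> 'b \<Rightarrow> 'b) \<Rightarrow> 'a \<Rightarrow> ('c \<Rightarrow> 'b) \<Rightarrow> ('c \<Rightarrow> 'b)" where
  "fun_scale s c f = (\<lambda>x. s c (f x))"

definition multilinear_maps ::
    "('a::field \<Rightarrow> 't::ab_group_add \<Rightarrow> 't) \<Rightarrow> ('a \<Rightarrow> 'w::ab_group_add \<Rightarrow> 'w) \<Rightarrow> nat \<Rightarrow> ('t list \<Rightarrow> 'w) set" where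
  "multilinear_maps sT sW m =
    {f. (\<forall>xs. length xs \<noteq> m \<longrightarrow> f xs = 0) \<and>
        (\<forall>us vs. length us + 1 + length vs = m \<longrightarrow>
           Vector_Spaces.linear sT sW (\<lambda>x. f (us @ x # vs)))}"

text \<open>For a subspace \<open>W\<close>, the spaces \<open>S\<^sup>mT* \<otimes> W\<close> and \<open>\<Lambda>\<^sup>mT* \<otimes> W\<close>.\<close>

definition sym_tensors ::
    "('a::field \<Rightarrow> 't::ab_group_add \<Rightarrow> 't) \<Rightarrow> ('a \<Rightarrow> 'w::ab_group_add \<Rightarrow> 'w) \<Rightarrow> nat \<Rightarrow> 'w set \<Rightarrow> ('t list \<Rightarrow> 'w) set" where
  "sym_tensors sT sW m W =
    {f \<in> multilinear_maps sT sW m.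
       (\<forall>xs. f xs \<in> W) \<and> (\<forall>xs ys. mset xs = mset ys \<longrightarrow> f xs = f ys)}"

definition alt_tensors ::
    "('a::field \<Rightarrow> 't::ab_group_add \<Rightarrow> 't) \<Rightarrow> ('a \<Rightarrow> 'w::ab_group_add \<Rightarrow> 'w) \<Rightarrow> nat \<Rightarrow> 'w set \<Rightarrow> ('t list \<Rightarrow> 'w) set" where
  "alt_tensors sT sW m W =
    {f \<in> multilinear_maps sT sW m.
       (\<forall>xs. f xs \<in> W) \<and> (\<forall>xs. \<not> distinct xs \<longrightarrow> f xs = 0)}"

text \<open>
  \<open>(S\<^sup>rT* \<otimes> W) \<inter> (S\<^sup>r\<^sup>+\<^sup>kT* \<otimes> N)\<close> for \<open>W \<subseteq> S\<^sup>kT* \<otimes> N\<close>: the function of \<open>us\<close> below is \<open>f\<close>, with its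
  arguments split into the first \<open>r\<close> and the remaining \<open>k\<close>.
\<close>

definition prolongation ::
    "('a::field \<Rightarrow> 't::ab_group_add \<Rightarrow> 't) \<Rightarrow> ('a \<Rightarrow> 'n::ab_group_add \<Rightarrow> 'n) \<Rightarrow> nat \<Rightarrow> nat \<Rightarrow>
     ('t list \<Rightarrow> 'n) set \<Rightarrow> ('t list \<Rightarrow> 'n) set" where
  "prolongation sT sN r k W =
    {f \<in> sym_tensors sT sN (r + k) UNIV.
       (\<lambda>us. if length us = r then (\<lambda>xs. f (us @ xs)) else 0) \<in> sym_tensors sT (fun_scale sN) r W}"

definition symbolic_system ::
    "('a::field \<Rightarrow> 't::ab_group_add \<Rightarrow> 't) \<Rightarrow> ('a \<Rightarrow> 'n::ab_group_add \<Rightarrow> 'n) \<Rightarrow> nat \<Rightarrow>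
     (nat \<Rightarrow> ('t list \<Rightarrow> 'n) set) \<Rightarrow> bool" where
  "symbolic_system sT sN k g \<longleftrightarrow>
     (\<forall>i<k. g i = sym_tensors sT sN i UNIV) \<and>
     g k \<subseteq> sym_tensors sT sN k UNIV \<and> module.subspace (fun_scale sN) (g k) \<and>
     (\<forall>i>k. g i = prolongation sT sN (i - k) k (g k))"


subsection \<open>Spencer cohomology\<close>

definition spencer_term ::
    "('a::field \<Rightarrow> 't::ab_group_add \<Rightarrow> 't) \<Rightarrow> ('a \<Rightarrow> 'n::ab_group_add \<Rightarrow> 'n) \<Rightarrow>
     (nat \<Rightarrow> ('t list \<Rightarrow> 'n) set) \<Rightarrow> nat \<Rightarrow> nat \<Rightarrow> ('t list \<Rightarrow> 't list \<Rightarrow> 'n) set" where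
  "spencer_term sT sN g i j = alt_tensors sT (fun_scale sN) j (g i)"

text \<open>
  The differential on \<open>S\<^sup>iT* \<otimes> N \<otimes> \<Lambda>\<^sup>jT*\<close>; see \<open>spencer_delta_generator\<close> below for its value on
  \<open>p\<^sup>i \<otimes> v \<otimes> \<omega>\<close>. For \<open>i = 0\<close> it is zero.
\<close>

definition spencer_delta ::
    "('a::field \<Rightarrow> 'n::ab_group_add \<Rightarrow> 'n) \<Rightarrow> nat \<Rightarrow>
     ('t list \<Rightarrow> 't list \<Rightarrow> 'n) \<Rightarrow> ('t list \<Rightarrow> 't list \<Rightarrow> 'n)" where
  "spencer_delta sN i f = (\<lambda>ys xs. sN (of_nat i)
     (\<Sum>a<length ys. sN ((-1) ^ a) (f (take a ys @ drop (Suc a) ys) (ys ! a # xs))))"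

definition spencer_cocycles ::
    "('a::field \<Rightarrow> 't::ab_group_add \<Rightarrow> 't) \<Rightarrow> ('a \<Rightarrow> 'n::ab_group_add \<Rightarrow> 'n) \<Rightarrow>
     (nat \<Rightarrow> ('t list \<Rightarrow> 'n) set) \<Rightarrow> nat \<Rightarrow> nat \<Rightarrow> ('t list \<Rightarrow> 't list \<Rightarrow> 'n) set" where
  "spencer_cocycles sT sN g i j = {f \<in> spencer_term sT sN g i j. spencer_delta sN i f = 0}"

definition spencer_coboundaries ::
    "('a::field \<Rightarrow> 't::ab_group_add \<Rightarrow> 't) \<Rightarrow> ('a \<Rightarrow> 'n::ab_group_add \<Rightarrow> 'n) \<Rightarrow>
     (nat \<Rightarrow> ('t list \<Rightarrow> 'n) set) \<Rightarrow> nat \<Rightarrow> nat \<Rightarrow> ('t list \<Rightarrow> 't list \<Rightarrow> 'n) set" where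
  "spencer_coboundaries sT sN g i j =
     (case j of 0 \<Rightarrow> {0} | Suc j' \<Rightarrow> spencer_delta sN (Suc i) ` spencer_term sT sN g (Suc i) j')"

text \<open>
  The dimension of the quotient \<open>Z / B\<close>: the number of elements of a finite \<open>C \<subseteq> Z\<close> whose classes
  form a basis of \<open>Z / B\<close>. (Linear independence modulo \<open>B\<close> makes these classes distinct.)
\<close>

definition quotient_dim :: "('a::field \<Rightarrow> 'w::ab_group_add \<Rightarrow> 'w) \<Rightarrow> 'w set \<Rightarrow> 'w set \<Rightarrow> nat" where
  "quotient_dim s Z B = (THE m. \<exists>C. finite C \<and> card C = m \<and> C \<subseteq> Z \<and>
      (\<forall>a. (\<Sum>c\<in>C. s (a c) c) \<in> B \<longrightarrow> (\<forall>c\<in>C. a c = 0)) \<and>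
      (\<forall>z\<in>Z. \<exists>a. z - (\<Sum>c\<in>C. s (a c) c) \<in> B))"

definition spencer_dim ::
    "('a::field \<Rightarrow> 't::ab_group_add \<Rightarrow> 't) \<Rightarrow> ('a \<Rightarrow> 'n::ab_group_add \<Rightarrow> 'n) \<Rightarrow>
     (nat \<Rightarrow> ('t list \<Rightarrow> 'n) set) \<Rightarrow> nat \<Rightarrow> nat \<Rightarrow> nat" where
  "spencer_dim sT sN g i j =
     quotient_dim (fun_scale (fun_scale sN)) (spencer_cocycles sT sN g i j) (spencer_coboundaries sT sN g i j)"

definition involutive ::
    "('a::field \<Rightarrow> 't::ab_group_add \<Rightarrow> 't) \<Rightarrow> ('a \<Rightarrow> 'n::ab_group_add \<Rightarrow> 'n) \<Rightarrow> nat \<Rightarrow>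
     (nat \<Rightarrow> ('t list \<Rightarrow> 'n) set) \<Rightarrow> bool" where
  "involutive sT sN k g \<longleftrightarrow>
     (\<forall>i j. i \<noteq> k - 1 \<and> i + j > 0 \<longrightarrow> spencer_cocycles sT sN g i j = spencer_coboundaries sT sN g i j)"


subsection \<open>Cartan characters\<close>

definition dual_space :: "('a::field \<Rightarrow> 't::ab_group_add \<Rightarrow> 't) \<Rightarrow> ('t \<Rightarrow> 'a) set" where
  "dual_space sT = {p. Vector_Spaces.linear sT (*) p}"

text \<open>The first \<open>n = dim T\<close> entries of \<open>e\<close> are a basis of \<open>T*\<close>; the other entries are irrelevant.\<close>

definition coframe :: "('a::field \<Rightarrow> 't::ab_group_add \<Rightarrow> 't) \<Rightarrow> (nat \<Rightarrow> 't \<Rightarrow> 'a) \<Rightarrow> bool" where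
  "coframe sT e \<longleftrightarrow> (let n = vector_space.dim sT UNIV in
     inj_on e {..<n} \<and> \<not> module.dependent (fun_scale (*)) (e ` {..<n}) \<and>
     module.span (fun_scale (*)) (e ` {..<n}) = dual_space sT)"

text \<open>The complete flag \<open>V\<^sub>i* = span (e\<^sub>i, ..., e\<^sub>n\<^sub>-\<^sub>1)\<close>; every complete flag of \<open>T*\<close> is of this form.\<close>

definition flag_of :: "('a::field \<Rightarrow> 't::ab_group_add \<Rightarrow> 't) \<Rightarrow> (nat \<Rightarrow> 't \<Rightarrow> 'a) \<Rightarrow> nat \<Rightarrow> ('t \<Rightarrow> 'a) set" where
  "flag_of sT e i = module.span (fun_scale (*)) (e ` {i..<vector_space.dim sT UNIV})"

text \<open>
  Polynomial functions on \<open>(T*)\<^sup>n\<close>: the evaluations at points of \<open>T\<close> are the linear functions on \<open>T*\<close>.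
\<close>

inductive_set coframe_polys :: "nat \<Rightarrow> ((nat \<Rightarrow> 't \<Rightarrow> 'a::field) \<Rightarrow> 'a) set" for n :: nat where
  const: "(\<lambda>e. c) \<in> coframe_polys n"
| coord: "a < n \<Longrightarrow> (\<lambda>e. e a x) \<in> coframe_polys n"
| add: "F \<in> coframe_polys n \<Longrightarrow> G \<in> coframe_polys n \<Longrightarrow> (\<lambda>e. F e + G e) \<in> coframe_polys n"
| mult: "F \<in> coframe_polys n \<Longrightarrow> G \<in> coframe_polys n \<Longrightarrow> (\<lambda>e. F e * G e) \<in> coframe_polys n"

text \<open>
  \<open>Q\<close> holds on a nonempty Zariski open set of complete flags. The flag variety is the quotient of
  the space of bases by an algebraic group, so this is tested on bases, where the sets \<open>F \<noteq> 0\<close>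
  form a base of the Zariski topology.
\<close>

definition for_generic_flag ::
    "('a::field \<Rightarrow> 't::ab_group_add \<Rightarrow> 't) \<Rightarrow> ((nat \<Rightarrow> ('t \<Rightarrow> 'a) set) \<Rightarrow> bool) \<Rightarrow> bool" where
  "for_generic_flag sT Q \<longleftrightarrow>
     (\<exists>F \<in> coframe_polys (vector_space.dim sT UNIV).
        (\<exists>e. coframe sT e \<and> F e \<noteq> 0) \<and>
        (\<forall>e. coframe sT e \<and> F e \<noteq> 0 \<longrightarrow> Q (flag_of sT e)))"

text \<open>The space \<open>S\<^sup>kV* \<otimes> N\<close>, spanned by the symmetric products \<open>p\<^sub>0 \<cdots> p\<^sub>k\<^sub>-\<^sub>1 \<otimes> v\<close> with all \<open>p\<^sub>a \<in> V*\<close>.\<close>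

definition sym_power_of ::
    "('a::field \<Rightarrow> 'n::ab_group_add \<Rightarrow> 'n) \<Rightarrow> nat \<Rightarrow> ('t \<Rightarrow> 'a) set \<Rightarrow> ('t list \<Rightarrow> 'n) set" where
  "sym_power_of sN k V = module.span (fun_scale sN)
     {(\<lambda>xs. if length xs = k
            then sN (\<Sum>\<sigma> | \<sigma> permutes {..<k}. \<Prod>a<k. p (\<sigma> a) (xs ! a)) v else 0) |
       (p :: nat \<Rightarrow> 't \<Rightarrow> 'a) v. \<forall>a<k. p a \<in> V}"

definition cartan_character ::
    "('a::field \<Rightarrow> 't::ab_group_add \<Rightarrow> 't) \<Rightarrow> ('a \<Rightarrow> 'n::ab_group_add \<Rightarrow> 'n) \<Rightarrow> nat \<Rightarrow>
     (nat \<Rightarrow> ('t list \<Rightarrow> 'n) set) \<Rightarrow> nat \<Rightarrow> int" where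
  "cartan_character sT sN k g i = (THE c. for_generic_flag sT (\<lambda>V.
      c = int (vector_space.dim (fun_scale sN) (g k \<inter> sym_power_of sN k (V (i - 1))))
        - int (vector_space.dim (fun_scale sN) (g k \<inter> sym_power_of sN k (V i)))))"


subsection \<open>The differential on generators\<close>

definition wedge1 :: "('t \<Rightarrow> 'a::field) \<Rightarrow> ('t list \<Rightarrow> 'a) \<Rightarrow> 't list \<Rightarrow> 'a" where
  "wedge1 p \<omega> = (\<lambda>ys. \<Sum>a<length ys. (-1) ^ a * p (ys ! a) * \<omega> (take a ys @ drop (Suc a) ys))"

definition power_tensor ::
    "('a::field \<Rightarrow> 'n::ab_group_add \<Rightarrow> 'n) \<Rightarrow> nat \<Rightarrow> ('t \<Rightarrow> 'a) \<Rightarrow> 'n \<Rightarrow> ('t list \<Rightarrow> 'a) \<Rightarrow> 't list \<Rightarrow> 't list \<Rightarrow> 'n" where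
  "power_tensor sN i p v \<omega> =
     (\<lambda>ys xs. if length xs = i then sN (\<omega> ys * (\<Prod>x\<leftarrow>xs. p x)) v else 0)"

lemma spencer_delta_generator:
  assumes "vector_space sN" and "i > 0"
  shows "spencer_delta sN i (power_tensor sN i p v \<omega>) =
         fun_scale (fun_scale sN) (of_nat i) (power_tensor sN (i - 1) p v (wedge1 p \<omega>))"
proof -
  interpret vector_space sN by fact
  have "spencer_delta sN i (power_tensor sN i p v \<omega>) ys xs =
        fun_scale (fun_scale sN) (of_nat i) (power_tensor sN (i - 1) p v (wedge1 p \<omega>)) ys xs"
    for ys xs
  proof (cases "length xs = i - 1")
    case True
    then show ?thesis
      using \<open>i > 0\<close>
      by (simp add: spencer_delta_def power_tensor_def wedge1_def fun_scale_def
          scale_sum_left [symmetric] sum_distrib_left [symmetric] mult_ac)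
  next
    case False
    then have "Suc (length xs) \<noteq> i"
      by auto
    with False show ?thesis
      by (simp add: spencer_delta_def power_tensor_def fun_scale_def)
  qed
  then show ?thesis
    by (simp add: fun_eq_iff)
qed

end

theory Submission
  imports Defs "HOL-Computational_Algebra.Polynomial" "HOL-Computational_Algebra.Formal_Power_Series"
begin

text \<open>
  Let \<open>K i t\<close> be the elements of \<open>g t\<close> killed by the contractions with the first \<open>i\<close> vectors of a
  basis \<open>v\<close> of \<open>T\<close>. If contraction with \<open>v\<^sub>i\<close> maps \<open>K i (t + 1)\<close> onto \<open>K i t\<close>, then exactness of the
  Spencer complex of \<open>K i\<close> passes to \<open>K (i + 1)\<close>, by Cartan's formula. Exactness in top degree says that
  the contractions of \<open>K i (t + 1)\<close> together span \<open>K i t\<close>; a perturbation argument in the pencil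
  \<open>v + \<epsilon> w\<close> deduces from this that a single contraction of maximal rank is already onto. Each step loses a
  bounded number of degrees, so for every bound there is a basis which is quasi-regular up to that bound.
  For such a basis, rank-nullity expresses \<open>dim g t\<close>, \<open>t \<ge> k\<close>, through the numbers
  \<open>dim K (l - 1) k - dim K l k\<close>, while the Euler characteristics of the Spencer complexes express it through
  \<open>h\<close>; comparing generating functions gives the formula. The numbers \<open>dim K i k\<close> are minimal for a
  quasi-regular basis, because Cartan's inequality \<open>dim g (k + 1) \<le> \<Sum>\<^sub>i dim K i k\<close> is then an equality;
  being upper semicontinuous, they are the generic ones, so their differences are the Cartan characters.
\<close>

subsection \<open>Finite-dimensional subspaces\<close>

text \<open>The obstacle is that exactness only says that all contractions together are onto,
  whereas rank-nullity needs a single one. Commutative algebra would avoid the associated primes of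
  the module dual to \<open>g\<close>; here the means are finite-dimensional linear algebra over a
  field that need not be algebraically closed. What is maximised is a sum of ranks, so a generic
  vector is obtained only for finitely many degrees at a time; this is the origin of the degree
  bounds. They shrink from one basis vector to the next, so the range wanted at the end, degrees
  \<open>k\<close> to \<open>k + n\<close>, is fixed first. It suffices because
  \<open>h_1, ..., h_n\<close> sit in degrees \<open>k, ..., k + n - 1\<close> of the generating
  function. Degree \<open>k - 1\<close> carries the unknown cohomology, so the basis is built from
  exactness in degrees from \<open>k\<close> on. Characteristic 0 makes the factor of the Spencer
  differential invertible, permits the divisions in polarization and symmetrization, and makes a
  polynomial with all values zero vanish.\<close>

abbreviation "lin \<equiv> Vector_Spaces.linear"

lemmas lin_iff = Vector_Spaces.linear_iff

lemma vector_space_mult: "vector_space ((*) :: 'a::field \<Rightarrow> 'a \<Rightarrow> 'a)"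
  by unfold_locales (simp_all add: distrib_left distrib_right mult.assoc)

text \<open>A copy of the locale \<open>vector_space\<close>, so that definitions in it are not inherited by its global
  interpretation for real vector spaces, where they would shadow the local ones.\<close>

locale lin_space = vector_space scale
  for scale :: "'a::field \<Rightarrow> 'b::ab_group_add \<Rightarrow> 'b"
begin

text \<open>The subspaces at hand lie in function types that are infinite-dimensional in general,
  and \<open>dim\<close> of an infinite-dimensional set is the default value 0. Finiteness is
  therefore carried along as a property of sets. The spanning set may lie outside \<open>V\<close>,
  so that the property passes to subsets.\<close>

definition fin_dim :: "'b set \<Rightarrow> bool" where
  "fin_dim V \<longleftrightarrow> (\<exists>B. finite B \<and> V \<subseteq> span B)"

text \<open>Families rather than sets: vectors that depend on a parameter may coincide for special
  values, and this must count as dependence.\<close>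

definition indep_family :: "nat \<Rightarrow> (nat \<Rightarrow> 'b) \<Rightarrow> bool" where
  "indep_family r a \<longleftrightarrow> (\<forall>t. (\<Sum>j<r. scale (t j) (a j)) = 0 \<longrightarrow> (\<forall>j<r. t j = 0))"

lemma fin_dim_subset: "fin_dim V \<Longrightarrow> U \<subseteq> V \<Longrightarrow> fin_dim U"
  unfolding fin_dim_def by blast

lemma fin_dim_span: "fin_dim V \<Longrightarrow> U \<subseteq> span V \<Longrightarrow> fin_dim U"
  unfolding fin_dim_def by (metis order_trans span_minimal subspace_span)

lemma fin_dim_zero: "fin_dim {0}"
  unfolding fin_dim_def by (rule exI[of _ "{}"]) auto

lemma dim_zero: "dim {0} = 0"
  using dim_eq_card_independent[OF independent_empty] dim_span[of "{}"] by simp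

lemma independent_card_le:
  assumes "fin_dim V" "B \<subseteq> span V" "independent B"
  shows "finite B \<and> card B \<le> dim V"
proof -
  obtain C where C: "C \<subseteq> V" "independent C" "V \<subseteq> span C" "card C = dim V" by (rule basis_exists)
  obtain D where D: "finite D" "V \<subseteq> span D" using assms(1) by (auto simp: fin_dim_def)
  have "finite C" using independent_span_bound[OF D(1) C(2)] C(1) D(2) by blast
  moreover have "B \<subseteq> span C" using assms(2) C(3) by (metis order_trans span_minimal subspace_span)
  ultimately show ?thesis using independent_span_bound[of C B] assms(3) C(4) by auto
qed

lemma fin_dim_basis:
  assumes "fin_dim V"
  obtains B where "B \<subseteq> V" "finite B" "independent B" "V \<subseteq> span B" "card B = dim V"
proof -
  obtain C where C: "C \<subseteq> V" "independent C" "V \<subseteq> span C" "card C = dim V" by (rule basis_exists)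
  then show ?thesis using independent_card_le[OF assms, of C] that span_superset[of V] by blast
qed

lemma dim_subset_fin_dim:
  assumes "fin_dim V" "U \<subseteq> span V"
  shows "dim U \<le> dim V"
proof -
  obtain C where C: "C \<subseteq> U" "independent C" "U \<subseteq> span C" "card C = dim U" by (rule basis_exists)
  show ?thesis using independent_card_le[OF assms(1), of C] C assms(2) by auto
qed

lemma subspace_eq_if_dim_le:
  assumes "fin_dim V" "subspace U" "U \<subseteq> V" "dim V \<le> dim U"
  shows "U = V"
proof (rule ccontr)
  assume "U \<noteq> V"
  then obtain x where x: "x \<in> V" "x \<notin> U" using assms(3) by blast
  obtain B where B: "B \<subseteq> U" "finite B" "independent B" "U \<subseteq> span B" "card B = dim U"
    using fin_dim_basis[OF fin_dim_subset[OF assms(1,3)]] by metis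
  have "x \<notin> span B" using x(2) B(1) assms(2) span_minimal by blast
  then have "independent (insert x B)" "x \<notin> B" using B(3) independent_insertI span_base by auto
  moreover have "insert x B \<subseteq> span V"
    using x(1) B(1) assms(3) span_superset[of V] by blast
  ultimately have "Suc (card B) \<le> dim V"
    using independent_card_le[OF assms(1), of "insert x B"] B(2) by auto
  then show False using assms(4) B(5) by simp
qed

lemma extend_basis_fin_dim:
  assumes "fin_dim V" "B \<subseteq> V" "independent B" "V \<subseteq> span (B \<union> G)" "G \<subseteq> V"
  obtains C where "B \<subseteq> C" "C \<subseteq> B \<union> G" "independent C" "finite C" "V \<subseteq> span C" "card C = dim V"
proof -
  obtain C where C: "B \<subseteq> C" "C \<subseteq> B \<union> G" "independent C" "B \<union> G \<subseteq> span C"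
    using maximal_independent_subset_extend[of B "B \<union> G"] assms(3) by blast
  have "V \<subseteq> span C" using assms(4) C(4) by (metis order_trans span_minimal subspace_span)
  moreover have "C \<subseteq> V" using C(2) assms(2,5) by blast
  ultimately show ?thesis using that[of C] C independent_card_le[OF assms(1), of C]
      basis_card_eq_dim[of C V] span_superset[of V] by blast
qed

lemma indep_family_iff:
  "indep_family r a \<longleftrightarrow> inj_on a {..<r} \<and> independent (a ` {..<r})"
proof
  assume L: "indep_family r a"
  have inj: "inj_on a {..<r}"
  proof (rule inj_onI, rule ccontr)
    fix i j assume ij: "i \<in> {..<r}" "j \<in> {..<r}" "a i = a j" "i \<noteq> j"
    define t where "t = (\<lambda>l. if l = i then 1 else if l = j then -1 else (0::'a))"
    have "(\<Sum>l<r. scale (t l) (a l)) = (\<Sum>l\<in>{i,j}. scale (t l) (a l))"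
      by (rule sum.mono_neutral_right) (use ij in \<open>auto simp: t_def\<close>)
    also have "\<dots> = 0" using ij by (simp add: t_def)
    finally have "t i = 0" using L ij(1) by (auto simp: indep_family_def)
    then show False by (simp add: t_def)
  qed
  have "u v = 0" if u: "(\<Sum>v\<in>a ` {..<r}. scale (u v) v) = 0" and v: "v \<in> a ` {..<r}" for u v
  proof -
    have "(\<Sum>j<r. scale (u (a j)) (a j)) = 0"
      using u by (simp add: sum.reindex[OF inj])
    then have "\<forall>j<r. u (a j) = 0" using L unfolding indep_family_def by (elim allE[of _ "\<lambda>j. u (a j)"]) simp
    then show ?thesis using v by auto
  qed
  then have "independent (a ` {..<r})"
    by (intro independent_if_scalars_zero) auto
  with inj show "inj_on a {..<r} \<and> independent (a ` {..<r})" by simp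
next
  assume R: "inj_on a {..<r} \<and> independent (a ` {..<r})"
  show "indep_family r a" unfolding indep_family_def
  proof (intro allI impI)
    fix t j assume t: "(\<Sum>j<r. scale (t j) (a j)) = 0" and j: "j < r"
    define u where "u = (\<lambda>v. t (inv_into {..<r} a v))"
    have "(\<Sum>v\<in>a ` {..<r}. scale (u v) v) = (\<Sum>j<r. scale (t j) (a j))"
      using R by (subst sum.reindex) (auto simp: u_def intro!: sum.cong)
    then have "(\<Sum>v\<in>a ` {..<r}. scale (u v) v) = 0" using t by simp
    then have "u (a j) = 0" using R j independentD[of "a ` {..<r}" "a ` {..<r}" u "a j"] by auto
    then show "t j = 0" using R j by (simp add: u_def)
  qed
qed

lemma indep_family_of_set:
  assumes "finite B" "independent B"
  obtains a where "indep_family (card B) a" "a ` {..<card B} = B"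
proof -
  obtain a where "bij_betw a {0..<card B} B" using ex_bij_betw_nat_finite[OF assms(1)] by blast
  then show ?thesis using that[of a] assms(2) by (auto simp: indep_family_iff bij_betw_def lessThan_atLeast0)
qed

lemma indep_family_le_dim:
  assumes "indep_family r a" "fin_dim V" "\<And>j. j < r \<Longrightarrow> a j \<in> span V"
  shows "r \<le> dim V"
  using independent_card_le[OF assms(2), of "a ` {..<r}"] assms(1,3)
  by (auto simp: indep_family_iff card_image)

lemma indep_family_span:
  assumes "indep_family r a" "fin_dim V" "\<And>j. j < r \<Longrightarrow> a j \<in> V" "dim V \<le> r"
  shows "V \<subseteq> span (a ` {..<r})"
proof -
  let ?A = "a ` {..<r}"
  have "V \<union> span ?A \<subseteq> span V" using assms(3) span_superset[of V] span_minimal[of ?A "span V"] by auto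
  have "?A \<subseteq> span V" using assms(3) span_superset[of V] by auto
  moreover have "dim (span ?A) = r"
    using assms(1) by (simp add: indep_family_iff dim_eq_card_independent card_image)
  ultimately have "span ?A = span V"
    using assms(4) subspace_eq_if_dim_le[of "span V" "span ?A"] fin_dim_span[OF assms(2), of "span V"]
      span_minimal[of ?A "span V"] by auto
  then show ?thesis using span_superset[of V] by simp
qed

lemma span_image_lessThan: "x \<in> span (a ` {..<r}) \<longleftrightarrow> (\<exists>t. x = (\<Sum>j<r. scale (t j) (a j)))" for r :: nat
proof
  show "\<exists>t. x = (\<Sum>j<r. scale (t j) (a j))" if "x \<in> span (a ` {..<r})"
    using that
  proof (induction r arbitrary: x)
    case 0
    then show ?case by simp
  next
    case (Suc r)
    then have "x \<in> span (insert (a r) (a ` {..<r}))" by (simp add: lessThan_Suc)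
    then obtain k where k: "x - scale k (a r) \<in> span (a ` {..<r})" by (auto simp: span_breakdown_eq)
    from Suc.IH[OF this] obtain t where t: "x - scale k (a r) = (\<Sum>j<r. scale (t j) (a j))" by blast
    have "x = (\<Sum>j<Suc r. scale ((t(r:=k)) j) (a j))" using t by (simp add: algebra_simps)
    then show ?case by blast
  qed
  show "x \<in> span (a ` {..<r})" if "\<exists>t. x = (\<Sum>j<r. scale (t j) (a j))"
    using that by (clarsimp intro!: span_sum span_scale) (simp add: span_base)
qed

lemma exists_functional:
  assumes "subspace S" "x \<notin> S"
  shows "\<exists>f. lin scale (*) f \<and> f x = 1 \<and> (\<forall>y\<in>S. f y = 0)"
proof -
  interpret p: vector_space_pair scale "(*) :: 'a \<Rightarrow> 'a \<Rightarrow> 'a"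
    unfolding vector_space_pair_def using vector_space_mult vector_space_axioms by simp
  obtain B where B: "B \<subseteq> S" "independent B" "S \<subseteq> span B" "card B = dim S" by (rule basis_exists)
  have xB: "x \<notin> span B" using assms B(1) span_minimal by blast
  have ind: "independent (insert x B)" by (rule independent_insertI[OF xB B(2)])
  obtain f where f: "lin scale (*) f" "\<forall>y\<in>insert x B. f y = (if y = x then 1 else 0)"
    using p.linear_independent_extend[OF ind, of "\<lambda>y. if y = x then 1 else 0"] by blast
  interpret f: Vector_Spaces.linear scale "(*)" f by fact
  have "f b = 0" if "b \<in> B" for b
  proof -
    have "b \<noteq> x" using that xB span_base by blast
    then show ?thesis using f(2) that by simp
  qed
  then have "f y = 0" if "y \<in> S" for y
    using f.eq_0_on_span[of B y] that B(3) by blast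
  then show ?thesis using f by auto
qed

lemma exists_right_inverse:
  assumes "vector_space s2" "lin scale s2 f" "subspace V" "f ` V = W"
  shows "\<exists>g. lin s2 scale g \<and> (\<forall>w. g w \<in> V) \<and> (\<forall>w\<in>W. f (g w) = w)"
proof -
  interpret p: vector_space_pair scale s2
    unfolding vector_space_pair_def using assms(1) vector_space_axioms by simp
  show ?thesis
    using p.linear_exists_right_inverse_on[OF assms(2,3)] assms(4) by (auto simp: image_subset_iff)
qed

end

lemma (in vector_space) vector_space_fun_scale: "vector_space (fun_scale scale)"
  by unfold_locales (simp_all add: fun_scale_def fun_eq_iff scale_right_distrib scale_left_distrib)

locale lin_space_pair = vs1: lin_space s1 + vs2: lin_space s2
  for s1 :: "'a::field \<Rightarrow> 'b::ab_group_add \<Rightarrow> 'b" and s2 :: "'a \<Rightarrow> 'c::ab_group_add \<Rightarrow> 'c"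
begin

text \<open>Finite dimension of \<open>V\<close> is a conclusion: the double inductions that prove
  the kernels \<open>K\<close> and the spaces of forms finite-dimensional only know the kernel and
  the image of one contraction.\<close>

lemma rank_nullity:
  assumes lin: "lin s1 s2 f" and V: "vs1.subspace V"
    and ker: "vs1.fin_dim {x\<in>V. f x = 0}" and img: "vs2.fin_dim (f ` V)"
  shows "vs1.fin_dim V" and "vs1.dim V = vs1.dim {x\<in>V. f x = 0} + vs2.dim (f ` V)"
proof -
  interpret f: Vector_Spaces.linear s1 s2 f by fact
  let ?K = "{x\<in>V. f x = 0}"
  obtain C where C: "C \<subseteq> f ` V" "finite C" "vs2.independent C" "f ` V \<subseteq> vs2.span C" "card C = vs2.dim (f ` V)"
    using vs2.fin_dim_basis[OF img] .
  obtain B where B: "B \<subseteq> ?K" "finite B" "vs1.independent B" "?K \<subseteq> vs1.span B" "card B = vs1.dim ?K"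
    using vs1.fin_dim_basis[OF ker] .
  define D where "D = inv_into V f ` C"
  have DV: "D \<subseteq> V" using C(1) by (auto simp: D_def inv_into_into)
  have fi: "f (inv_into V f c) = c" if "c \<in> C" for c using that C(1) by (meson f_inv_into_f subsetD)
  have fD: "f ` D = C" "inj_on f D"
    using fi by (auto simp: D_def image_image inj_on_def)
  have finD: "finite D" using C(2) by (simp add: D_def)
  have indD: "vs1.independent D"
  proof (rule vs1.independent_if_scalars_zero[OF finD])
    fix u x assume u: "(\<Sum>x\<in>D. s1 (u x) x) = 0" and x: "x \<in> D"
    define u' where "u' = (\<lambda>y. u (inv_into D f y))"
    have "(\<Sum>y\<in>C. s2 (u' y) y) = (\<Sum>x\<in>D. s2 (u x) (f x))"
      unfolding fD(1)[symmetric] by (subst sum.reindex[OF fD(2)]) (auto simp: u'_def fD(2) intro!: sum.cong)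
    also have "\<dots> = f (\<Sum>x\<in>D. s1 (u x) x)" by (simp add: f.sum f.scale)
    finally have "(\<Sum>y\<in>C. s2 (u' y) y) = 0" using u f.zero by simp
    then have "u' (f x) = 0" using vs2.independentD[OF C(3,2) subset_refl] x fD(1) by blast
    then show "u x = 0" using x fD(2) by (simp add: u'_def)
  qed
  have zero: "x = 0" if "x \<in> vs1.span D" "f x = 0" for x
  proof -
    have "inj_on f (vs1.span D)" using f.inj_on_span_iff_independent_image[of D] fD C(3) by simp
    then show ?thesis using that f.zero vs1.span_zero[of D] by (metis inj_onD)
  qed
  have span: "V \<subseteq> vs1.span (D \<union> B)"
  proof
    fix x assume x: "x \<in> V"
    then have "f x \<in> vs2.span (f ` D)" using C(4) fD(1) by blast
    then obtain y where y: "y \<in> vs1.span D" "f y = f x" unfolding f.span_image by force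
    have "y \<in> V" using y(1) DV V vs1.span_minimal by blast
    then have "x - y \<in> ?K" using x V y(2) by (simp add: vs1.subspace_diff f.diff)
    then have "x - y \<in> vs1.span B" using B(4) by blast
    then have "y + (x - y) \<in> vs1.span (D \<union> B)"
      using y(1) vs1.span_mono[of D "D \<union> B"] vs1.span_mono[of B "D \<union> B"] by (intro vs1.span_add) auto
    then show "x \<in> vs1.span (D \<union> B)" by simp
  qed
  show "vs1.fin_dim V" unfolding vs1.fin_dim_def using span finD B(2) by (intro exI[of _ "D \<union> B"]) auto
  have spB: "f x = 0" if "x \<in> vs1.span B" for x
    using that by (rule f.eq_0_on_span[rotated]) (use B(1) in auto)
  have disj: "D \<inter> B = {}"
  proof -
    have "x \<notin> B" if "x \<in> D" for x
    proof
      assume "x \<in> B"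
      then have "x = 0" using zero[OF vs1.span_base[OF that]] B(1) by auto
      then show False using \<open>x \<in> B\<close> B(3) vs1.dependent_zero by blast
    qed
    then show ?thesis by blast
  qed
  have ind: "vs1.independent (D \<union> B)"
  proof (rule vs1.independent_if_scalars_zero)
    show "finite (D \<union> B)" using finD B(2) by simp
    fix u x assume u: "(\<Sum>x\<in>D \<union> B. s1 (u x) x) = 0" and x: "x \<in> D \<union> B"
    have eq: "(\<Sum>x\<in>D. s1 (u x) x) + (\<Sum>x\<in>B. s1 (u x) x) = 0"
      using u sum.union_disjoint[OF finD B(2) disj] by metis
    have b: "f (\<Sum>x\<in>B. s1 (u x) x) = 0"
      by (rule spB) (intro vs1.span_sum vs1.span_scale vs1.span_base)
    have d: "f (\<Sum>x\<in>D. s1 (u x) x) = 0"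
      using arg_cong[OF eq, of f] b by (simp add: f.add f.zero)
    then have d0: "(\<Sum>x\<in>D. s1 (u x) x) = 0"
      by (rule zero[rotated]) (intro vs1.span_sum vs1.span_scale vs1.span_base)
    then have b0: "(\<Sum>x\<in>B. s1 (u x) x) = 0" using eq by simp
    show "u x = 0" using x vs1.independentD[OF indD finD subset_refl d0] vs1.independentD[OF B(3,2) subset_refl b0]
      by blast
  qed
  have "card (D \<union> B) = vs1.dim V"
    using DV B(1) span ind by (intro vs1.basis_card_eq_dim) auto
  moreover have "card D = card C" using fD by (metis card_image)
  ultimately show "vs1.dim V = vs1.dim ?K + vs2.dim (f ` V)"
    using card_Un_disjoint[OF finD B(2) disj] C(5) B(5) by simp
qed

lemma fin_dim_image:
  assumes "lin s1 s2 f" "vs1.fin_dim V"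
  shows "vs2.fin_dim (f ` V)"
proof -
  interpret f: Vector_Spaces.linear s1 s2 f by fact
  obtain B where "finite B" "V \<subseteq> vs1.span B" using assms(2) by (auto simp: vs1.fin_dim_def)
  then show ?thesis unfolding vs2.fin_dim_def
    by (intro exI[of _ "f ` B"]) (auto simp: f.span_image)
qed

lemma rank_nullity_fin_dim:
  assumes "lin s1 s2 f" "vs1.subspace V" "vs1.fin_dim V"
  shows "vs1.dim V = vs1.dim {x\<in>V. f x = 0} + vs2.dim (f ` V)"
  by (rule rank_nullity(2)[OF assms(1,2) vs1.fin_dim_subset[OF assms(3)] fin_dim_image[OF assms(1,3)]]) auto

end

section \<open>Dimension of a quotient\<close>

context lin_space
begin

lemma quotient_basis:
  assumes Z: "subspace Z" "fin_dim Z" and B: "subspace B" "B \<subseteq> Z"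
  shows "\<exists>C. finite C \<and> card C = dim Z - dim B \<and> C \<subseteq> Z \<and>
      (\<forall>a. (\<Sum>c\<in>C. scale (a c) c) \<in> B \<longrightarrow> (\<forall>c\<in>C. a c = 0)) \<and>
      (\<forall>z\<in>Z. \<exists>a. z - (\<Sum>c\<in>C. scale (a c) c) \<in> B)"
proof -
  obtain B0 where B0: "B0 \<subseteq> B" "finite B0" "independent B0" "B \<subseteq> span B0" "card B0 = dim B"
    using fin_dim_basis[OF fin_dim_subset[OF Z(2) B(2)]] .
  have spB: "span B0 = B" using B0 B(1) span_subspace by blast
  obtain D where D: "B0 \<subseteq> D" "D \<subseteq> B0 \<union> Z" "independent D" "finite D" "Z \<subseteq> span D" "card D = dim Z"
    using extend_basis_fin_dim[OF Z(2), of B0 Z] B0 B(2) span_superset[of "B0 \<union> Z"] by blast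
  define C where "C = D - B0"
  have finC: "finite C" "C \<inter> B0 = {}" "D = C \<union> B0" using D(1,4) by (auto simp: C_def)
  have split: "(\<Sum>x\<in>D. scale (u x) x) = (\<Sum>x\<in>C. scale (u x) x) + (\<Sum>x\<in>B0. scale (u x) x)" for u
    using sum.union_disjoint[OF finC(1) B0(2) finC(2)] finC(3) by metis
  have i: "\<forall>c\<in>C. a c = 0" if a: "(\<Sum>c\<in>C. scale (a c) c) \<in> B" for a
  proof -
    have "(\<Sum>c\<in>C. scale (a c) c) \<in> span B0" using a spB by simp
    then obtain b where b: "(\<Sum>c\<in>C. scale (a c) c) = (\<Sum>x\<in>B0. scale (b x) x)"
      using span_finite[OF B0(2)] by auto
    define u where "u = (\<lambda>x. if x \<in> C then a x else - b x)"
    have "(\<Sum>x\<in>B0. scale (u x) x) = - (\<Sum>x\<in>B0. scale (b x) x)"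
      unfolding sum_negf[symmetric] using finC(2) by (intro sum.cong) (auto simp: u_def)
    moreover have "(\<Sum>x\<in>C. scale (u x) x) = (\<Sum>x\<in>C. scale (a x) x)" by (simp add: u_def)
    ultimately have "(\<Sum>x\<in>D. scale (u x) x) = 0" using split[of u] b by simp
    then have "\<forall>x\<in>D. u x = 0" using independentD[OF D(3,4) subset_refl] by blast
    then show ?thesis using finC(3) unfolding u_def by (metis UnI1)
  qed
  have ii: "\<exists>a. z - (\<Sum>c\<in>C. scale (a c) c) \<in> B" if "z \<in> Z" for z
  proof -
    have "z \<in> span D" using that D(5) by blast
    then obtain u where "z = (\<Sum>x\<in>D. scale (u x) x)" using span_finite[OF D(4)] by auto
    then have "z - (\<Sum>c\<in>C. scale (u c) c) = (\<Sum>x\<in>B0. scale (u x) x)" using split[of u] by simp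
    also have "\<dots> \<in> B" unfolding spB[symmetric] by (intro span_sum span_scale) (simp add: span_base)
    finally show ?thesis by blast
  qed
  have "card C = dim Z - dim B" using D(1,4,6) B0(5,2) by (simp add: C_def card_Diff_subset)
  moreover have "C \<subseteq> Z" using D(2) by (auto simp: C_def)
  ultimately show ?thesis using i ii finC(1) by blast
qed

lemma independent_mod:
  assumes B: "subspace B" "fin_dim B"
    and C: "finite C" "\<And>a. (\<Sum>c\<in>C. scale (a c) c) \<in> B \<Longrightarrow> \<forall>c\<in>C. a c = 0"
  obtains B0 where "B0 \<subseteq> B" "finite B0" "card B0 = dim B" "span B0 = B" "C \<inter> B0 = {}" "independent (C \<union> B0)"
proof -
  obtain B0 where B0: "B0 \<subseteq> B" "finite B0" "independent B0" "B \<subseteq> span B0" "card B0 = dim B"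
    using fin_dim_basis[OF B(2)] .
  have spB: "span B0 = B" using B0 B(1) span_subspace by blast
  have i: "c \<in> C \<Longrightarrow> (\<Sum>c\<in>C. scale (a c) c) \<in> B \<Longrightarrow> a c = 0" for c a using C(2) by blast
  note finC = C(1)
  have disj: "C \<inter> B0 = {}"
  proof -
    have "c \<notin> B" if "c \<in> C" for c
    proof
      assume "c \<in> B"
      moreover have "(\<Sum>x\<in>C. scale (if x = c then 1 else 0) x) = (\<Sum>x\<in>{c}. scale (if x = c then 1 else 0) x)"
        by (rule sum.mono_neutral_right) (use that finC in auto)
      ultimately show False using i[OF that, of "\<lambda>x. if x = c then 1 else 0"] by simp
    qed
    then show ?thesis using B0(1) by blast
  qed
  have "independent (C \<union> B0)"
  proof (rule independent_if_scalars_zero)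
    show "finite (C \<union> B0)" using finC B0 by simp
    fix u x assume u: "(\<Sum>x\<in>C \<union> B0. scale (u x) x) = 0" and x: "x \<in> C \<union> B0"
    have eq: "(\<Sum>x\<in>C. scale (u x) x) + (\<Sum>x\<in>B0. scale (u x) x) = 0"
      using u sum.union_disjoint[OF finC B0(2) disj] by metis
    have "(\<Sum>x\<in>B0. scale (u x) x) \<in> B" unfolding spB[symmetric] by (intro span_sum span_scale) (simp add: span_base)
    then have "(\<Sum>x\<in>C. scale (u x) x) \<in> B" using eq B(1) by (metis add_eq_0_iff2 subspace_neg)
    then have C0: "\<forall>c\<in>C. u c = 0" using i by blast
    then have "(\<Sum>x\<in>B0. scale (u x) x) = 0" using eq by simp
    then show "u x = 0" using C0 x independentD[OF B0(3,2) subset_refl] by blast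
  qed
  then show ?thesis using that B0 spB disj by blast
qed

text \<open>Without the spanning half of a quotient basis only an inequality remains. This is what
  is available after a perturbation, where independence modulo \<open>B\<close> survives and
  spanning may be lost.\<close>

lemma independent_mod_card:
  assumes Z: "fin_dim Z" and B: "subspace B" "B \<subseteq> Z"
    and C: "finite C" "C \<subseteq> Z" "\<And>a. (\<Sum>c\<in>C. scale (a c) c) \<in> B \<Longrightarrow> \<forall>c\<in>C. a c = 0"
  shows "card C + dim B \<le> dim Z"
proof -
  obtain B0 where B0: "B0 \<subseteq> B" "finite B0" "card B0 = dim B" "C \<inter> B0 = {}" "independent (C \<union> B0)"
    using independent_mod[OF B(1) fin_dim_subset[OF Z B(2)] C(1,3)] by metis
  have "C \<union> B0 \<subseteq> span Z" using C(2) B0(1) B(2) span_superset[of Z] by blast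
  then have "card (C \<union> B0) \<le> dim Z" using independent_card_le[OF Z _ B0(5)] by blast
  then show ?thesis using card_Un_disjoint[OF C(1) B0(2,4)] B0(3) by simp
qed

text \<open>The definite description also needs uniqueness of the size: a quotient basis together
  with a basis of \<open>B\<close> is a basis of \<open>Z\<close>.\<close>

lemma quotient_dim_eq:
  assumes Z: "subspace Z" "fin_dim Z" and B: "subspace B" "B \<subseteq> Z"
  shows "quotient_dim scale Z B = dim Z - dim B"
proof -
  let ?Q = "\<lambda>m C. finite C \<and> card C = m \<and> C \<subseteq> Z \<and>
      (\<forall>a. (\<Sum>c\<in>C. scale (a c) c) \<in> B \<longrightarrow> (\<forall>c\<in>C. a c = 0)) \<and>
      (\<forall>z\<in>Z. \<exists>a. z - (\<Sum>c\<in>C. scale (a c) c) \<in> B)"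
  have un: "m = dim Z - dim B" if Q: "?Q m C" for m C
  proof -
    have finC: "finite C" "C \<subseteq> Z" "card C = m" using Q by auto
    obtain B0 where B0: "B0 \<subseteq> B" "finite B0" "card B0 = dim B" "span B0 = B" "C \<inter> B0 = {}" "independent (C \<union> B0)"
      by (rule independent_mod[OF B(1) fin_dim_subset[OF Z(2) B(2)] finC(1)]) (use Q in blast)+
    have "Z \<subseteq> span (C \<union> B0)"
    proof
      fix z assume "z \<in> Z"
      then obtain a where "z - (\<Sum>c\<in>C. scale (a c) c) \<in> B" using Q by blast
      then have "z - (\<Sum>c\<in>C. scale (a c) c) \<in> span (C \<union> B0)" using B0(4) span_mono[of B0 "C \<union> B0"] by blast
      moreover have "(\<Sum>c\<in>C. scale (a c) c) \<in> span (C \<union> B0)" by (intro span_sum span_scale) (simp add: span_base)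
      ultimately show "z \<in> span (C \<union> B0)" using span_add by fastforce
    qed
    then have "card (C \<union> B0) = dim Z" using finC(2) B0(1,6) B(2) by (intro basis_card_eq_dim) auto
    then show ?thesis using card_Un_disjoint[OF finC(1) B0(2,5)] finC(3) B0(3) by simp
  qed
  show ?thesis unfolding quotient_dim_def using quotient_basis[OF assms] un by (intro the_equality) blast+
qed

end


subsection \<open>Algebras of functions\<close>

text \<open>Elimination is carried out once for two algebras, the polynomials in the parameter of a
  pencil and the polynomial functions of a coframe.\<close>

definition fun_algebra :: "('p \<Rightarrow> 'a::comm_ring_1) set \<Rightarrow> bool" where
  "fun_algebra R \<longleftrightarrow> (\<forall>c. (\<lambda>_. c) \<in> R) \<and>
     (\<forall>f\<in>R. \<forall>g\<in>R. (\<lambda>p. f p + g p) \<in> R \<and> (\<lambda>p. f p * g p) \<in> R)"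

lemma fun_algebra_const: "fun_algebra R \<Longrightarrow> (\<lambda>_. c) \<in> R"
  and fun_algebra_add: "fun_algebra R \<Longrightarrow> f \<in> R \<Longrightarrow> g \<in> R \<Longrightarrow> (\<lambda>p. f p + g p) \<in> R"
  and fun_algebra_mult: "fun_algebra R \<Longrightarrow> f \<in> R \<Longrightarrow> g \<in> R \<Longrightarrow> (\<lambda>p. f p * g p) \<in> R"
  unfolding fun_algebra_def by blast+

lemma fun_algebra_diff:
  assumes "fun_algebra R" "f \<in> R" "g \<in> R"
  shows "(\<lambda>p. f p - g p) \<in> R"
  using fun_algebra_add[OF assms(1,2) fun_algebra_mult[OF assms(1) fun_algebra_const[OF assms(1), of "-1"] assms(3)]]
  by simp

lemma fun_algebra_sum:
  assumes "fun_algebra R" "\<And>x. x \<in> X \<Longrightarrow> f x \<in> R"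
  shows "(\<lambda>p. \<Sum>x\<in>X. f x p) \<in> R"
  using assms(2)
  by (induction X rule: infinite_finite_induct)
     (auto intro!: fun_algebra_const fun_algebra_add assms(1))

lemma fun_algebra_prod:
  assumes "fun_algebra R" "\<And>x. x \<in> X \<Longrightarrow> f x \<in> R"
  shows "(\<lambda>p. \<Prod>x\<in>X. f x p) \<in> R"
  using assms(2)
  by (induction X rule: infinite_finite_induct)
     (auto intro!: fun_algebra_const fun_algebra_mult assms(1))

text \<open>Fraction-free elimination: \<open>c\<close> is a product of minors of the matrix \<open>a\<close>, so that it is nonzero near
  \<open>p0\<close>, and dividing \<open>b\<close> by it would give a dual family.\<close>

lemma dual_minors:
  fixes a :: "nat \<Rightarrow> 'p \<Rightarrow> 'i \<Rightarrow> 'a::field"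
  assumes R: "fun_algebra R"
    and a: "\<And>j x. j < r \<Longrightarrow> x \<in> I \<Longrightarrow> (\<lambda>p. a j p x) \<in> R"
    and ind: "\<And>t. (\<And>x. x \<in> I \<Longrightarrow> (\<Sum>j<r. t j * a j p0 x) = 0) \<Longrightarrow> \<forall>j<r. t j = 0"
  shows "\<exists>c b X. finite X \<and> X \<subseteq> I \<and> c \<in> R \<and> c p0 \<noteq> 0 \<and>
     (\<forall>j<r. \<forall>x\<in>X. (\<lambda>p. b j p x) \<in> R) \<and>
     (\<forall>p. \<forall>i<r. \<forall>j<r. (\<Sum>x\<in>X. b j p x * a i p x) = (if i = j then c p else 0))"
  using a ind
proof (induction r)
  case 0
  show ?case by (rule exI[of _ "\<lambda>_. 1"]) (auto intro!: exI[of _ "{}"] fun_algebra_const[OF R])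
next
  case (Suc r)
  have "\<exists>c b X. finite X \<and> X \<subseteq> I \<and> c \<in> R \<and> c p0 \<noteq> 0 \<and>
     (\<forall>j<r. \<forall>x\<in>X. (\<lambda>p. b j p x) \<in> R) \<and>
     (\<forall>p. \<forall>i<r. \<forall>j<r. (\<Sum>x\<in>X. b j p x * a i p x) = (if i = j then c p else 0))"
  proof (rule Suc.IH)
    show "(\<lambda>p. a j p x) \<in> R" if "j < r" "x \<in> I" for j x using Suc.prems(1) that by simp
    fix t :: "nat \<Rightarrow> 'a" assume t: "\<And>x. x \<in> I \<Longrightarrow> (\<Sum>j<r. t j * a j p0 x) = 0"
    have "\<forall>j<Suc r. (t(r:=0)) j = 0"
      by (rule Suc.prems(2)) (use t in simp)
    then show "\<forall>j<r. t j = 0" by (auto simp: less_Suc_eq)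
  qed
  then obtain c b X where X: "finite X" "X \<subseteq> I" and c: "c \<in> R" "c p0 \<noteq> 0"
    and b': "\<forall>j<r. \<forall>x\<in>X. (\<lambda>p. b j p x) \<in> R"
    and dual: "\<forall>p. \<forall>i<r. \<forall>j<r. (\<Sum>x\<in>X. b j p x * a i p x) = (if i = j then c p else 0)"
    by (elim exE conjE) rule
  from b' have b: "(\<lambda>p. b j p x) \<in> R" if "j < r" "x \<in> X" for j x using that by blast
  define \<beta> where "\<beta> = (\<lambda>j p (y::'i \<Rightarrow> 'a). \<Sum>x\<in>X. b j p x * y x)"
  have \<beta>a: "\<beta> j p (a i p) = (if i = j then c p else 0)" if "i < r" "j < r" for i j p
    using dual that by (simp add: \<beta>_def)
  \<comment> \<open>If the new row, reduced by the old ones, vanished on all of \<open>I\<close>,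
    the rows at \<open>p0\<close> would be dependent, with coefficient \<open>c p0\<close> at the
    new one.\<close>
  have "\<exists>x\<in>I. c p0 * a r p0 x - (\<Sum>j<r. \<beta> j p0 (a r p0) * a j p0 x) \<noteq> 0"
  proof (rule ccontr)
    assume neg: "\<not> ?thesis"
    have "\<forall>j<Suc r. ((\<lambda>j. - \<beta> j p0 (a r p0))(r := c p0)) j = 0"
      by (rule Suc.prems(2)) (use neg in \<open>auto simp: sum_negf\<close>)
    then show False using c(2) by auto
  qed
  then obtain x0 where x0: "x0 \<in> I" "c p0 * a r p0 x0 - (\<Sum>j<r. \<beta> j p0 (a r p0) * a j p0 x0) \<noteq> 0"
    by blast
  \<comment> \<open>Evaluation at \<open>x0\<close>, scaled by \<open>c\<close> and corrected so as
    to kill the old rows. Its value \<open>c'\<close> on the new row is the next pivot.\<close>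
  define \<mu> where "\<mu> = (\<lambda>p y. c p * y x0 - (\<Sum>j<r. \<beta> j p y * a j p x0))"
  define X' where "X' = insert x0 X"
  have finX': "finite X'" "X' \<subseteq> I" using X x0 by (auto simp: X'_def)
  define l where "l = (\<lambda>p x. (if x = x0 then c p else 0) - (\<Sum>j<r. (if x \<in> X then b j p x else 0) * a j p x0))"
  have sumX: "(\<Sum>x\<in>X'. (if x \<in> X then f x else 0) * y x) = (\<Sum>x\<in>X. f x * y x)" for f y :: "'i \<Rightarrow> 'a"
  proof -
    have "(\<Sum>x\<in>X. f x * y x) = (\<Sum>x\<in>X. (if x \<in> X then f x else 0) * y x)" by simp
    also have "\<dots> = (\<Sum>x\<in>X'. (if x \<in> X then f x else 0) * y x)"
      by (rule sum.mono_neutral_left) (use finX' in \<open>auto simp: X'_def\<close>)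
    finally show ?thesis by simp
  qed
  have l: "(\<Sum>x\<in>X'. l p x * y x) = \<mu> p y" for p y
  proof -
    have "(\<Sum>x\<in>X'. l p x * y x) = (\<Sum>x\<in>X'. (if x = x0 then c p else 0) * y x)
        - (\<Sum>x\<in>X'. \<Sum>j<r. ((if x \<in> X then b j p x else 0) * y x) * a j p x0)"
      by (simp add: l_def sum_subtractf[symmetric] left_diff_distrib sum_distrib_right)
        (simp add: mult_ac)
    also have "(\<Sum>x\<in>X'. (if x = x0 then c p else 0) * y x) = c p * y x0"
      using finX' by (simp add: X'_def if_distrib[of "\<lambda>u. u * _"] cong: if_cong)
    also have "(\<Sum>x\<in>X'. \<Sum>j<r. ((if x \<in> X then b j p x else 0) * y x) * a j p x0)
        = (\<Sum>j<r. \<beta> j p y * a j p x0)"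
      by (subst sum.swap) (simp add: sum_distrib_right[symmetric] sumX \<beta>_def)
    finally show ?thesis by (simp add: \<mu>_def)
  qed
  define c' where "c' = (\<lambda>p. \<mu> p (a r p))"
  have la: "\<mu> p (a i p) = (if i = r then c' p else 0)" if "i < Suc r" for i p
  proof (cases "i = r")
    case False
    then have "i < r" using that by simp
    then have "(\<Sum>j<r. \<beta> j p (a i p) * a j p x0) = (\<Sum>j<r. if j = i then c p * a i p x0 else 0)"
      by (intro sum.cong) (auto simp: \<beta>a)
    then show ?thesis using False \<open>i < r\<close> by (simp add: \<mu>_def)
  qed (simp add: c'_def)
  \<comment> \<open>The old functionals are scaled by \<open>c'\<close> and corrected by
    \<open>\<mu>\<close> to kill the new row; \<open>\<mu>\<close> itself is scaled by
    \<open>c\<close>. Thus all diagonal entries become \<open>c p * c' p\<close>.\<close>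
  define b' where "b' = (\<lambda>j p x. if j = r then c p * l p x
     else c' p * (if x \<in> X then b j p x else 0) - \<beta> j p (a r p) * l p x)"
  have \<beta>R: "(\<lambda>p. \<beta> j p (a r p)) \<in> R" if "j < r" for j
    unfolding \<beta>_def
    by (intro fun_algebra_sum fun_algebra_mult R b that Suc.prems(1)) (use X in auto)
  have lR: "(\<lambda>p. l p x) \<in> R" if "x \<in> X'" for x
  proof -
    have "(\<lambda>p. if x = x0 then c p else 0) \<in> R"
      by (cases "x = x0") (auto intro: c fun_algebra_const[OF R])
    moreover have "(\<lambda>p. if x \<in> X then b j p x else 0) \<in> R" if "j < r" for j
      by (cases "x \<in> X") (auto intro: b that fun_algebra_const[OF R])
    ultimately show ?thesis unfolding l_def
      by (intro fun_algebra_diff fun_algebra_sum fun_algebra_mult R Suc.prems(1)) (use x0 in auto)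
  qed
  have c'R: "c' \<in> R"
    unfolding c'_def \<mu>_def
    by (intro fun_algebra_diff fun_algebra_sum fun_algebra_mult R Suc.prems(1) \<beta>R c) (use x0 in auto)
  have b'R: "(\<lambda>p. b' j p x) \<in> R" if "j < Suc r" "x \<in> X'" for j x
  proof (cases "j = r")
    case True
    then show ?thesis by (auto simp: b'_def intro!: fun_algebra_mult R c lR that)
  next
    case False
    then have "j < r" using that by simp
    moreover have "(\<lambda>p. if x \<in> X then b j p x else 0) \<in> R"
      by (cases "x \<in> X") (auto intro: b \<open>j < r\<close> fun_algebra_const[OF R])
    ultimately show ?thesis using False
      by (auto simp: b'_def intro!: fun_algebra_diff fun_algebra_mult R c'R \<beta>R lR that)
  qed
  have dual': "(\<Sum>x\<in>X'. b' j p x * a i p x) = (if i = j then c p * c' p else 0)"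
    if "i < Suc r" "j < Suc r" for p i j
  proof (cases "j = r")
    case True
    then have "(\<Sum>x\<in>X'. b' j p x * a i p x) = c p * (\<Sum>x\<in>X'. l p x * a i p x)"
      by (simp add: b'_def sum_distrib_left mult_ac)
    also have "\<dots> = c p * \<mu> p (a i p)" by (simp add: l)
    finally show ?thesis using la[OF that(1)] True by simp
  next
    case False
    then have j: "j < r" using that by simp
    have "(\<Sum>x\<in>X'. b' j p x * a i p x)
        = (\<Sum>x\<in>X'. c' p * ((if x \<in> X then b j p x else 0) * a i p x) - \<beta> j p (a r p) * (l p x * a i p x))"
      using False by (intro sum.cong) (simp_all add: b'_def left_diff_distrib mult.assoc)
    also have "\<dots> = c' p * \<beta> j p (a i p) - \<beta> j p (a r p) * \<mu> p (a i p)"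
      by (simp only: sum_subtractf sum_distrib_left[symmetric] l sumX) (simp add: \<beta>_def)
    finally have *: "(\<Sum>x\<in>X'. b' j p x * a i p x) = c' p * \<beta> j p (a i p) - \<beta> j p (a r p) * \<mu> p (a i p)" .
    show ?thesis
    proof (cases "i = r")
      case True
      then show ?thesis using * la[of r p] j by simp
    next
      case i: False
      then have "i < r" using that by simp
      then show ?thesis using * la[OF that(1), of p] \<beta>a[OF _ j, of i p] i by simp
    qed
  qed
  show ?case
  proof (intro exI conjI)
    show "finite X'" "X' \<subseteq> I" using finX' by auto
    show "(\<lambda>p. c p * c' p) \<in> R" by (intro fun_algebra_mult R c c'R)
    show "c p0 * c' p0 \<noteq> 0" using c x0(2) by (simp add: c'_def \<mu>_def)
    show "\<forall>j<Suc r. \<forall>x\<in>X'. (\<lambda>p. b' j p x) \<in> R" using b'R by blast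
    show "\<forall>p. \<forall>i<Suc r. \<forall>j<Suc r. (\<Sum>x\<in>X'. b' j p x * a i p x) = (if i = j then c p * c' p else 0)"
      using dual' by blast
  qed
qed

lemma fun_algebra_poly: "fun_algebra {poly q | q. True}"
  unfolding fun_algebra_def
proof (intro conjI allI ballI)
  show "(\<lambda>_. c) \<in> {poly q | q. True}" for c :: 'a
    by (simp, rule exI[of _ "[:c:]"]) auto
  fix f g :: "'a \<Rightarrow> 'a"
  assume "f \<in> {poly q | q. True}" "g \<in> {poly q | q. True}"
  then obtain p q where pq: "f = poly p" "g = poly q" by blast
  have "(\<lambda>x. f x + g x) = poly (p + q)" "(\<lambda>x. f x * g x) = poly (p * q)" by (auto simp: pq)
  then show "(\<lambda>x. f x + g x) \<in> {poly q | q. True}" "(\<lambda>x. f x * g x) \<in> {poly q | q. True}" by blast+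
qed


subsection \<open>Binomial identities\<close>

text \<open>Inversion of the Pascal matrix: trinomial revision turns the sum into an alternating row
  sum. The upper end \<open>M\<close> is free, so that one range of summation serves all
  \<open>m\<close>.\<close>

lemma binomial_orthogonality:
  assumes "q \<le> m" "m \<le> M"
  shows "(\<Sum>p=q..M. (-1) ^ (p - q) * int (p choose q) * int (m choose p)) = (if m = q then 1 else 0)"
proof -
  have "(\<Sum>p=q..M. (-1) ^ (p - q) * int (p choose q) * int (m choose p))
      = (\<Sum>p=q..m. (-1) ^ (p - q) * int (p choose q) * int (m choose p))"
    by (rule sum.mono_neutral_right) (use assms in auto)
  also have "\<dots> = (\<Sum>p=q..m. (-1) ^ (p - q) * (int (m choose q) * int ((m - q) choose (p - q))))"
  proof (rule sum.cong[OF refl])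
    fix p assume "p \<in> {q..m}"
    then have "(m choose p) * (p choose q) = (m choose q) * ((m - q) choose (p - q))"
      by (intro choose_mult) auto
    then have "int (p choose q) * int (m choose p) = int (m choose q) * int ((m - q) choose (p - q))"
      by (metis mult.commute of_nat_mult)
    then show "(-1) ^ (p - q) * int (p choose q) * int (m choose p)
      = (-1) ^ (p - q) * (int (m choose q) * int ((m - q) choose (p - q)))" by (simp add: mult.assoc)
  qed
  also have "\<dots> = int (m choose q) * (\<Sum>i\<le>m - q. (-1) ^ i * int ((m - q) choose i))"
  proof -
    have "(\<Sum>p=q..m. (-1) ^ (p - q) * (int (m choose q) * int ((m - q) choose (p - q))))
      = (\<Sum>i=0..m-q. (-1) ^ i * (int (m choose q) * int ((m - q) choose i)))"
      by (rule sum.reindex_bij_witness[of _ "\<lambda>i. i + q" "\<lambda>p. p - q"]) (use assms in auto)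
    then show ?thesis by (simp add: sum_distrib_left atMost_atLeast0 mult_ac)
  qed
  also have "\<dots> = (if m = q then 1 else 0)"
  proof (cases "m = q")
    case False
    then show ?thesis using choose_alternating_sum[of "m - q", where ?'a = int] assms by simp
  qed simp
  finally show ?thesis .
qed

text \<open>The recursion moves along lattice paths, so the differences in column 0 are weighted by
  numbers of paths. It is applied to the dimensions of \<open>K\<close>, where the recursion is
  rank-nullity for a surjective contraction, and to the binomial coefficients of the free
  system.\<close>

lemma pascal_array:
  fixes F :: "nat \<Rightarrow> nat \<Rightarrow> int"
  assumes rec: "\<And>i m. i < n \<Longrightarrow> m < M \<Longrightarrow> F i (Suc m) = F (Suc i) (Suc m) + F i m"
    and zero: "\<And>m. m \<le> M \<Longrightarrow> F n m = 0"
    and "i \<le> n" "m \<le> M"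
  shows "F i m = (\<Sum>l=Suc i..n. (F (l - 1) 0 - F l 0) * int ((m + l - Suc i) choose (l - Suc i)))"
  using assms(3,4)
proof (induction i arbitrary: m rule: inc_induct)
  case base
  then show ?case by (simp add: zero)
next
  case (step i)
  let ?s = "\<lambda>l. F (l - 1) 0 - F l 0"
  have split: "(\<Sum>l=Suc i..n. f l) = f (Suc i) + (\<Sum>l=Suc (Suc i)..n. f l)" for f :: "nat \<Rightarrow> int"
    using step.hyps by (simp add: sum.atLeast_Suc_atMost)
  show ?case using step.prems
  proof (induction m)
    case 0
    have "(\<Sum>l=Suc i..n. ?s l) = F i 0 - F n 0"
    proof -
      have "(\<Sum>l=Suc i..n. ?s l) = (\<Sum>l=i..<n. F l 0 - F (Suc l) 0)"
        by (rule sum.reindex_bij_witness[of _ Suc "\<lambda>l. l - 1"]) (use step.hyps in auto)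
      also have "\<dots> = F i 0 - F n 0"
        using sum_Suc_diff'[of i n "\<lambda>l. - F l 0"] step.hyps by simp
      finally show ?thesis .
    qed
    then show ?case using zero[of 0] by simp
  next
    case (Suc m)
    have "F i (Suc m) = F (Suc i) (Suc m) + F i m" using rec step.hyps Suc.prems by simp
    also have "\<dots> = (\<Sum>l=Suc (Suc i)..n. ?s l * int ((Suc m + l - Suc (Suc i)) choose (l - Suc (Suc i))))
        + (\<Sum>l=Suc i..n. ?s l * int ((m + l - Suc i) choose (l - Suc i)))"
      using step.IH[of "Suc m"] Suc by simp
    also have "\<dots> = ?s (Suc i) + (\<Sum>l=Suc (Suc i)..n. ?s l *
        (int ((Suc m + l - Suc (Suc i)) choose (l - Suc (Suc i))) + int ((m + l - Suc i) choose (l - Suc i))))"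
      unfolding split[of "\<lambda>l. ?s l * int ((m + l - Suc i) choose (l - Suc i))"]
      by (simp add: sum.distrib distrib_left)
    also have "\<dots> = ?s (Suc i) + (\<Sum>l=Suc (Suc i)..n. ?s l * int ((Suc m + l - Suc i) choose (l - Suc i)))"
    proof -
      have "int ((Suc m + l - Suc (Suc i)) choose (l - Suc (Suc i))) + int ((m + l - Suc i) choose (l - Suc i))
         = int ((Suc m + l - Suc i) choose (l - Suc i))" if l: "l \<in> {Suc (Suc i)..n}" for l
      proof -
        obtain u where u: "l = Suc (Suc i) + u" using l by (auto simp: nat_le_iff_add)
        show ?thesis by (simp add: u binomial_Suc_Suc flip: of_nat_add)
      qed
      then show ?thesis by simp
    qed
    finally show ?case unfolding split by simp
  qed
qed

section \<open>Generating functions\<close>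

unbundle fps_syntax

text \<open>\<open>negbin l\<close> is the power series \<open>(1 - X)\<^sup>-\<^sup>l\<close>.\<close>

definition negbin :: "nat \<Rightarrow> int fps" where
  "negbin l = Abs_fps (\<lambda>m. int ((m + l - 1) choose m))"

lemma one_minus_X_negbin_Suc: "(1 - fps_X) * negbin (Suc l) = negbin l"
proof (rule fps_ext)
  fix m
  show "((1 - fps_X) * negbin (Suc l)) $ m = negbin l $ m"
  proof (cases m)
    case (Suc u)
    then show ?thesis
      by (simp add: negbin_def left_diff_distrib binomial_Suc_Suc flip: of_nat_add)
  qed (simp add: negbin_def left_diff_distrib)
qed

text \<open>The truncated subtraction matters: at \<open>m = 0\<close> the coefficient is 0 over 0,
  which is 1, and afterwards it is \<open>m - 1\<close> over \<open>m\<close>, which is 0.\<close>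

lemma negbin_0: "negbin 0 = 1"
  by (rule fps_ext) (simp add: negbin_def binomial_eq_0)

lemma one_minus_X_power_negbin: "l \<le> n \<Longrightarrow> (1 - fps_X) ^ n * negbin l = (1 - fps_X) ^ (n - l)"
proof (induction l arbitrary: n)
  case 0
  then show ?case by (simp add: negbin_0)
next
  case (Suc l)
  then obtain n' where n: "n = Suc n'" by (cases n) auto
  have "(1 - fps_X) ^ n * negbin (Suc l) = (1 - fps_X) ^ n' * ((1 - fps_X) * negbin (Suc l))"
    by (simp add: n mult_ac)
  then show ?case using Suc n by (simp add: one_minus_X_negbin_Suc)
qed

lemma one_minus_X_power_nth: "((1 - fps_X) ^ n :: int fps) $ j = (-1) ^ j * int (n choose j)"
proof (induction n arbitrary: j)
  case 0
  then show ?case by (cases j) auto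
next
  case (Suc n)
  show ?case
    by (cases j) (simp_all add: left_diff_distrib Suc binomial_Suc_Suc algebra_simps)
qed

lemma one_minus_X_power_times_nth:
  "((1 - fps_X) ^ n * G) $ m = (\<Sum>j\<le>m. (-1) ^ j * int (n choose j) * G $ (m - j))" for G :: "int fps"
  by (simp add: fps_mult_nth one_minus_X_power_nth atMost_atLeast0)

text \<open>The case of the free system, with all of \<open>S^k T*\<close> as symbol:
  \<open>F i m\<close> counts the monomials of degree \<open>k + m\<close> in \<open>n - i\<close>
  variables, and the first binomial coefficients on the right are the characters of this
  system.\<close>

lemma choose_expand_tail:
  assumes "k \<ge> 1" "n \<ge> 1"
  shows "int ((n + (k + u) - 1) choose (k + u))
     = (\<Sum>l=1..n. int ((n + k - l - 1) choose (k - 1)) * int ((u + l - 1) choose (l - 1)))"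
proof -
  define F where "F = (\<lambda>i m. int ((n - i + (k + m) - 1) choose (k + m)))"
  have rec: "F i (Suc m) = F (Suc i) (Suc m) + F i m" if "i < n" for i m
  proof -
    obtain d where d: "n = Suc i + d" using less_imp_Suc_add[OF \<open>i < n\<close>] by auto
    show ?thesis by (simp add: F_def d binomial_Suc_Suc)
  qed
  have "F 0 u = (\<Sum>l=Suc 0..n. (F (l - 1) 0 - F l 0) * int ((u + l - Suc 0) choose (l - Suc 0)))"
    by (rule pascal_array[of n u]) (use rec assms in \<open>auto simp: F_def binomial_eq_0\<close>)
  moreover have "F (l - 1) 0 - F l 0 = int ((n + k - l - 1) choose (k - 1))" if "l \<in> {1..n}" for l
  proof -
    obtain d where d: "n = l + d" using \<open>l \<in> {1..n}\<close> by (auto simp: nat_le_iff_add)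
    obtain k' where k: "k = Suc k'" using assms by (cases k) auto
    obtain l' where l: "l = Suc l'" using \<open>l \<in> {1..n}\<close> by (cases l) auto
    show ?thesis by (simp add: F_def d k l binomial_Suc_Suc)
  qed
  ultimately show ?thesis by (simp add: F_def)
qed

text \<open>The generating function of \<open>D\<close>, minus \<open>h\<^sub>0 (1 - X)\<^sup>-\<^sup>n\<close>, is \<open>X\<^sup>k\<close> times a combination of the series
  \<open>(1 - X)\<^sup>-\<^sup>l\<close>; multiplying by \<open>(1 - X)\<^sup>n\<close> expresses \<open>h\<close> by \<open>s\<close>, and this relation is inverted.\<close>

lemma characters_from_euler:
  fixes D s h :: "nat \<Rightarrow> int"
  assumes k: "k \<ge> 1" and D0: "D 0 = h 0"
    and low: "\<And>m. 1 \<le> m \<Longrightarrow> m < k \<Longrightarrow> (\<Sum>j\<le>m. (-1) ^ j * int (n choose j) * D (m - j)) = 0"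
    and high: "\<And>i. 1 \<le> i \<Longrightarrow> i \<le> n \<Longrightarrow>
        (\<Sum>j\<le>k - 1 + i. (-1) ^ j * int (n choose j) * D (k - 1 + i - j)) = (-1) ^ i * h i"
    and Ds: "\<And>u. u < n \<Longrightarrow> D (k + u) = (\<Sum>l=1..n. s l * int ((u + l - 1) choose (l - 1)))"
    and l: "l \<in> {1..n}"
  shows "s l = int ((n + k - l - 1) choose (k - 1)) * h 0 +
       (\<Sum>i = n - l + 1..n. (-1) ^ (i - (n - l)) * int ((i - 1) choose (n - l)) * h i)"
proof -
  have n: "n \<ge> 1" using l by simp
  \<comment> \<open>The difference from the characters of the free system, which produce the term
    with \<open>h 0\<close>.\<close>
  define s' where "s' = (\<lambda>l. s l - h 0 * int ((n + k - l - 1) choose (k - 1)))"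
  define G where "G = Abs_fps D - fps_const (h 0) * negbin n"
  define A where "A = ((1 - fps_X) ^ n :: int fps)"
  have A1: "A * negbin n = 1" by (simp add: A_def one_minus_X_power_negbin)
  have AG: "(A * G) $ m = (\<Sum>j\<le>m. (-1) ^ j * int (n choose j) * D (m - j)) - (if m = 0 then h 0 else 0)" for m
  proof -
    have "A * G = A * Abs_fps D - fps_const (h 0)"
      using A1 by (simp add: G_def right_diff_distrib mult.left_commute[of A])
    then show ?thesis by (simp add: A_def one_minus_X_power_times_nth)
  qed
  \<comment> \<open>The low Euler characteristics make \<open>A * G\<close> vanish below degree
    \<open>k\<close>. Since \<open>A\<close> has constant term 1, \<open>G\<close> vanishes there as
    well.\<close>
  have G0: "G $ m = 0" if "m < k" for m
    using that
  proof (induction m rule: less_induct)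
    case (less m)
    have "(A * G) $ m = 0" using AG[of m] low[of m] D0 less.prems by (cases "m = 0") auto
    moreover have "(A * G) $ m = (\<Sum>j\<in>{0}. (-1) ^ j * int (n choose j) * G $ (m - j))"
      unfolding A_def one_minus_X_power_times_nth
      by (rule sum.mono_neutral_right) (use less in auto)
    ultimately show ?case by simp
  qed
  have Gk: "G $ (k + u) = (\<Sum>l=1..n. s' l * int ((u + l - 1) choose (l - 1)))" if "u < n" for u
  proof -
    have "negbin n $ (k + u) = (\<Sum>l=1..n. int ((n + k - l - 1) choose (k - 1)) * int ((u + l - 1) choose (l - 1)))"
      using choose_expand_tail[OF k n, of u] by (simp add: negbin_def add_ac)
    then show ?thesis using Ds[OF that]
      by (simp add: G_def s'_def left_diff_distrib sum_subtractf sum_distrib_left mult.assoc)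
  qed
  define H where "H = (\<Sum>l=1..n. fps_const (s' l) * negbin l)"
  \<comment> \<open>\<open>G\<close> is \<open>X^k * H\<close> only below degree
    \<open>k + n\<close>, because \<open>Ds\<close> covers \<open>u < n\<close>. The coefficients of
    \<open>A * G\<close> that carry \<open>h 1, ..., h n\<close> see no more than this.\<close>
  have GH: "G $ (k + u) = H $ u" if "u < n" for u
  proof -
    have "int ((u + l - 1) choose (l - 1)) = int ((u + l - 1) choose u)" if "l \<in> {1..n}" for l
      using that binomial_symmetric[of u "u + l - 1"] by auto
    then show ?thesis unfolding Gk[OF that] by (simp add: H_def fps_sum_nth negbin_def)
  qed
  have hi: "h i = - (\<Sum>l=1..n. s' l * int ((n - l) choose (i - 1)))" if i: "1 \<le> i" "i \<le> n" for i
  proof -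
    obtain p where p: "i = Suc p" using i by (cases i) auto
    have "(A * G) $ (k + p) = (\<Sum>j\<le>k + p. (-1) ^ j * int (n choose j) * G $ (k + p - j))"
      by (simp add: A_def one_minus_X_power_times_nth)
    also have "\<dots> = (\<Sum>j\<le>p. (-1) ^ j * int (n choose j) * G $ (k + p - j))"
      by (rule sum.mono_neutral_right) (auto intro!: G0)
    also have "\<dots> = (\<Sum>j\<le>p. (-1) ^ j * int (n choose j) * H $ (p - j))"
      using i p by (intro sum.cong refl) (simp add: GH[symmetric])
    also have "\<dots> = (A * H) $ p" by (simp add: A_def one_minus_X_power_times_nth)
    also have "A * H = (\<Sum>l=1..n. fps_const (s' l) * (1 - fps_X) ^ (n - l))"
      unfolding H_def sum_distrib_left
      by (intro sum.cong refl) (simp add: A_def mult.left_commute one_minus_X_power_negbin)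
    also have "\<dots> $ p = (-1) ^ p * (\<Sum>l=1..n. s' l * int ((n - l) choose p))"
      by (simp add: fps_sum_nth one_minus_X_power_nth sum_distrib_left mult_ac)
    finally have "(A * G) $ (k + p) = (-1) ^ p * (\<Sum>l=1..n. s' l * int ((n - l) choose p))" .
    moreover have "(A * G) $ (k + p) = (-1) ^ i * h i"
      using AG[of "k + p"] high[OF i] k p by (cases k) auto
    ultimately have "(-1) ^ p * (h i + (\<Sum>l=1..n. s' l * int ((n - l) choose p))) = 0"
      using p by (simp add: distrib_left)
    then have "h i + (\<Sum>l=1..n. s' l * int ((n - l) choose p)) = 0" by simp
    then show ?thesis using p by simp
  qed
  have "(\<Sum>i = n - l + 1..n. (-1) ^ (i - (n - l)) * int ((i - 1) choose (n - l)) * h i)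
      = (\<Sum>p = n - l..n - 1. (-1) ^ (Suc p - (n - l)) * int (p choose (n - l)) * h (Suc p))"
    by (rule sum.reindex_bij_witness[of _ Suc "\<lambda>i. i - 1"]) (use l in auto)
  also have "\<dots> = (\<Sum>p = n - l..n - 1. \<Sum>l'=1..n. s' l' * ((-1) ^ (p - (n - l)) * int (p choose (n - l)) * int ((n - l') choose p)))"
  proof (rule sum.cong[OF refl])
    fix p assume p: "p \<in> {n - l..n - 1}"
    have "h (Suc p) = - (\<Sum>l'=1..n. s' l' * int ((n - l') choose p))" using hi[of "Suc p"] p n by auto
    moreover have "(-1) ^ (Suc p - (n - l)) = - ((-1) ^ (p - (n - l)) :: int)" using p by (simp add: Suc_diff_le)
    ultimately show "(-1) ^ (Suc p - (n - l)) * int (p choose (n - l)) * h (Suc p) =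
      (\<Sum>l'=1..n. s' l' * ((-1) ^ (p - (n - l)) * int (p choose (n - l)) * int ((n - l') choose p)))"
      by (simp add: sum_distrib_left mult_ac)
  qed
  also have "\<dots> = (\<Sum>l'=1..n. s' l' * (\<Sum>p = n - l..n - 1. (-1) ^ (p - (n - l)) * int (p choose (n - l)) * int ((n - l') choose p)))"
    by (subst sum.swap) (simp add: sum_distrib_left)
  also have "\<dots> = (\<Sum>l'=1..n. s' l' * (if l' = l then 1 else 0))"
  proof (intro sum.cong refl arg_cong2[where f = "(*)"])
    fix l' assume l': "l' \<in> {1..n}"
    show "(\<Sum>p = n - l..n - 1. (-1) ^ (p - (n - l)) * int (p choose (n - l)) * int ((n - l') choose p)) = (if l' = l then 1 else 0)"
    proof (cases "n - l \<le> n - l'")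
      case True
      then show ?thesis using binomial_orthogonality[OF True, of "n - 1"] l l' by auto
    next
      case False
      then have "int ((n - l') choose p) = 0" if "p \<in> {n - l..n - 1}" for p using that by simp
      then have "(\<Sum>p = n - l..n - 1. (-1) ^ (p - (n - l)) * int (p choose (n - l)) * int ((n - l') choose p)) = 0"
        by (intro sum.neutral) auto
      then show ?thesis using False by auto
    qed
  qed
  also have "\<dots> = s' l" using l by (simp add: if_distrib[of "\<lambda>u. _ * u"] cong: if_cong)
  finally show ?thesis by (simp add: s'_def mult_ac)
qed


subsection \<open>Alternating forms\<close>

text \<open>The exterior differential \<open>\<Sum>\<^sub>a (-1)\<^sup>a P (ys\<^sub>a) (f (ys without ys\<^sub>a))\<close>, written so that Cartan's formula
  \<open>i\<^sub>y d + d i\<^sub>y = P\<^sub>y\<close> holds by definition.\<close>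

fun dd :: "('t \<Rightarrow> 'v \<Rightarrow> 'v::ab_group_add) \<Rightarrow> ('t list \<Rightarrow> 'v) \<Rightarrow> 't list \<Rightarrow> 'v" where
  "dd P f [] = 0"
| "dd P f (y # ys) = P y (f ys) - dd P (\<lambda>zs. f (y # zs)) ys"

text \<open>Used at two levels: with values in \<open>N\<close> for symmetric tensors, and with
  values in functions on lists for forms whose coefficients are symmetric tensors.\<close>

locale tensor_spaces = T: lin_space sT + V: lin_space sV
  for sT :: "'a::field \<Rightarrow> 't::ab_group_add \<Rightarrow> 't" and sV :: "'a \<Rightarrow> 'v::ab_group_add \<Rightarrow> 'v"
begin

abbreviation "Mult m \<equiv> multilinear_maps sT sV m"
abbreviation "Alt j W \<equiv> alt_tensors sT sV j W"
abbreviation "Sym j W \<equiv> sym_tensors sT sV j W"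

sublocale F: lin_space "fun_scale sV"
  unfolding lin_space_def by (rule V.vector_space_fun_scale)

sublocale FF: lin_space_pair "fun_scale sV" "fun_scale sV"
  by unfold_locales

sublocale FV: lin_space_pair "fun_scale sV" sV
  by unfold_locales

sublocale VV: lin_space_pair sV sV
  by unfold_locales

lemma linear_funI:
  fixes L :: "('t list \<Rightarrow> 'v) \<Rightarrow> 't list \<Rightarrow> 'v"
  assumes "\<And>f g. L (f + g) = L f + L g" "\<And>c f. L (fun_scale sV c f) = fun_scale sV c (L f)"
  shows "lin (fun_scale sV) (fun_scale sV) L"
  using assms F.vector_space_axioms by (simp add: lin_iff)

lemma linear_slot:
  assumes "f \<in> Mult m"
  shows "lin sT sV (\<lambda>x. f (us @ x # vs))"
proof (cases "length us + 1 + length vs = m")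
  case True
  then show ?thesis using assms by (simp add: multilinear_maps_def)
next
  case False
  then have "(\<lambda>x. f (us @ x # vs)) = (\<lambda>x. 0)" using assms by (auto simp: multilinear_maps_def)
  then show ?thesis
    using T.vector_space_axioms V.vector_space_axioms by (simp add: lin_iff)
qed

lemma slot_add: "f \<in> Mult m \<Longrightarrow> f (us @ (x + y) # vs) = f (us @ x # vs) + f (us @ y # vs)"
  and slot_scale: "f \<in> Mult m \<Longrightarrow> f (us @ sT c x # vs) = sV c (f (us @ x # vs))"
  using linear_slot[of f m us vs] by (auto simp: lin_iff)

lemma multilinear_length: "f \<in> Mult m \<Longrightarrow> length xs \<noteq> m \<Longrightarrow> f xs = 0"
  by (simp add: multilinear_maps_def)

lemma multilinearI:
  assumes "\<And>xs. length xs \<noteq> m \<Longrightarrow> f xs = 0"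
    and "\<And>us vs. length us + 1 + length vs = m \<Longrightarrow> lin sT sV (\<lambda>x. f (us @ x # vs))"
  shows "f \<in> Mult m"
  using assms by (simp add: multilinear_maps_def)

lemma subspace_multilinear: "F.subspace (Mult m)"
proof (rule F.subspaceI)
  show "0 \<in> Mult m"
    using T.vector_space_axioms V.vector_space_axioms
    by (auto simp: multilinear_maps_def lin_iff)
  show "f + g \<in> Mult m"
    if "f \<in> Mult m" "g \<in> Mult m" for f g
    using that T.vector_space_axioms V.vector_space_axioms
    by (auto simp: multilinear_maps_def lin_iff V.scale_right_distrib algebra_simps)
  show "fun_scale sV c f \<in> Mult m"
    if "f \<in> Mult m" for c f
    using that T.vector_space_axioms V.vector_space_axioms
    by (auto simp: multilinear_maps_def lin_iff V.scale_right_distrib fun_scale_def mult_ac)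
qed

lemma adjacent_swap:
  assumes f: "f \<in> Mult m" and adj: "\<And>us v vs. f (us @ v # v # vs) = 0"
  shows "f (us @ x # y # vs) = - f (us @ y # x # vs)"
proof -
  have "0 = f (us @ (x + y) # (x + y) # vs)" by (simp add: adj)
  also have "\<dots> = f (us @ x # (x + y) # vs) + f (us @ y # (x + y) # vs)"
    by (rule slot_add[OF f])
  also have "\<dots> = f ((us @ [x]) @ (x + y) # vs) + f ((us @ [y]) @ (x + y) # vs)" by simp
  also have "\<dots> = f (us @ x # y # vs) + f (us @ y # x # vs)"
    unfolding slot_add[OF f] by (simp add: adj)
  finally show ?thesis by (metis add_eq_0_iff2)
qed

text \<open>Adjacent swaps bring two equal arguments together. Adjacent arguments are the case that
  can be checked for \<open>dd\<close>, which is defined by recursion on the list.\<close>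

lemma multilinear_zero_if_adjacent:
  assumes f: "f \<in> Mult m" and adj: "\<And>us v vs. f (us @ v # v # vs) = 0"
    and "\<not> distinct xs"
  shows "f xs = 0"
proof -
  have move: "f (us @ x # ms @ x # vs) = 0" for us x ms vs
  proof (induction ms arbitrary: us)
    case (Cons u ms)
    have "f (us @ x # (u # ms) @ x # vs) = - f ((us @ [u]) @ x # ms @ x # vs)"
      using adjacent_swap[OF f adj, of us x u "ms @ x # vs"] by simp
    then show ?case using Cons[of "us @ [u]"] by simp
  qed (simp add: adj)
  obtain us x ms vs where "xs = us @ [x] @ ms @ [x] @ vs" using not_distinct_decomp[OF assms(3)] by blast
  then show ?thesis using move by simp
qed

lemma alt_swap: "f \<in> Alt m W \<Longrightarrow> f (us @ x # y # vs) = - f (us @ y # x # vs)"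
  by (rule adjacent_swap) (auto simp: alt_tensors_def)

lemma alt_zero_if_head_zero:
  assumes f: "f \<in> Alt m W" and "\<And>zs. f (x # zs) = 0" "x \<in> set ys"
  shows "f ys = 0"
proof -
  have "f (us @ x # vs) = 0" for us vs
  proof (induction us arbitrary: vs rule: rev_induct)
    case (snoc u us)
    then show ?case using alt_swap[OF f, of us u x vs] by simp
  qed (simp add: assms(2))
  then show ?thesis using assms(3) by (metis split_list)
qed

lemma alt_interior:
  assumes "f \<in> Alt (Suc j) W"
  shows "(\<lambda>zs. f (y # zs)) \<in> Alt j W"
proof -
  have ml: "f \<in> Mult (Suc j)" using assms by (simp add: alt_tensors_def)
  have "(\<lambda>zs. f (y # zs)) \<in> Mult j"
    by (rule multilinearI) (use ml linear_slot[OF ml, of "y # _"] in \<open>auto simp: multilinear_length[OF ml]\<close>)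
  then show ?thesis using assms by (auto simp: alt_tensors_def)
qed

lemma subspace_alt:
  assumes "V.subspace W"
  shows "F.subspace (Alt j W)"
proof (rule F.subspaceI)
  note ml = F.subspace_0[OF subspace_multilinear] F.subspace_add[OF subspace_multilinear] F.subspace_scale[OF subspace_multilinear]
  show "0 \<in> Alt j W" using assms ml by (auto simp: alt_tensors_def V.subspace_0)
  show "f + g \<in> Alt j W" if "f \<in> Alt j W" "g \<in> Alt j W" for f g
    using assms that ml by (auto simp: alt_tensors_def V.subspace_add)
  show "fun_scale sV c f \<in> Alt j W" if "f \<in> Alt j W" for c f
    using assms that ml by (auto simp: alt_tensors_def V.subspace_scale fun_scale_def)
qed

text \<open>Linearity in the vector \<open>y\<close> is required only on \<open>W\<close>:
  contraction of an arbitrary function on lists is linear in the function but not in the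
  vector.\<close>

definition derivation :: "('t \<Rightarrow> 'v \<Rightarrow> 'v) \<Rightarrow> 'v set \<Rightarrow> 'v set \<Rightarrow> bool" where
  "derivation P W W' \<longleftrightarrow> (\<forall>y. lin sV sV (P y)) \<and>
     (\<forall>w\<in>W. lin sT sV (\<lambda>y. P y w)) \<and> (\<forall>y. \<forall>w\<in>W. P y w \<in> W')"

lemma derivation_add: "derivation P W W' \<Longrightarrow> P y (u + w) = P y u + P y w"
  and derivation_scale: "derivation P W W' \<Longrightarrow> P y (sV c w) = sV c (P y w)"
  and derivation_zero: "derivation P W W' \<Longrightarrow> P y 0 = 0"
  and derivation_diff: "derivation P W W' \<Longrightarrow> P y (u - w) = P y u - P y w"
  and derivation_mem: "derivation P W W' \<Longrightarrow> w \<in> W \<Longrightarrow> P y w \<in> W'"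
  and derivation_add_arg: "derivation P W W' \<Longrightarrow> w \<in> W \<Longrightarrow> P (x + y) w = P x w + P y w"
  and derivation_scale_arg: "derivation P W W' \<Longrightarrow> w \<in> W \<Longrightarrow> P (sT c y) w = sV c (P y w)"
proof -
  assume P: "derivation P W W'"
  interpret P: Vector_Spaces.linear sV sV "P y" using P by (simp add: derivation_def)
  show "P y (u + w) = P y u + P y w" "P y (sV c w) = sV c (P y w)" "P y 0 = 0" "P y (u - w) = P y u - P y w"
    by (rule P.add P.scale P.zero P.diff)+
  assume "w \<in> W"
  then show "P y w \<in> W'" "P (x + y) w = P x w + P y w" "P (sT c y) w = sV c (P y w)"
    using P by (auto simp: derivation_def lin_iff)
qed

lemma derivation_subset: "derivation P W W' \<Longrightarrow> U \<subseteq> W \<Longrightarrow> (\<And>y u. u \<in> U \<Longrightarrow> P y u \<in> U') \<Longrightarrow> derivation P U U'"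
  unfolding derivation_def by blast

lemma dd_zero: "derivation P W W' \<Longrightarrow> (\<And>zs. f zs = 0) \<Longrightarrow> dd P f ys = 0"
  by (induction ys arbitrary: f) (auto simp: derivation_zero)

lemma dd_eq_0:
  assumes "\<And>y w. w \<in> W \<Longrightarrow> P y w = 0" "\<And>zs. f zs \<in> W"
  shows "dd P f = 0"
proof
  show "dd P f ys = 0 ys" for ys using assms(2) by (induction ys arbitrary: f) (auto simp: assms(1))
qed

lemma dd_add: "derivation P W W' \<Longrightarrow> dd P (\<lambda>zs. f zs + g zs) ys = dd P f ys + dd P g ys"
  by (induction ys arbitrary: f g) (auto simp: derivation_add)

lemma dd_scale: "derivation P W W' \<Longrightarrow> dd P (\<lambda>zs. sV c (f zs)) ys = sV c (dd P f ys)"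
  by (induction ys arbitrary: f) (auto simp: derivation_scale V.scale_right_diff_distrib)

lemma dd_diff: "derivation P W W' \<Longrightarrow> dd P (\<lambda>zs. f zs - g zs) ys = dd P f ys - dd P g ys"
  by (induction ys arbitrary: f g) (auto simp: derivation_diff)

lemma linear_dd: "derivation P W W' \<Longrightarrow> lin (fun_scale sV) (fun_scale sV) (dd P)"
  by (rule linear_funI) (auto simp: fun_eq_iff fun_scale_def plus_fun_def dd_add dd_scale)

lemma dd_length:
  assumes "derivation P W W'"
  shows "(\<And>zs. length zs \<noteq> m \<Longrightarrow> f zs = 0) \<Longrightarrow> length ys \<noteq> Suc m \<Longrightarrow> dd P f ys = 0"
proof (induction ys arbitrary: f m)
  case (Cons y ys)
  have "f ys = 0" using Cons.prems by simp
  moreover have "dd P (\<lambda>zs. f (y # zs)) ys = 0"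
  proof (cases m)
    case 0
    then show ?thesis using Cons.prems by (intro dd_zero[OF assms]) simp
  next
    case (Suc u)
    show ?thesis by (rule Cons.IH[of u]) (use Cons.prems Suc in auto)
  qed
  ultimately show ?case by (simp add: derivation_zero[OF assms])
qed simp

lemma dd_mem:
  assumes "derivation P W W'" "V.subspace W'"
  shows "(\<And>zs. f zs \<in> W) \<Longrightarrow> dd P f ys \<in> W'"
  by (induction ys arbitrary: f)
     (auto intro!: V.subspace_0 V.subspace_diff derivation_mem[OF assms(1)] assms(2))

lemma dd_multilinear:
  assumes P: "derivation P W W'"
  shows "f \<in> Mult m \<Longrightarrow> (\<And>zs. f zs \<in> W) \<Longrightarrow>
    lin sT sV (\<lambda>x. dd P f (us @ x # vs))"
proof (induction us arbitrary: f m)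
  case Nil
  have "lin sT sV (\<lambda>x. P x (f vs))" using P Nil by (auto simp: derivation_def)
  moreover have "dd P (\<lambda>zs. f ((x + y) # zs)) vs = dd P (\<lambda>zs. f (x # zs)) vs + dd P (\<lambda>zs. f (y # zs)) vs" for x y
    using slot_add[OF Nil(1), of "[]"] by (simp add: dd_add[OF P])
  moreover have "dd P (\<lambda>zs. f (sT c x # zs)) vs = sV c (dd P (\<lambda>zs. f (x # zs)) vs)" for c x
    using slot_scale[OF Nil(1), of "[]"] by (simp add: dd_scale[OF P])
  ultimately show ?case by (auto simp: lin_iff V.scale_right_diff_distrib)
next
  case (Cons u us)
  have "(\<lambda>zs. f (u # zs)) \<in> Mult (m - 1)"
  proof (rule multilinearI)
    fix us vs show "lin sT sV (\<lambda>x. f (u # us @ x # vs))"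
      using linear_slot[OF Cons.prems(1), of "u # us" vs] by simp
  next
    fix xs :: "'t list" assume xs: "length xs \<noteq> m - 1"
    show "f (u # xs) = 0"
    proof (cases "m = 0")
      case True
      then show ?thesis using multilinear_length[OF Cons.prems(1)] by simp
    next
      case False
      then show ?thesis using xs multilinear_length[OF Cons.prems(1), of "u # xs"] by auto
    qed
  qed
  from Cons.IH[OF this] Cons.prems have 1: "lin sT sV (\<lambda>x. dd P (\<lambda>zs. f (u # zs)) (us @ x # vs))"
    by simp
  have 2: "lin sT sV (\<lambda>x. P u (f (us @ x # vs)))"
    using linear_slot[OF Cons.prems(1), of us vs]
    by (simp add: lin_iff derivation_add[OF P] derivation_scale[OF P])
  show ?case using 1 2 by (auto simp: lin_iff V.scale_right_diff_distrib)
qed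

lemma dd_adjacent:
  assumes P: "derivation P W W'"
  shows "(\<And>us vs. f (us @ v # v # vs) = 0) \<Longrightarrow> dd P f (us @ v # v # vs) = 0"
proof (induction us arbitrary: f)
  case Nil
  have "f (v # v # zs) = 0" for zs using Nil[of "[]"] by simp
  then show ?case by (simp add: dd_zero[OF P])
next
  case (Cons u us)
  have "f (u # us' @ v # v # vs') = 0" for us' vs' using Cons.prems[of "u # us'"] by simp
  then show ?case using Cons by (simp add: derivation_zero[OF P])
qed

lemma dd_alt:
  assumes P: "derivation P W W'" and W': "V.subspace W'" and f: "f \<in> Alt j W"
  shows "dd P f \<in> Alt (Suc j) W'"
proof -
  have ml: "f \<in> Mult j" and W: "\<And>zs. f zs \<in> W" and adj: "\<And>us v vs. f (us @ v # v # vs) = 0"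
    using f by (auto simp: alt_tensors_def)
  have "dd P f \<in> Mult (Suc j)"
    by (rule multilinearI) (use dd_length[OF P multilinear_length[OF ml]] dd_multilinear[OF P ml W] in auto)
  moreover from this have "dd P f xs = 0" if "\<not> distinct xs" for xs
    by (rule multilinear_zero_if_adjacent) (use that dd_adjacent[OF P, of f] adj in auto)
  ultimately show ?thesis using dd_mem[OF P W' W] by (simp add: alt_tensors_def)
qed

text \<open>By Cartan's formula \<open>i_y d d = P_y d - d P_y + d d i_y\<close>. The first two
  terms cancel because the operators \<open>P\<close> commute, and \<open>i_y f\<close> takes one
  argument less.\<close>

lemma dd_dd:
  assumes P: "derivation P W W'" and comm: "\<And>x y w. w \<in> W \<Longrightarrow> P x (P y w) = P y (P x w)"
  shows "(\<And>zs. f zs \<in> W) \<Longrightarrow> dd P (dd P f) ys = 0"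
proof (induction ys arbitrary: f)
  case (Cons y ys)
  have c: "dd P (\<lambda>zs. P y (g zs)) ys = P y (dd P g ys)" if "\<And>zs. g zs \<in> W" for g ys
    using that
  proof (induction ys arbitrary: g)
    case Nil
    then show ?case by (simp add: derivation_zero[OF P])
  next
    case (Cons z ys)
    then show ?case by (simp add: derivation_diff[OF P] comm)
  qed
  have "dd P (dd P f) (y # ys) = P y (dd P f ys) - dd P (\<lambda>zs. P y (f zs) - dd P (\<lambda>zs. f (y # zs)) zs) ys"
    by simp
  also have "\<dots> = dd P (dd P (\<lambda>zs. f (y # zs))) ys"
    using c[of f] Cons.prems by (simp add: dd_diff[OF P])
  also have "\<dots> = 0" using Cons by simp
  finally show ?case .
qed simp


section \<open>Dual bases and horizontal forms\<close>

definition dual_bases :: "nat \<Rightarrow> (nat \<Rightarrow> 't) \<Rightarrow> (nat \<Rightarrow> 't \<Rightarrow> 'a) \<Rightarrow> bool" where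
  "dual_bases n v e \<longleftrightarrow> (\<forall>a<n. lin sT (*) (e a)) \<and>
     (\<forall>a<n. \<forall>b<n. e a (v b) = (if a = b then 1 else 0)) \<and>
     (\<forall>x. x = (\<Sum>a<n. sT (e a x) (v a)))"

lemma dual_bases_linear: "dual_bases n v e \<Longrightarrow> a < n \<Longrightarrow> lin sT (*) (e a)"
  and dual_bases_eval: "dual_bases n v e \<Longrightarrow> a < n \<Longrightarrow> b < n \<Longrightarrow> e a (v b) = (if a = b then 1 else 0)"
  and dual_bases_expand: "dual_bases n v e \<Longrightarrow> x = (\<Sum>a<n. sT (e a x) (v a))"
  unfolding dual_bases_def by blast+

lemma multilinear_zero_on_basis:
  assumes v: "dual_bases n v e" and f: "f \<in> Mult m"
    and z: "\<And>as. set as \<subseteq> {..<n} \<Longrightarrow> f (map v as) = 0"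
  shows "f xs = 0"
proof -
  have "f (us @ map v as) = 0" if "set as \<subseteq> {..<n}" for us as
    using that
  proof (induction us arbitrary: as rule: rev_induct)
    case Nil
    then show ?case using z by simp
  next
    case (snoc u us)
    interpret l: Vector_Spaces.linear sT sV "\<lambda>x. f (us @ x # map v as)" by (rule linear_slot[OF f])
    have "f ((us @ [u]) @ map v as) = f (us @ (\<Sum>a<n. sT (e a u) (v a)) # map v as)"
      using dual_bases_expand[OF v, of u] by simp
    also have "\<dots> = (\<Sum>a<n. sV (e a u) (f (us @ map v (a # as))))"
      unfolding l.sum l.scale by simp
    also have "\<dots> = (\<Sum>a<n. 0)"
      by (intro sum.cong refl) (use snoc.IH[of "_ # as"] snoc.prems in simp)
    finally show ?case by simp
  qed
  from this[of "[]" xs] show ?thesis by simp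
qed

text \<open>The forms on the quotient of \<open>T\<close> by the span of
  \<open>v_0, ..., v_{i-1}\<close>, realised among the forms on \<open>T\<close> so that no quotient
  space has to be constructed.\<close>

definition horizontal :: "(nat \<Rightarrow> 't) \<Rightarrow> nat \<Rightarrow> nat \<Rightarrow> 'v set \<Rightarrow> ('t list \<Rightarrow> 'v) set" where
  "horizontal v i j W = {f \<in> Alt j W. \<forall>ys. \<forall>a<i. v a \<in> set ys \<longrightarrow> f ys = 0}"

lemma horizontal_0: "horizontal v 0 j W = Alt j W"
  by (simp add: horizontal_def)

lemma horizontal_Suc_subset: "horizontal v (Suc i) j W \<subseteq> horizontal v i j W"
  unfolding horizontal_def using less_SucI by blast

lemma horizontal_head:
  assumes "f \<in> horizontal v i j W" "a < i"
  shows "f (v a # zs) = 0"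
  using assms list.set_intros(1)[of "v a" zs] unfolding horizontal_def by blast

lemma subspace_horizontal:
  assumes "V.subspace W"
  shows "F.subspace (horizontal v i j W)"
proof (rule F.subspaceI)
  note alt = F.subspace_0[OF subspace_alt[OF assms]] F.subspace_add[OF subspace_alt[OF assms]]
    F.subspace_scale[OF subspace_alt[OF assms]]
  show "0 \<in> horizontal v i j W" using alt by (auto simp: horizontal_def)
  show "f + g \<in> horizontal v i j W" if "f \<in> horizontal v i j W" "g \<in> horizontal v i j W" for f g
    using that alt by (auto simp: horizontal_def)
  show "fun_scale sV c f \<in> horizontal v i j W" if "f \<in> horizontal v i j W" for c f
    using that alt by (auto simp: horizontal_def fun_scale_def)
qed

lemma horizontal_interior:
  assumes "f \<in> horizontal v i (Suc j) W"
  shows "(\<lambda>zs. f (v i # zs)) \<in> horizontal v (Suc i) j W"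
  using assms alt_interior[of f j W "v i"]
  by (auto simp: horizontal_def less_Suc_eq alt_tensors_def)

lemma horizontal_Suc:
  assumes "f \<in> horizontal v i j W" "\<And>zs. f (v i # zs) = 0"
  shows "f \<in> horizontal v (Suc i) j W"
  using assms alt_zero_if_head_zero[of f j W "v i"] by (auto simp: horizontal_def less_Suc_eq)

lemma horizontal_eq_0:
  assumes v: "dual_bases n v e" and "i \<le> n" "n - i < j" and f: "f \<in> horizontal v i j W"
  shows "f = 0"
proof
  fix xs
  have ml: "f \<in> Mult j" using f by (simp add: horizontal_def alt_tensors_def)
  have "f (map v as) = 0" if as: "set as \<subseteq> {..<n}" for as
  proof (rule ccontr)
    assume nz: "f (map v as) \<noteq> 0"
    then have "length as = j" using multilinear_length[OF ml, of "map v as"] by auto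
    moreover have "distinct (map v as)" using nz f by (auto simp: horizontal_def alt_tensors_def)
    then have "distinct as" by (simp add: distinct_map)
    moreover have "set as \<subseteq> {i..<n}"
      using nz f as by (force simp: horizontal_def not_less[symmetric])
    ultimately have "j \<le> n - i" using card_mono[of "{i..<n}" "set as"] distinct_card[of as] by simp
    then show False using assms by simp
  qed
  then show "f xs = 0 xs" using multilinear_zero_on_basis[OF v ml] by simp
qed

text \<open>Cartan's formula again: contraction of \<open>dd P f\<close> with \<open>v a\<close> is
  \<open>P (v a)\<close> applied to \<open>f\<close>, minus the differential of a vanishing
  contraction. This is why horizontal forms are paired with coefficients in
  \<open>K\<close>.\<close>

lemma dd_horizontal:
  assumes P: "derivation P W W'" and W': "V.subspace W'" and f: "f \<in> horizontal v i j W"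
    and z: "\<And>a w. a < i \<Longrightarrow> w \<in> W \<Longrightarrow> P (v a) w = 0"
  shows "dd P f \<in> horizontal v i (Suc j) W'"
proof -
  have "dd P f ys = 0" if "v a \<in> set ys" "a < i" "\<And>zs. f zs \<in> W" "\<And>zs. v a \<in> set zs \<Longrightarrow> f zs = 0" for f a ys
    using that
  proof (induction ys arbitrary: f)
    case (Cons y ys)
    show ?case
    proof (cases "y = v a")
      case True
      then have "dd P (\<lambda>zs. f (y # zs)) ys = 0" using Cons.prems by (intro dd_zero[OF P]) auto
      then show ?thesis using True z Cons.prems by simp
    next
      case False
      then have "v a \<in> set ys" using Cons.prems(1) by auto
      moreover from this have "dd P (\<lambda>zs. f (y # zs)) ys = 0" using Cons.prems by (intro Cons.IH) auto
      ultimately show ?thesis using Cons.prems by (simp add: derivation_zero[OF P])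
    qed
  qed simp
  then show ?thesis using f dd_alt[OF P W', of f j] by (auto simp: horizontal_def alt_tensors_def)
qed

text \<open>For this choice of \<open>P\<close> the operator \<open>dd\<close> is the exterior
  product with \<open>p\<close>, so the facts about \<open>dd\<close> also cover wedge
  products.\<close>

lemma derivation_functional:
  assumes "lin sT (*) p" "V.subspace W"
  shows "derivation (\<lambda>y. sV (p y)) W W"
  using assms T.vector_space_axioms V.vector_space_axioms
  by (auto simp: derivation_def lin_iff V.scale_right_distrib V.scale_left_distrib
      V.scale_left_commute V.subspace_scale)

text \<open>Contraction with \<open>v\<^sub>i\<close> has as right inverse the exterior product with \<open>e\<^sub>i\<close>.\<close>

lemma horizontal_wedge:
  assumes v: "dual_bases n v e" and i: "i < n" and W: "V.subspace W"
    and f: "f \<in> horizontal v (Suc i) j W"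
  shows "dd (\<lambda>y. sV (e i y)) f \<in> horizontal v i (Suc j) W"
    and "(\<lambda>zs. dd (\<lambda>y. sV (e i y)) f (v i # zs)) = f"
proof -
  note D = derivation_functional[OF dual_bases_linear[OF v i] W]
  have f': "f \<in> horizontal v i j W" using f horizontal_Suc_subset by blast
  show "dd (\<lambda>y. sV (e i y)) f \<in> horizontal v i (Suc j) W"
    by (rule dd_horizontal[OF D W f']) (use i in \<open>simp add: dual_bases_eval[OF v]\<close>)
  have "dd (\<lambda>y. sV (e i y)) (\<lambda>zs. f (v i # zs)) ys = 0" for ys
    by (rule dd_zero[OF D]) (use horizontal_head[OF f] in simp)
  then show "(\<lambda>zs. dd (\<lambda>y. sV (e i y)) f (v i # zs)) = f"
    by (simp add: dual_bases_eval[OF v i i])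
qed

lemma zero_forms:
  assumes W: "V.subspace W" "V.fin_dim W"
  shows "F.fin_dim (horizontal v i 0 W)" "F.dim (horizontal v i 0 W) = V.dim W"
proof -
  let ?H = "horizontal v i 0 W"
  let ?E = "\<lambda>f :: 't list \<Rightarrow> 'v. f []"
  have lin: "lin (fun_scale sV) sV ?E"
    using F.vector_space_axioms V.vector_space_axioms by (simp add: lin_iff fun_scale_def)
  have "f = 0" if "f \<in> ?H" "f [] = 0" for f
  proof
    show "f xs = 0 xs" for xs
      using that by (cases xs) (auto simp: horizontal_def alt_tensors_def multilinear_maps_def)
  qed
  moreover have "0 \<in> ?H" by (rule F.subspace_0[OF subspace_horizontal[OF W(1)]])
  ultimately have ker: "{f \<in> ?H. f [] = 0} = {0}" by auto
  have "w \<in> ?E ` ?H" if "w \<in> W" for w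
  proof -
    have "(\<lambda>ys. if ys = [] then w else 0) \<in> ?H"
      using that W by (auto simp: horizontal_def alt_tensors_def multilinear_maps_def V.subspace_0)
    then show ?thesis by (rule rev_image_eqI) simp
  qed
  then have img: "?E ` ?H = W" by (auto simp: horizontal_def alt_tensors_def)
  have "F.fin_dim {f \<in> ?H. f [] = 0}" unfolding ker by (rule F.fin_dim_zero)
  moreover have "V.fin_dim (?E ` ?H)" unfolding img by (rule W)
  ultimately show "F.fin_dim ?H" "F.dim ?H = V.dim W"
    using FV.rank_nullity[OF lin subspace_horizontal[OF W(1), of v i 0]]
    unfolding ker img F.dim_zero by auto
qed

text \<open>Pascal's rule: contraction with \<open>v i\<close> maps the \<open>(j+1)\<close>-forms
  at level \<open>i\<close> onto the \<open>j\<close>-forms at level \<open>i + 1\<close>, and its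
  kernel consists of the \<open>(j+1)\<close>-forms at level \<open>i + 1\<close>.\<close>

lemma dim_horizontal:
  assumes v: "dual_bases n v e" and W: "V.subspace W" "V.fin_dim W"
  shows "i \<le> n \<Longrightarrow> F.fin_dim (horizontal v i j W) \<and> F.dim (horizontal v i j W) = V.dim W * ((n - i) choose j)"
proof (induction j arbitrary: i)
  case 0
  then show ?case using zero_forms[OF W] by simp
next
  case (Suc j)
  from Suc.prems show ?case
  proof (induction i rule: inc_induct)
    case base
    have "horizontal v n (Suc j) W = {0}"
      using horizontal_eq_0[OF v, of n "Suc j"] F.subspace_0[OF subspace_horizontal[OF W(1), of v n "Suc j"]] by auto
    then show ?case using F.fin_dim_zero F.dim_zero by simp
  next
    case (step i)
    let ?H = "horizontal v i (Suc j) W"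
    let ?I = "\<lambda>(f :: 't list \<Rightarrow> 'v) zs. f (v i # zs)"
    have lin: "lin (fun_scale sV) (fun_scale sV) ?I"
      by (rule linear_funI) (auto simp: fun_eq_iff fun_scale_def)
    have ker: "{f \<in> ?H. ?I f = 0} = horizontal v (Suc i) (Suc j) W"
      using horizontal_Suc_subset[of v i "Suc j" W] horizontal_Suc[of _ v i "Suc j" W] horizontal_head[of _ v "Suc i" "Suc j" W i]
      by (auto simp: fun_eq_iff)
    have img: "?I ` ?H = horizontal v (Suc i) j W"
    proof
      show "?I ` ?H \<subseteq> horizontal v (Suc i) j W" using horizontal_interior by blast
      show "horizontal v (Suc i) j W \<subseteq> ?I ` ?H"
      proof
        fix g assume "g \<in> horizontal v (Suc i) j W"
        from horizontal_wedge[OF v step.hyps(2) W(1) this] show "g \<in> ?I ` ?H" by (metis image_eqI)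
      qed
    qed
    have IH: "F.fin_dim (horizontal v (Suc i) j W)" "F.dim (horizontal v (Suc i) j W) = V.dim W * ((n - Suc i) choose j)"
      using Suc.IH[of "Suc i"] step.hyps by auto
    have "n - i = Suc (n - Suc i)" using step.hyps by simp
    then have ch: "(n - i) choose Suc j = ((n - Suc i) choose j) + ((n - Suc i) choose Suc j)" by simp
    show ?case
      using FF.rank_nullity[OF lin subspace_horizontal[OF W(1), of v i "Suc j"]] step.IH IH
      unfolding ker img ch by (simp add: distrib_left)
  qed
qed

end


subsection \<open>Pencils of linear maps\<close>

lemma affine_combination:
  "(c * a - s) + t * (c * b - s') = c * (a + t * b) - (s + t * s')" for a b c s s' t :: "'a::comm_ring"
  by (simp add: algebra_simps)

context lin_space
begin

text \<open>\<open>\<Phi>\<close> is a polynomial family of functionals which vanish on the images of \<open>A + \<epsilon> B\<close>; it exists because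
  \<open>C\<close> makes the rank of the pencil generically equal to the rank of \<open>A\<close>.\<close>

lemma pencil:
  fixes U :: "'b set"
  assumes A: "lin scale scale A" and B: "lin scale scale B"
    and U: "subspace U" "fin_dim (A ` U)"
  obtains c :: "'a poly" where "poly c 0 \<noteq> 0"
    "\<And>\<epsilon>. poly c \<epsilon> \<noteq> 0 \<Longrightarrow> fin_dim ((\<lambda>x. A x + scale \<epsilon> (B x)) ` U) \<Longrightarrow>
       dim (A ` U) \<le> dim ((\<lambda>x. A x + scale \<epsilon> (B x)) ` U)"
    "\<And>\<phi> C. lin scale (*) \<phi> \<Longrightarrow> (\<And>u. u \<in> U \<Longrightarrow> \<phi> (A u) = 0) \<Longrightarrow> C \<noteq> 0 \<Longrightarrow>
       (\<And>\<epsilon>. poly C \<epsilon> \<noteq> 0 \<Longrightarrow> fin_dim ((\<lambda>x. A x + scale \<epsilon> (B x)) ` U) \<and>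
           dim ((\<lambda>x. A x + scale \<epsilon> (B x)) ` U) \<le> dim (A ` U)) \<Longrightarrow>
       infinite (UNIV :: 'a set) \<Longrightarrow>
       \<exists>\<Phi>. (\<forall>x. poly (\<Phi> x) 0 = poly c 0 * \<phi> x) \<and> (\<forall>u\<in>U. \<Phi> (A u) = - (pCons 0 1 * \<Phi> (B u)))"
proof -
  interpret A: Vector_Spaces.linear scale scale A by fact
  interpret B: Vector_Spaces.linear scale scale B by fact
  define r where "r = dim (A ` U)"
  obtain Y where Y: "Y \<subseteq> A ` U" "finite Y" "independent Y" "A ` U \<subseteq> span Y" "card Y = dim (A ` U)"
    using fin_dim_basis[OF U(2)] .
  obtain y where y: "indep_family r y" "y ` {..<r} = Y"
    using indep_family_of_set[OF Y(2,3)] Y(5) r_def by metis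
  have "\<exists>x\<in>U. A x = y j" if "j < r" for j using that y(2) Y(1) by force
  then obtain u where u: "\<And>j. j < r \<Longrightarrow> u j \<in> U \<and> A (u j) = y j" by metis
  \<comment> \<open>The \<open>u j\<close> lift a basis of the image of \<open>A\<close>, and at
    parameter 0 these vectors are that basis. They stay independent where a minor is nonzero. Their
    coordinates are the values of all linear functionals, since the type may be
    infinite-dimensional.\<close>
  define a where "a = (\<lambda>j (\<epsilon>::'a). A (u j) + scale \<epsilon> (B (u j)))"
  define I where "I = {l :: 'b \<Rightarrow> 'a. lin scale (*) l}"
  have Ilin: "l (\<Sum>j\<in>J. scale (t j) (z j)) = (\<Sum>j\<in>J. t j * l (z j))" if "l \<in> I" for l t z and J :: "nat set"
  proof -
    interpret l: Vector_Spaces.linear scale "(*)" l using that by (simp add: I_def)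
    show ?thesis by (simp add: l.sum l.scale)
  qed
  have Iadd: "l (x + z) = l x + l z" "l (scale t x) = t * l x" if "l \<in> I" for l t x z
    using that by (auto simp: I_def lin_iff)
  have "\<exists>c b X. finite X \<and> X \<subseteq> I \<and> c \<in> {poly q | q. True} \<and> c 0 \<noteq> 0 \<and>
     (\<forall>j<r. \<forall>x\<in>X. (\<lambda>p. b j p x) \<in> {poly q | q. True}) \<and>
     (\<forall>p. \<forall>i<r. \<forall>j<r. (\<Sum>x\<in>X. b j p x * x (a i p)) = (if i = j then c p else 0))"
  proof (rule dual_minors[OF fun_algebra_poly])
    fix j and l :: "'b \<Rightarrow> 'a" assume l: "l \<in> I"
    have "(\<lambda>\<epsilon>. l (a j \<epsilon>)) = poly [:l (A (u j)), l (B (u j)):]"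
      by (auto simp: a_def Iadd[OF l])
    then show "(\<lambda>\<epsilon>. l (a j \<epsilon>)) \<in> {poly q | q. True}" by blast
  next
    fix t assume t: "\<And>l. l \<in> I \<Longrightarrow> (\<Sum>j<r. t j * l (a j 0)) = 0"
    have "(\<Sum>j<r. scale (t j) (y j)) = 0"
    proof (rule ccontr)
      assume nz: "(\<Sum>j<r. scale (t j) (y j)) \<noteq> 0"
      then obtain l where l: "l \<in> I" "l (\<Sum>j<r. scale (t j) (y j)) = 1"
        using exists_functional[of "{0}"] by (auto simp: I_def)
      have "(\<Sum>j<r. t j * l (a j 0)) = 1"
        using l u by (simp add: Ilin a_def)
      then show False using t[OF l(1)] by simp
    qed
    then show "\<forall>j<r. t j = 0" using y(1) by (auto simp: indep_family_def)
  qed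
  then obtain c0 b X where X: "finite X" "X \<subseteq> I" and c0: "c0 \<in> {poly q | q. True}" "c0 0 \<noteq> 0"
    and b: "\<forall>j<r. \<forall>x\<in>X. (\<lambda>p. b j p x) \<in> {poly q | q. True}"
    and dual0: "\<forall>p. \<forall>i<r. \<forall>j<r. (\<Sum>x\<in>X. b j p x * x (a i p)) = (if i = j then c0 p else 0)"
    by (elim exE conjE) rule
  obtain c where c: "c0 = poly c" using c0 by blast
  have dual: "(\<Sum>l\<in>X. b j \<epsilon> l * l (a i \<epsilon>)) = (if i = j then poly c \<epsilon> else 0)" if "i < r" "j < r" for i j \<epsilon>
    using dual0 that c by blast
  define \<beta> where "\<beta> = (\<lambda>j \<epsilon> x. \<Sum>l\<in>X. b j \<epsilon> l * l x)"
  have \<beta>_sum: "\<beta> j \<epsilon> (\<Sum>i\<in>J. scale (t i) (z i)) = (\<Sum>i\<in>J. t i * \<beta> j \<epsilon> (z i))" for j \<epsilon> t z and J :: "nat set"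
  proof -
    have "\<beta> j \<epsilon> (\<Sum>i\<in>J. scale (t i) (z i)) = (\<Sum>l\<in>X. \<Sum>i\<in>J. t i * (b j \<epsilon> l * l (z i)))"
      unfolding \<beta>_def
    proof (intro sum.cong refl)
      fix l assume "l \<in> X"
      then show "b j \<epsilon> l * l (\<Sum>i\<in>J. scale (t i) (z i)) = (\<Sum>i\<in>J. t i * (b j \<epsilon> l * l (z i)))"
        using X(2) Ilin[of l t z J] by (auto simp: sum_distrib_left mult.left_commute)
    qed
    then show ?thesis unfolding \<beta>_def by (subst (asm) sum.swap) (simp add: sum_distrib_left)
  qed
  have \<beta>_add: "\<beta> j \<epsilon> (x + scale t z) = \<beta> j \<epsilon> x + t * \<beta> j \<epsilon> z" for j \<epsilon> t x z
    unfolding \<beta>_def sum_distrib_left sum.distrib[symmetric]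
  proof (intro sum.cong refl)
    fix l assume "l \<in> X"
    then show "b j \<epsilon> l * l (x + scale t z) = b j \<epsilon> l * l x + t * (b j \<epsilon> l * l z)"
      using X(2) Iadd[of l] by (auto simp: distrib_left mult.left_commute)
  qed
  have ind: "indep_family r (\<lambda>j. a j \<epsilon>)" if "poly c \<epsilon> \<noteq> 0" for \<epsilon>
    unfolding indep_family_def
  proof (intro allI impI)
    fix t j assume t: "(\<Sum>j<r. scale (t j) (a j \<epsilon>)) = 0" and j: "j < r"
    have "\<beta> j \<epsilon> 0 = 0" using \<beta>_sum[of j \<epsilon> t "\<lambda>i. a i \<epsilon>" "{}"] by simp
    then have "0 = (\<Sum>i<r. t i * \<beta> j \<epsilon> (a i \<epsilon>))" using \<beta>_sum[of j \<epsilon> t "\<lambda>i. a i \<epsilon>" "{..<r}"] t by simp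
    also have "\<dots> = (\<Sum>i<r. if i = j then t j * poly c \<epsilon> else 0)"
      by (intro sum.cong refl) (use dual j in \<open>auto simp: \<beta>_def\<close>)
    finally show "t j = 0" using j that by simp
  qed
  have img: "a j \<epsilon> \<in> (\<lambda>x. A x + scale \<epsilon> (B x)) ` U" if "j < r" for j \<epsilon>
    unfolding a_def using u[OF that] by blast
  show ?thesis
  proof (rule that)
    show "poly c 0 \<noteq> 0" using c0 c by simp
  next
    fix \<epsilon> assume "poly c \<epsilon> \<noteq> 0" "fin_dim ((\<lambda>x. A x + scale \<epsilon> (B x)) ` U)"
    then show "dim (A ` U) \<le> dim ((\<lambda>x. A x + scale \<epsilon> (B x)) ` U)"
      using indep_family_le_dim[OF ind] img span_superset unfolding r_def[symmetric] by blast
  next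
    fix \<phi> and C :: "'a poly"
    assume \<phi>: "lin scale (*) \<phi>" "\<And>u. u \<in> U \<Longrightarrow> \<phi> (A u) = 0" and C: "C \<noteq> 0"
      "\<And>\<epsilon>. poly C \<epsilon> \<noteq> 0 \<Longrightarrow> fin_dim ((\<lambda>x. A x + scale \<epsilon> (B x)) ` U) \<and>
           dim ((\<lambda>x. A x + scale \<epsilon> (B x)) ` U) \<le> dim (A ` U)"
      and inf: "infinite (UNIV :: 'a set)"
    interpret \<phi>: Vector_Spaces.linear scale "(*)" \<phi> by fact
    \<comment> \<open>Up to the factor \<open>c\<close>, this is \<open>\<phi>\<close> minus the
      combination of the dual functionals that agrees with \<open>\<phi>\<close> on the
      \<open>a j \<epsilon>\<close>. The correction disappears at 0, where \<open>\<phi>\<close>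
      kills the \<open>a j 0\<close>.\<close>
    define \<Phi>0 where "\<Phi>0 = (\<lambda>\<epsilon> x. poly c \<epsilon> * \<phi> x - (\<Sum>j<r. \<beta> j \<epsilon> x * \<phi> (a j \<epsilon>)))"
    have "\<exists>q. \<forall>\<epsilon>. poly q \<epsilon> = \<Phi>0 \<epsilon> x" for x
    proof -
      have "(\<lambda>\<epsilon>. poly c \<epsilon> * \<phi> x) \<in> {poly q | q. True}"
        by (intro fun_algebra_mult[OF fun_algebra_poly] fun_algebra_const[OF fun_algebra_poly]) auto
      moreover have "(\<lambda>\<epsilon>. \<beta> j \<epsilon> x * \<phi> (a j \<epsilon>)) \<in> {poly q | q. True}" if "j < r" for j
      proof (rule fun_algebra_mult[OF fun_algebra_poly])
        show "(\<lambda>\<epsilon>. \<beta> j \<epsilon> x) \<in> {poly q | q. True}" unfolding \<beta>_def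
        proof (rule fun_algebra_sum[OF fun_algebra_poly])
          fix l assume l: "l \<in> X"
          have "(\<lambda>\<epsilon>. b j \<epsilon> l) \<in> {poly q | q. True}" using b[rule_format, OF that l] .
          then show "(\<lambda>\<epsilon>. b j \<epsilon> l * l x) \<in> {poly q | q. True}"
            by (rule fun_algebra_mult[OF fun_algebra_poly _ fun_algebra_const[OF fun_algebra_poly]])
        qed
        have "(\<lambda>\<epsilon>. \<phi> (a j \<epsilon>)) = poly [:\<phi> (A (u j)), \<phi> (B (u j)):]"
          by (auto simp: a_def \<phi>.add \<phi>.scale)
        then show "(\<lambda>\<epsilon>. \<phi> (a j \<epsilon>)) \<in> {poly q | q. True}" by blast
      qed
      ultimately have "(\<lambda>\<epsilon>. \<Phi>0 \<epsilon> x) \<in> {poly q | q. True}" unfolding \<Phi>0_def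
        by (intro fun_algebra_diff[OF fun_algebra_poly] fun_algebra_sum[OF fun_algebra_poly]) auto
      then obtain q where "(\<lambda>\<epsilon>. \<Phi>0 \<epsilon> x) = poly q" by blast
      then show ?thesis by metis
    qed
    then obtain \<Phi> where \<Phi>: "\<And>\<epsilon> x. poly (\<Phi> x) \<epsilon> = \<Phi>0 \<epsilon> x" by metis
    have "\<Phi> (A x) = - (pCons 0 1 * \<Phi> (B x))" if x: "x \<in> U" for x
    proof -
      let ?q = "\<Phi> (A x) + pCons 0 1 * \<Phi> (B x)"
      \<comment> \<open>Where the rank has not grown, the \<open>a j \<epsilon>\<close> span the
        image of the pencil, and \<open>\<Phi>0 \<epsilon>\<close> kills them. Multiplying by
        \<open>c\<close> and \<open>C\<close> takes care of the exceptional parameters, so the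
        identity holds between polynomials.\<close>
      have z: "poly ?q \<epsilon> = 0" if \<epsilon>: "poly c \<epsilon> \<noteq> 0" "poly C \<epsilon> \<noteq> 0" for \<epsilon>
      proof -
        have "A x + scale \<epsilon> (B x) \<in> span ((\<lambda>j. a j \<epsilon>) ` {..<r})"
          using indep_family_span[OF ind[OF \<epsilon>(1)], of "(\<lambda>x. A x + scale \<epsilon> (B x)) ` U"] C(2)[OF \<epsilon>(2)] img x
          unfolding r_def[symmetric] by blast
        then obtain t where t: "A x + scale \<epsilon> (B x) = (\<Sum>j<r. scale (t j) (a j \<epsilon>))"
          unfolding span_image_lessThan by blast
        have "(\<Sum>j<r. \<beta> j \<epsilon> (A x + scale \<epsilon> (B x)) * \<phi> (a j \<epsilon>))
            = (\<Sum>j<r. \<beta> j \<epsilon> (A x) * \<phi> (a j \<epsilon>)) + \<epsilon> * (\<Sum>j<r. \<beta> j \<epsilon> (B x) * \<phi> (a j \<epsilon>))"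
          by (simp only: \<beta>_add distrib_right sum.distrib sum_distrib_left mult.assoc)
        note sum_eq = this
        have "poly ?q \<epsilon> = \<Phi>0 \<epsilon> (A x) + \<epsilon> * \<Phi>0 \<epsilon> (B x)" by (simp add: \<Phi>)
        also have "\<dots> = \<Phi>0 \<epsilon> (A x + scale \<epsilon> (B x))"
          unfolding \<Phi>0_def sum_eq \<phi>.add \<phi>.scale by (rule affine_combination)
        also have "\<dots> = (\<Sum>i<r. t i * \<Phi>0 \<epsilon> (a i \<epsilon>))"
        proof -
          have "(\<Sum>j<r. (\<Sum>i<r. t i * \<beta> j \<epsilon> (a i \<epsilon>)) * \<phi> (a j \<epsilon>))
             = (\<Sum>i<r. t i * (\<Sum>j<r. \<beta> j \<epsilon> (a i \<epsilon>) * \<phi> (a j \<epsilon>)))"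
            unfolding sum_distrib_right sum_distrib_left by (subst sum.swap) (simp only: mult_ac)
          note sum_eq = this
          have c_eq: "poly c \<epsilon> * (\<Sum>i<r. t i * \<phi> (a i \<epsilon>)) = (\<Sum>i<r. t i * (poly c \<epsilon> * \<phi> (a i \<epsilon>)))"
            unfolding sum_distrib_left by (intro sum.cong refl) (rule mult.left_commute)
          show ?thesis unfolding t \<Phi>0_def \<beta>_sum sum_eq \<phi>.sum \<phi>.scale c_eq right_diff_distrib sum_subtractf ..
        qed
        also have "\<dots> = 0"
        proof (rule sum.neutral, rule ballI)
          fix i assume "i \<in> {..<r}"
          then have "(\<Sum>j<r. \<beta> j \<epsilon> (a i \<epsilon>) * \<phi> (a j \<epsilon>)) = (\<Sum>j<r. if j = i then poly c \<epsilon> * \<phi> (a i \<epsilon>) else 0)"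
            by (intro sum.cong refl) (use dual in \<open>auto simp: \<beta>_def\<close>)
          then show "t i * \<Phi>0 \<epsilon> (a i \<epsilon>) = 0" using \<open>i \<in> {..<r}\<close> by (simp add: \<Phi>0_def)
        qed
        finally show ?thesis .
      qed
      have "poly (?q * c * C) \<epsilon> = 0" for \<epsilon> using z[of \<epsilon>] by auto
      then have "?q * c * C = 0"
        using inf poly_roots_finite[of "?q * c * C"] by (metis (mono_tags, lifting) UNIV_eq_I mem_Collect_eq)
      then have "?q = 0" using C(1) c0(2) c by auto
      then show ?thesis by (simp only: eq_neg_iff_add_eq_0)
    qed
    moreover have "poly (\<Phi> x) 0 = poly c 0 * \<phi> x" for x
    proof -
      have "\<phi> (a j 0) = 0" if "j < r" for j using \<phi>(2)[of "u j"] u[OF that] by (simp add: a_def)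
      then show ?thesis by (simp add: \<Phi> \<Phi>0_def)
    qed
    ultimately show "\<exists>\<Phi>. (\<forall>x. poly (\<Phi> x) 0 = poly c 0 * \<phi> x) \<and> (\<forall>u\<in>U. \<Phi> (A u) = - (pCons 0 1 * \<Phi> (B u)))"
      by blast
  qed
qed

end


subsection \<open>Quasi-regular bases\<close>

text \<open>Dually, a graded module over the polynomial ring generated by \<open>T\<close>, and
  \<open>P_exact\<close> says that its Koszul homology vanishes in the stated degrees. They start at
  \<open>k\<close> because degree \<open>k - 1\<close> is where the cohomology sits.\<close>

locale spencer_module = tensor_spaces sT sV
  for sT :: "'a::field_char_0 \<Rightarrow> 't::ab_group_add \<Rightarrow> 't" and sV :: "'a \<Rightarrow> 'v::ab_group_add \<Rightarrow> 'v" +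
  fixes n k :: nat and P :: "'t \<Rightarrow> 'v \<Rightarrow> 'v" and g :: "nat \<Rightarrow> 'v set"
  assumes ex_dual_bases: "\<exists>v e. dual_bases n v e"
    and k_pos: "k \<ge> 1"
    and g_subspace: "V.subspace (g t)"
    and g_0_fin_dim: "V.fin_dim (g 0)"
    and P_derivation: "derivation P (g (Suc t)) (g t)"
    and P_g_0: "w \<in> g 0 \<Longrightarrow> P y w = 0"
    and P_commute: "w \<in> g t \<Longrightarrow> P x (P y w) = P y (P x w)"
    and P_nondegenerate: "w \<in> g (Suc t) \<Longrightarrow> (\<And>y. P y w = 0) \<Longrightarrow> w = 0"
    and P_exact: "k \<le> t \<Longrightarrow> f \<in> Alt (Suc j) (g t) \<Longrightarrow> dd P f = 0 \<Longrightarrow>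
        f \<in> dd P ` Alt j (g (Suc t))"
begin

section \<open>Common kernels of contractions and their complexes\<close>

lemma P_linear: "lin sV sV (P y)"
  using P_derivation[of 0] by (simp add: derivation_def)

lemma P_arg_comb: "w \<in> g t \<Longrightarrow> P (x + sT c y) w = P x w + sV c (P y w)"
proof (cases t)
  case 0
  then show "w \<in> g t \<Longrightarrow> ?thesis" by (simp add: P_g_0)
next
  case (Suc u)
  then show "w \<in> g t \<Longrightarrow> ?thesis"
    by (simp add: derivation_add_arg[OF P_derivation] derivation_scale_arg[OF P_derivation])
qed

text \<open>If \<open>M\<close> is the module dual to \<open>g\<close>, with \<open>T\<close> acting
  by transposed contractions, then \<open>K v i t\<close> is dual to degree \<open>t\<close> of
  \<open>M\<close> modulo \<open>v_0 M + ... + v_{i-1} M\<close>.\<close>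

definition K :: "(nat \<Rightarrow> 't) \<Rightarrow> nat \<Rightarrow> nat \<Rightarrow> 'v set" where
  "K v i t = {w \<in> g t. \<forall>a<i. P (v a) w = 0}"

lemma K_0: "K v 0 t = g t"
  by (simp add: K_def)

lemma K_subset: "K v i t \<subseteq> g t"
  by (auto simp: K_def)

lemma K_Suc: "K v (Suc i) t = {w \<in> K v i t. P (v i) w = 0}"
  by (auto simp: K_def less_Suc_eq)

lemma subspace_K: "V.subspace (K v i t)"
proof -
  note D = P_derivation[of 0]
  show ?thesis
    by (rule V.subspaceI)
       (auto simp: K_def V.subspace_0[OF g_subspace] V.subspace_add[OF g_subspace] V.subspace_scale[OF g_subspace]
         derivation_zero[OF D] derivation_add[OF D] derivation_scale[OF D])
qed

lemma K_derivation: "derivation P (K v i (Suc t)) (K v i t)"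
proof (rule derivation_subset[OF P_derivation[of t] K_subset])
  fix y w assume w: "w \<in> K v i (Suc t)"
  then have "P y w \<in> g t" using derivation_mem[OF P_derivation] by (simp add: K_def)
  moreover have "P (v a) (P y w) = 0" if "a < i" for a
    using w that P_commute[of w "Suc t" "v a" y] derivation_zero[OF P_derivation[of 0]] by (simp add: K_def)
  ultimately show "P y w \<in> K v i t" by (simp add: K_def)
qed

lemma K_n: 
  assumes "dual_bases n v e"
  shows "K v n (Suc t) = {0}"
proof -
  have "w = 0" if "w \<in> K v n (Suc t)" for w
  proof (rule P_nondegenerate[of w t])
    show w: "w \<in> g (Suc t)" using that by (simp add: K_def)
    interpret l: Vector_Spaces.linear sT sV "\<lambda>y. P y w" using P_derivation w by (auto simp: derivation_def)
    fix y
    have "P y w = P (\<Sum>a<n. sT (e a y) (v a)) w" using dual_bases_expand[OF assms, of y] by simp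
    also have "\<dots> = (\<Sum>a<n. sV (e a y) (P (v a) w))" by (simp add: l.sum l.scale)
    also have "\<dots> = 0" using that by (simp add: K_def)
    finally show "P y w = 0" .
  qed
  then show ?thesis using V.subspace_0[OF subspace_K] by auto
qed

lemma fin_dim_K: "dual_bases n v e \<Longrightarrow> i \<le> n \<Longrightarrow> V.fin_dim (K v i t)"
proof (induction t arbitrary: i)
  case 0
  then show ?case using V.fin_dim_subset[OF g_0_fin_dim K_subset] by simp
next
  case (Suc t)
  from Suc.prems(2) show ?case
  proof (induction i rule: inc_induct)
    case base
    then show ?case using K_n[OF Suc.prems(1)] V.fin_dim_zero by simp
  next
    case (step i)
    have "P (v i) ` K v i (Suc t) \<subseteq> K v i t" using derivation_mem[OF K_derivation] by blast
    then have "V.fin_dim (P (v i) ` K v i (Suc t))"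
      using Suc.IH[OF Suc.prems(1), of i] V.fin_dim_subset step.hyps by auto
    then show ?case
      using VV.rank_nullity(1)[OF P_linear[of "v i"] subspace_K[of v i "Suc t"]] step.IH by (simp add: K_Suc)
  qed
qed

lemma fin_dim_g: "V.fin_dim (g t)"
  using ex_dual_bases fin_dim_K[of _ _ 0 t] by (auto simp: K_0)

lemma fin_dim_K': "V.fin_dim (K v i t)"
  using V.fin_dim_subset[OF fin_dim_g K_subset] .

lemma K_cong: "(\<And>a. a < i \<Longrightarrow> v a = v' a) \<Longrightarrow> K v i t = K v' i t"
  by (auto simp: K_def)

definition exact_at :: "(nat \<Rightarrow> 't) \<Rightarrow> nat \<Rightarrow> nat \<Rightarrow> bool" where
  "exact_at v i t \<longleftrightarrow> (\<forall>j. \<forall>f \<in> horizontal v i (Suc j) (K v i t). dd P f = 0 \<longrightarrow>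
     f \<in> dd P ` horizontal v i j (K v i (Suc t)))"

text \<open>Dually, multiplication by \<open>v i\<close> is injective from degree \<open>t\<close>
  to degree \<open>t + 1\<close> of the quotient module, as for a quasi-regular sequence.\<close>

definition surj_at :: "(nat \<Rightarrow> 't) \<Rightarrow> nat \<Rightarrow> nat \<Rightarrow> bool" where
  "surj_at v i t \<longleftrightarrow> P (v i) ` K v i (Suc t) = K v i t"

lemma horizontal_cong: "(\<And>a. a < i \<Longrightarrow> v a = v' a) \<Longrightarrow> horizontal v i j W = horizontal v' i j W"
  unfolding horizontal_def by auto

lemma exact_at_cong:
  assumes "\<And>a. a < i \<Longrightarrow> v a = v' a"
  shows "exact_at v i t = exact_at v' i t"
  unfolding exact_at_def using horizontal_cong[OF assms] K_cong[OF assms] by simp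

lemma horizontal_mono: "W \<subseteq> W' \<Longrightarrow> horizontal v i j W \<subseteq> horizontal v i j W'"
  by (auto simp: horizontal_def alt_tensors_def)

lemma dd_K_horizontal:
  assumes "f \<in> horizontal v i j (K v i (Suc t))"
  shows "dd P f \<in> horizontal v i (Suc j) (K v i t)"
  by (rule dd_horizontal[OF K_derivation subspace_K assms]) (auto simp: K_def)

lemma dd_dd_g:
  assumes "\<And>zs. f zs \<in> g (Suc t)"
  shows "dd P (dd P f) = 0"
  using dd_dd[OF P_derivation[of t], of f] P_commute assms by auto

text \<open>A primitive \<open>\<eta>\<close> of \<open>f\<close> at level \<open>i\<close> is
  corrected by an exact form. If \<open>\<zeta>\<close> is horizontal with \<open>P (v i)\<close> of
  it equal to the contraction of \<open>\<eta>\<close> with \<open>v i\<close>, then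
  \<open>\<eta> - dd P \<zeta>\<close> is horizontal at level \<open>i + 1\<close>. Its coefficients
  lie in the smaller kernel by Cartan's formula, since \<open>f\<close> is horizontal too. As
  \<open>\<eta>\<close> has coefficients of degree \<open>t + 1\<close>, surjectivity is needed in
  that degree.\<close>

lemma exact_at_Suc:
  assumes ex: "exact_at v i t" and surj: "surj_at v i (Suc t)"
  shows "exact_at v (Suc i) t"
  unfolding exact_at_def
proof (intro allI ballI impI)
  fix j f assume f: "f \<in> horizontal v (Suc i) (Suc j) (K v (Suc i) t)" and df: "dd P f = 0"
  note D = P_derivation[of 0]
  have "f \<in> horizontal v i (Suc j) (K v i t)"
    using f horizontal_Suc_subset[of v i "Suc j" "K v i t"]
      horizontal_mono[of "K v (Suc i) t" "K v i t" v "Suc i" "Suc j"] by (auto simp: K_Suc)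
  then obtain \<eta> where \<eta>: "\<eta> \<in> horizontal v i j (K v i (Suc t))" "f = dd P \<eta>"
    using ex df unfolding exact_at_def by blast
  have "\<exists>\<zeta>. dd P \<zeta> \<in> horizontal v i j (K v i (Suc t)) \<and> (\<forall>zs. dd P \<zeta> (v i # zs) = \<eta> (v i # zs)) \<and> dd P (dd P \<zeta>) = 0"
  proof (cases j)
    \<comment> \<open>Contraction of a 0-form is zero, so no correction is necessary.\<close>
    case 0
    have "\<eta> (v i # zs) = 0" for zs
      using \<eta>(1) 0 by (auto simp: horizontal_def alt_tensors_def multilinear_maps_def)
    moreover have "dd P (\<lambda>_. 0) = 0" by (auto simp: dd_zero[OF D])
    ultimately show ?thesis
      using F.subspace_0[OF subspace_horizontal[OF subspace_K]]
      by (intro exI[of _ "\<lambda>_. 0"]) (simp add: zero_fun_def[symmetric])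
  next
    case (Suc j')
    \<comment> \<open>A linear section is applied to the values of the form. Linearity is what keeps
      \<open>\<zeta>\<close> multilinear and alternating; preimages chosen one by one would
      not.\<close>
    obtain \<sigma> where \<sigma>: "lin sV sV \<sigma>" "\<And>w. \<sigma> w \<in> K v i (Suc (Suc t))"
        "\<And>w. w \<in> K v i (Suc t) \<Longrightarrow> P (v i) (\<sigma> w) = w"
      using V.exists_right_inverse[OF V.vector_space_axioms P_linear subspace_K surj[unfolded surj_at_def]] by blast
    interpret \<sigma>: Vector_Spaces.linear sV sV \<sigma> by (rule \<sigma>(1))
    define \<alpha> where "\<alpha> = (\<lambda>zs. \<eta> (v i # zs))"
    have \<alpha>: "\<alpha> \<in> horizontal v (Suc i) j' (K v i (Suc t))"
      using \<eta>(1) horizontal_interior unfolding \<alpha>_def Suc by blast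
    define \<zeta> where "\<zeta> = (\<lambda>zs. \<sigma> (\<alpha> zs))"
    have "\<zeta> \<in> Mult j'"
    proof (rule multilinearI)
      have ml: "\<alpha> \<in> Mult j'" using \<alpha> by (simp add: horizontal_def alt_tensors_def)
      show "\<zeta> xs = 0" if "length xs \<noteq> j'" for xs
        using multilinear_length[OF ml that] by (simp add: \<zeta>_def \<sigma>.zero)
      show "lin sT sV (\<lambda>x. \<zeta> (us @ x # vs))" for us vs
        using linear_slot[OF ml, of us vs] by (simp add: lin_iff \<zeta>_def \<sigma>.add \<sigma>.scale)
    qed
    then have \<zeta>: "\<zeta> \<in> horizontal v (Suc i) j' (K v i (Suc (Suc t)))"
      using \<alpha> \<sigma>(2) by (auto simp: horizontal_def alt_tensors_def \<zeta>_def \<sigma>.zero)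
    then have "\<zeta> \<in> horizontal v i j' (K v i (Suc (Suc t)))" using horizontal_Suc_subset by blast
    then have 1: "dd P \<zeta> \<in> horizontal v i j (K v i (Suc t))" unfolding Suc by (rule dd_K_horizontal)
    have 2: "dd P \<zeta> (v i # zs) = \<eta> (v i # zs)" for zs
    proof -
      have d0: "dd P (\<lambda>zs. \<zeta> (v i # zs)) zs = 0"
        by (rule dd_zero[OF D]) (use horizontal_head[OF \<zeta>] in simp)
      have "\<alpha> zs \<in> K v i (Suc t)" using \<alpha> by (simp add: horizontal_def alt_tensors_def)
      then have "P (v i) (\<zeta> zs) = \<eta> (v i # zs)" using \<sigma>(3)[of "\<alpha> zs"] by (simp add: \<zeta>_def \<alpha>_def)
      then show ?thesis unfolding dd.simps d0 by simp
    qed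
    have "\<zeta> zs \<in> g (Suc (Suc t))" for zs unfolding \<zeta>_def using \<sigma>(2) K_subset by blast
    then have "dd P (dd P \<zeta>) = 0" by (rule dd_dd_g)
    then show ?thesis using 1 2 by blast
  qed
  then obtain \<zeta> where \<zeta>: "dd P \<zeta> \<in> horizontal v i j (K v i (Suc t))" "\<And>zs. dd P \<zeta> (v i # zs) = \<eta> (v i # zs)"
    "dd P (dd P \<zeta>) = 0" by blast
  define \<eta>' where "\<eta>' = \<eta> - dd P \<zeta>"
  have \<eta>'i: "\<eta>' \<in> horizontal v i j (K v i (Suc t))"
    unfolding \<eta>'_def by (intro F.subspace_diff subspace_horizontal subspace_K \<eta>(1) \<zeta>(1))
  have z: "\<eta>' (v i # zs) = 0" for zs by (simp add: \<eta>'_def \<zeta>(2) del: dd.simps)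
  have "dd P \<eta>' ys = f ys" for ys
  proof -
    have "dd P (\<lambda>zs. \<eta> zs - dd P \<zeta> zs) ys = dd P \<eta> ys - dd P (dd P \<zeta>) ys" by (rule dd_diff[OF D])
    then show ?thesis using \<zeta>(3) \<eta>(2) by (simp add: \<eta>'_def fun_diff_def)
  qed
  then have d: "f = dd P \<eta>'" by auto
  have "P (v i) (\<eta>' ys) = 0" for ys
  proof -
    have "f (v i # ys) = 0" by (rule horizontal_head[OF f]) simp
    moreover have "dd P (\<lambda>zs. \<eta>' (v i # zs)) ys = 0" by (rule dd_zero[OF D]) (rule z)
    ultimately show ?thesis by (simp add: d)
  qed
  then have "\<eta>' \<in> horizontal v (Suc i) j (K v (Suc i) (Suc t))"
    using horizontal_Suc[OF \<eta>'i z] by (auto simp: horizontal_def alt_tensors_def K_Suc)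
  then show "f \<in> dd P ` horizontal v (Suc i) j (K v (Suc i) (Suc t))" using d by blast
qed

text \<open>The form is \<open>w\<close> times \<open>e_i \<and> ... \<and> e_{n-1}\<close>, built
  by wedging from the last factor down. The index \<open>i'\<close> of the coefficients is kept
  apart from \<open>i\<close> so that it stays fixed during this descent.\<close>

lemma volume_form:
  assumes v: "dual_bases n v e" and i: "i \<le> n" and w: "w \<in> K v i' t" and "i' \<le> i"
  shows "\<exists>f \<in> horizontal v i (n - i) (K v i' t). f (map v [i..<n]) = w"
  using i \<open>i' \<le> i\<close>
proof (induction i rule: inc_induct)
  case base
  have "(\<lambda>ys. if ys = [] then w else 0) \<in> horizontal v n 0 (K v i' t)"
    using w V.subspace_0[OF subspace_K] by (auto simp: horizontal_def alt_tensors_def multilinear_maps_def)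
  then show ?case by (intro bexI[of _ "\<lambda>ys. if ys = [] then w else 0"]) auto
next
  case (step m)
  then obtain f where f: "f \<in> horizontal v (Suc m) (n - Suc m) (K v i' t)" "f (map v [Suc m..<n]) = w" by auto
  have "n - m = Suc (n - Suc m)" "[m..<n] = m # [Suc m..<n]" using step.hyps by (auto simp: upt_conv_Cons)
  then show ?case using horizontal_wedge[OF v step.hyps(2) subspace_K f(1)] f(2)
    by (intro bexI[of _ "dd (\<lambda>y. sV (e m y)) f"]) (auto dest: fun_cong[of _ _ "map v [Suc m..<n]"])
qed

text \<open>Exactness in top degree is applied to multiples of the volume form \<open>e\<^sub>i \<and> \<dots> \<and> e\<^sub>n\<^sub>-\<^sub>1\<close>.\<close>

lemma socle:
  assumes v: "dual_bases n v e" and i: "i < n" and ex: "exact_at v i t"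
  shows "K v i t \<subseteq> V.span (\<Union>y. P y ` K v i (Suc t))"
proof
  fix w assume w: "w \<in> K v i t"
  obtain f where f: "f \<in> horizontal v i (n - i) (K v i t)" "f (map v [i..<n]) = w"
    using volume_form[OF v _ w, of i] i by auto
  obtain m where m: "n - i = Suc m" using i by (cases "n - i") auto
  \<comment> \<open>Closed for reasons of degree: horizontal forms of degree
    \<open>n - i + 1\<close> vanish, and for \<open>t = 0\<close> all contractions of the
    coefficients are zero.\<close>
  have "dd P f = 0"
  proof (cases t)
    case 0
    then show ?thesis using f(1) K_subset[of v i 0]
      by (intro dd_eq_0[of "g 0"]) (auto simp: P_g_0 horizontal_def alt_tensors_def)
  next
    case (Suc u)
    show ?thesis
      by (rule horizontal_eq_0[OF v _ _ dd_K_horizontal[of f v i "n - i" u]]) (use f Suc i in auto)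
  qed
  then obtain \<eta> where \<eta>: "\<eta> \<in> horizontal v i m (K v i (Suc t))" "f = dd P \<eta>"
    using ex f(1) unfolding exact_at_def m by blast
  have "dd P h ys \<in> V.span (\<Union>y. P y ` K v i (Suc t))" if "\<And>zs. h zs \<in> K v i (Suc t)" for h ys
    using that
  proof (induction ys arbitrary: h)
    case (Cons y ys)
    have "P y (h ys) \<in> (\<Union>y. P y ` K v i (Suc t))" using Cons.prems by blast
    then show ?case using Cons by (simp add: V.span_diff V.span_base)
  qed (simp add: V.span_zero)
  then show "w \<in> V.span (\<Union>y. P y ` K v i (Suc t))"
    using f(2) \<eta> by (auto simp: horizontal_def alt_tensors_def)
qed

section \<open>Products of contractions and polarization\<close>

lemma K_foldr: "y \<in> K v i (t + length us) \<Longrightarrow> foldr P us y \<in> K v i t"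
proof (induction us arbitrary: t)
  case (Cons u us)
  then show ?case using derivation_mem[OF K_derivation, of "foldr P us y" v i t u] by simp
qed simp

lemma K_funpow: "y \<in> K v i (t + m) \<Longrightarrow> (P u ^^ m) y \<in> K v i t"
proof (induction m arbitrary: t)
  case (Suc m)
  then show ?case using derivation_mem[OF K_derivation, of "(P u ^^ m) y" v i t u] by simp
qed simp

lemma funpow_linear: "lin sV sV (P u ^^ m)"
proof (induction m)
  case 0
  then show ?case using V.vector_space_axioms by (simp add: lin_iff)
next
  case (Suc m)
  then show ?case using P_linear[of u] by (simp add: lin_iff)
qed

lemma funpow_commute: "y \<in> K v i (t + Suc m) \<Longrightarrow> (P u ^^ m) (P x y) = P x ((P u ^^ m) y)"
proof (induction m arbitrary: t)
  case (Suc m)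
  then have "(P u ^^ m) (P x y) = P x ((P u ^^ m) y)" using Suc.IH[of "Suc t"] by simp
  moreover have "(P u ^^ m) y \<in> g (Suc (Suc t))" using K_funpow[of y v i "Suc (Suc t)" m u] Suc.prems K_subset by auto
  ultimately show ?case using P_commute by simp
qed simp

text \<open>Only the expansion to first order is recorded: the derivative of the \<open>m\<close>-th
  power of \<open>P u\<close> in the direction \<open>x\<close> is \<open>m\<close> times the
  product of \<open>P x\<close> with the power \<open>m - 1\<close>, as the contractions
  commute.\<close>

lemma polarization_poly:
  assumes \<phi>: "lin sV (*) \<phi>"
  shows "z \<in> K v i (t + m) \<Longrightarrow> \<exists>q. (\<forall>\<epsilon>. poly q \<epsilon> = \<phi> ((P (u + sT \<epsilon> x) ^^ m) z)) \<and>
    poly.coeff q 0 = \<phi> ((P u ^^ m) z) \<and> poly.coeff q 1 = of_nat m * \<phi> ((P u ^^ (m - 1)) (P x z))"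
proof (induction m arbitrary: z t)
  case 0
  then show ?case by (intro exI[of _ "[:\<phi> z:]"]) auto
next
  case (Suc m)
  interpret \<phi>: Vector_Spaces.linear sV "(*)" \<phi> by fact
  have Pz: "P y z \<in> K v i (t + m)" for y
    using Suc.prems derivation_mem[OF K_derivation, of z v i "t + m"] by simp
  obtain q1 q2 where q1: "\<And>\<epsilon>. poly q1 \<epsilon> = \<phi> ((P (u + sT \<epsilon> x) ^^ m) (P u z))"
      "poly.coeff q1 0 = \<phi> ((P u ^^ m) (P u z))" "poly.coeff q1 1 = of_nat m * \<phi> ((P u ^^ (m - 1)) (P x (P u z)))"
    and q2: "\<And>\<epsilon>. poly q2 \<epsilon> = \<phi> ((P (u + sT \<epsilon> x) ^^ m) (P x z))" "poly.coeff q2 0 = \<phi> ((P u ^^ m) (P x z))"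
    using Suc.IH[OF Pz[of u]] Suc.IH[OF Pz[of x]] by blast
  have zg: "z \<in> g (t + Suc m)" using Suc.prems K_subset by auto
  have "poly (q1 + pCons 0 q2) \<epsilon> = \<phi> ((P (u + sT \<epsilon> x) ^^ Suc m) z)" for \<epsilon>
  proof -
    interpret f: Vector_Spaces.linear sV sV "P (u + sT \<epsilon> x) ^^ m" by (rule funpow_linear)
    show ?thesis
      by (simp add: funpow_Suc_right q1 q2 P_arg_comb[OF zg] f.add f.scale \<phi>.add \<phi>.scale del: funpow.simps)
  qed
  moreover have "poly.coeff (q1 + pCons 0 q2) 0 = \<phi> ((P u ^^ Suc m) z)"
    by (simp add: q1 funpow_Suc_right del: funpow.simps)
  moreover have "poly.coeff (q1 + pCons 0 q2) 1 = of_nat (Suc m) * \<phi> ((P u ^^ (Suc m - 1)) (P x z))"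
  proof (cases m)
    case 0
    then show ?thesis using q1 q2 by simp
  next
    case (Suc l)
    have "P x (P u z) = P u (P x z)" using P_commute[OF zg] .
    then have "(P u ^^ (m - 1)) (P x (P u z)) = (P u ^^ m) (P x z)"
      by (simp add: Suc funpow_Suc_right del: funpow.simps)
    then show ?thesis using q1 q2 by (simp add: distrib_right)
  qed
  ultimately show ?case by blast
qed

text \<open>The factors \<open>P u\<close> are exchanged one at a time. Vanishing for every vector
  makes the polynomial in \<open>\<epsilon>\<close> zero, and its linear coefficient is
  \<open>p\<close> times the value with one factor exchanged; here \<open>p\<close> is a nonzero
  integer in characteristic 0.\<close>

lemma polarization:
  assumes \<phi>: "lin sV (*) \<phi>"
    and z: "\<And>u y. y \<in> K v i (t + m) \<Longrightarrow> \<phi> ((P u ^^ m) y) = 0"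
    and y: "y \<in> K v i (t + m)"
  shows "length us \<le> m \<Longrightarrow> \<phi> ((P u ^^ (m - length us)) (foldr P us y)) = 0"
proof (induction us arbitrary: u)
  case Nil
  then show ?case using z y by simp
next
  case (Cons x us)
  define p where "p = m - length us"
  have p: "p \<ge> 1" "m = p + length us" using Cons.prems by (auto simp: p_def)
  let ?z = "foldr P us y"
  have "?z \<in> K v i (t + p)" using K_foldr[of y v i "t + p" us] y p by (simp add: add.assoc)
  then obtain q where q: "\<And>\<epsilon>. poly q \<epsilon> = \<phi> ((P (u + sT \<epsilon> x) ^^ p) ?z)"
    "poly.coeff q 1 = of_nat p * \<phi> ((P u ^^ (p - 1)) (P x ?z))"
    using polarization_poly[OF \<phi>, of ?z v i t p u x] by blast
  have "poly q = poly 0" using q(1) Cons by (auto simp: p_def)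
  then have "q = 0" by (simp add: poly_eq_poly_eq_iff)
  then have "\<phi> ((P u ^^ (p - 1)) (P x ?z)) = 0" using q(2) p(1) by simp
  moreover have "m - length (x # us) = p - 1" by (simp add: p_def)
  ultimately show ?case by simp
qed

text \<open>Iterating the span condition \<open>m\<close> times shows that the \<open>m\<close>-fold
  products of contractions span \<open>K v i t\<close>.\<close>

lemma functional_zero_from_products:
  assumes \<phi>: "lin sV (*) \<phi>"
    and soc: "\<And>t'. t \<le> t' \<Longrightarrow> t' < t + m \<Longrightarrow> K v i t' \<subseteq> V.span (\<Union>y. P y ` K v i (Suc t'))"
    and z: "\<And>us y. length us = m \<Longrightarrow> y \<in> K v i (t + m) \<Longrightarrow> \<phi> (foldr P us y) = 0"
  shows "y \<in> K v i t \<Longrightarrow> \<phi> y = 0"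
  using soc z
proof (induction m arbitrary: y)
  case 0
  then show ?case by (auto dest: meta_spec[of _ "[]"])
next
  case (Suc m)
  show ?case
  proof (rule Suc.IH)
    show "y \<in> K v i t" by fact
    show "K v i t' \<subseteq> V.span (\<Union>y. P y ` K v i (Suc t'))" if "t \<le> t'" "t' < t + m" for t'
      using Suc.prems(2) that by simp
    fix us :: "'t list" and y assume us: "length us = m" and y: "y \<in> K v i (t + m)"
    have lin: "lin sV (*) (\<lambda>y. \<phi> (foldr P us y))"
    proof -
      have "lin sV sV (foldr P us)" for us
      proof (induction us)
        case Nil
        then show ?case using V.vector_space_axioms by (simp add: lin_iff)
      next
        case (Cons u us)
        then show ?case using P_linear[of u] by (simp add: lin_iff)
      qed
      from this[of us] \<phi> show ?thesis by (simp add: lin_iff)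
    qed
    interpret l: Vector_Spaces.linear sV "(*)" "\<lambda>y. \<phi> (foldr P us y)" by (rule lin)
    have "y \<in> V.span (\<Union>y. P y ` K v i (Suc (t + m)))" using Suc.prems(2)[of "t + m"] y by auto
    then show "\<phi> (foldr P us y) = 0"
    proof (rule l.eq_0_on_span[rotated])
      fix x assume "x \<in> (\<Union>y. P y ` K v i (Suc (t + m)))"
      then obtain u y' where "x = P u y'" "y' \<in> K v i (Suc (t + m))" by blast
      then show "\<phi> (foldr P us x) = 0" using Suc.prems(3)[of "us @ [u]" y'] us by simp
    qed
  qed
qed

text \<open>The images form a decreasing chain of subspaces of \<open>K v i t\<close>, and its
  dimension can drop at most \<open>dim (K v i t)\<close> times. This bound on \<open>m\<close>
  limits how many degrees of exactness \<open>generic_surjective\<close> consumes.\<close>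

lemma plateau:
  "\<exists>m \<le> V.dim (K v i t). (P w ^^ m) ` K v i (t + m) = (P w ^^ Suc m) ` K v i (t + Suc m)"
proof (rule ccontr)
  assume neg: "\<not> ?thesis"
  let ?J = "\<lambda>m. (P w ^^ m) ` K v i (t + m)"
  let ?d = "V.dim (K v i t)"
  have sub: "?J (Suc m) \<subseteq> ?J m" for m
    using derivation_mem[OF K_derivation, of _ v i "t + m" w] by (auto simp: funpow_Suc_right simp del: funpow.simps)
  have J: "?J m \<subseteq> K v i t" for m using K_funpow by blast
  have ss: "V.subspace (?J m)" for m
  proof -
    interpret f: Vector_Spaces.linear sV sV "P w ^^ m" by (rule funpow_linear)
    show ?thesis by (rule f.subspace_image[OF subspace_K])
  qed
  have "V.dim (?J m) + m \<le> ?d" if "m \<le> Suc ?d" for m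
    using that
  proof (induction m)
    case (Suc m)
    have "V.dim (?J (Suc m)) < V.dim (?J m)"
      using V.subspace_eq_if_dim_le[OF V.fin_dim_subset[OF fin_dim_K' J[of m]] ss[of "Suc m"] sub] neg Suc.prems
      by (metis Suc_le_mono not_le)
    then show ?case using Suc by simp
  qed simp
  from this[of "Suc ?d"] show False by simp
qed

text \<open>An exchange step. It leaves \<open>v a\<close> for \<open>a < i\<close> alone, and with
  it everything already achieved at levels up to \<open>i\<close>.\<close>

lemma dual_bases_update:
  assumes v: "dual_bases n v e" and i: "i < n" and w: "e i w \<noteq> 0"
  shows "\<exists>e'. dual_bases n (v(i := w)) e'"
proof -
  define e' where "e' = (\<lambda>a x. if a = i then e i x / e i w else e a x - e a w * (e i x / e i w))"
  have "lin sT (*) (e' a)" if "a < n" for a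
    using dual_bases_linear[OF v that] dual_bases_linear[OF v i]
    by (auto simp: e'_def lin_iff add_divide_distrib algebra_simps)
  moreover have "e' a ((v(i := w)) b) = (if a = b then 1 else 0)" if "a < n" "b < n" for a b
    using dual_bases_eval[OF v] that i w by (auto simp: e'_def)
  moreover have "x = (\<Sum>a<n. sT (e' a x) ((v(i := w)) a))" for x
  proof -
    let ?c = "e i x / e i w"
    have rem: "(\<Sum>a<n. f a) = f i + (\<Sum>a\<in>{..<n} - {i}. f a)" for f :: "nat \<Rightarrow> 't"
      using i by (simp add: sum.remove)
    have rest: "(\<Sum>a\<in>{..<n} - {i}. sT (e a y) (v a)) = y - sT (e i y) (v i)" for y
      using rem[of "\<lambda>a. sT (e a y) (v a)"] dual_bases_expand[OF v, of y] by (simp add: eq_diff_eq add.commute)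
    have "(\<Sum>a\<in>{..<n} - {i}. sT (e' a x) ((v(i := w)) a))
        = (\<Sum>a\<in>{..<n} - {i}. sT (e a x) (v a) - sT ?c (sT (e a w) (v a)))"
      by (intro sum.cong refl) (auto simp: e'_def T.scale_left_diff_distrib mult.commute)
    also have "\<dots> = (x - sT (e i x) (v i)) - sT ?c (w - sT (e i w) (v i))"
      unfolding sum_subtractf T.scale_sum_right[symmetric] rest ..
    also have "\<dots> = x - sT ?c w" using w by (simp add: T.scale_right_diff_distrib)
    finally show ?thesis unfolding rem[of "\<lambda>a. sT (e' a x) ((v(i := w)) a)"] by (simp add: e'_def)
  qed
  ultimately show ?thesis unfolding dual_bases_def by blast
qed

text \<open>Suppose that \<open>w\<close> has maximal rank and \<open>\<phi>\<close> kills the image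
  of its contraction. Along \<open>w + \<epsilon> u\<close> the rank is unchanged for almost all
  \<open>\<epsilon>\<close>, so \<open>\<phi>\<close> deforms to \<open>\<Phi>\<close> with
  \<open>\<Phi> (P w y) = - \<epsilon> \<Phi> (P u y)\<close>. Iterating this on a plateau of the
  powers of \<open>P w\<close> shows that \<open>\<phi>\<close> kills all
  \<open>(P u ^^ m) y\<close>. By polarization it kills all \<open>m\<close>-fold products, and by
  \<open>socle\<close> these span \<open>K v i t\<close>. So \<open>\<phi>\<close> is zero on
  \<open>K v i t\<close>, and the image is everything.\<close>

lemma generic_surjective:
  assumes v: "dual_bases n v e" and i: "i < n"
    and ex: "\<And>t. k \<le> t \<Longrightarrow> t \<le> B + (\<Sum>t\<le>B. V.dim (g t)) \<Longrightarrow> exact_at v i t"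
  shows "\<exists>w. e i w \<noteq> 0 \<and> (\<forall>t. k \<le> t \<longrightarrow> t \<le> B \<longrightarrow> P w ` K v i (Suc t) = K v i t)"
proof -
  define r where "r = (\<lambda>t w. V.dim (P w ` K v i (Suc t)))"
  have img: "P w ` K v i (Suc t) \<subseteq> K v i t" for w t using derivation_mem[OF K_derivation] by blast
  have fin: "V.fin_dim (P w ` K v i (Suc t))" for w t using V.fin_dim_subset[OF fin_dim_K' img] .
  have "r t w \<le> V.dim (K v i t)" for t w
    unfolding r_def using V.dim_subset_fin_dim[OF fin_dim_K'] img V.span_superset by blast
  then have bd: "(\<Sum>t=k..B. r t w) < Suc (\<Sum>t=k..B. V.dim (K v i t))" for w
    by (simp add: less_Suc_eq_le sum_mono)
  \<comment> \<open>The sum of the ranks is maximised so that one \<open>w\<close> serves all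
    degrees. The condition on \<open>e i\<close> keeps \<open>w\<close> eligible as the next basis
    vector.\<close>
  have "e i (v i) \<noteq> 0" using dual_bases_eval[OF v i i] by simp
  then obtain w where w: "e i w \<noteq> 0" "\<And>w'. e i w' \<noteq> 0 \<Longrightarrow> (\<Sum>t=k..B. r t w') \<le> (\<Sum>t=k..B. r t w)"
    using ex_has_greatest_nat[of "\<lambda>w. e i w \<noteq> 0" "v i" "\<lambda>w. \<Sum>t=k..B. r t w"] bd by blast
  have "P w ` K v i (Suc t) = K v i t" if t: "k \<le> t" "t \<le> B" for t
  proof (rule ccontr)
    assume neq: "P w ` K v i (Suc t) \<noteq> K v i t"
    then obtain x where x: "x \<in> K v i t" "x \<notin> P w ` K v i (Suc t)" using img by blast
    have ss: "V.subspace (P w ` K v i (Suc t))"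
    proof -
      interpret f: Vector_Spaces.linear sV sV "P w" by (rule P_linear)
      show ?thesis by (rule f.subspace_image[OF subspace_K])
    qed
    obtain \<phi> where \<phi>: "lin sV (*) \<phi>" "\<phi> x = 1" "\<And>y. y \<in> K v i (Suc t) \<Longrightarrow> \<phi> (P w y) = 0"
      using V.exists_functional[OF ss x(2)] by blast
    obtain m where m: "m \<le> V.dim (K v i t)" "(P w ^^ m) ` K v i (t + m) = (P w ^^ Suc m) ` K v i (t + Suc m)"
      using plateau by blast
    have pw: "\<phi> ((P u ^^ m) y) = 0" if y: "y \<in> K v i (t + m)" for u y
    proof -
      have comb: "(\<lambda>x. P w x + sV \<epsilon> (P u x)) ` K v i (Suc t') = P (w + sT \<epsilon> u) ` K v i (Suc t')" for t' \<epsilon>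
        using P_arg_comb K_subset[of v i "Suc t'"] by (intro image_cong) (auto simp: subset_iff)
      have "\<exists>c :: 'a poly. poly c 0 \<noteq> 0 \<and> (\<forall>\<epsilon>. poly c \<epsilon> \<noteq> 0 \<longrightarrow> r t' w \<le> r t' (w + sT \<epsilon> u))" for t'
        using V.pencil[OF P_linear[of w] P_linear[of u] subspace_K[of v i "Suc t'"] fin[of w t']] fin[of _ t']
        unfolding comb r_def by metis
      then obtain c :: "nat \<Rightarrow> 'a poly" where c: "\<And>t'. poly (c t') 0 \<noteq> 0"
          "\<And>t' \<epsilon>. poly (c t') \<epsilon> \<noteq> 0 \<Longrightarrow> r t' w \<le> r t' (w + sT \<epsilon> u)"
        by metis
      \<comment> \<open>Away from the roots of \<open>C\<close> no rank drops and
        \<open>w + \<epsilon> u\<close> is eligible. Maximality of the sum then forces every single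
        rank to be unchanged.\<close>
      define C where "C = (\<Prod>t'=k..B. c t') * [:e i w, e i u:]"
      have "poly C 0 \<noteq> 0" using c(1) w(1) by (simp add: C_def poly_prod)
      then have C0: "C \<noteq> 0" by auto
      have C: "r t (w + sT \<epsilon> u) \<le> r t w" if "poly C \<epsilon> \<noteq> 0" for \<epsilon>
      proof -
        have "e i (w + sT \<epsilon> u) = poly [:e i w, e i u:] \<epsilon>"
          using dual_bases_linear[OF v i] by (simp add: lin_iff)
        then have "e i (w + sT \<epsilon> u) \<noteq> 0" using that by (auto simp only: C_def poly_mult mult_zero_right)
        from w(2)[OF this] have "(\<Sum>t=k..B. r t (w + sT \<epsilon> u)) \<le> (\<Sum>t=k..B. r t w)" .
        moreover have le: "r t' w \<le> r t' (w + sT \<epsilon> u)" if "t' \<in> {k..B}" for t'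
        proof (rule c(2))
          have "(\<Prod>t'=k..B. poly (c t') \<epsilon>) \<noteq> 0" using \<open>poly C \<epsilon> \<noteq> 0\<close> unfolding C_def poly_mult poly_prod by (rule contrapos_nn) (simp only: mult_zero_left)
          then show "poly (c t') \<epsilon> \<noteq> 0" using that by (simp add: prod_zero_iff)
        qed
        ultimately have "(\<Sum>t=k..B. r t w) = (\<Sum>t=k..B. r t (w + sT \<epsilon> u))"
          by (intro antisym[OF sum_mono[OF le]])
        then have "r t w = r t (w + sT \<epsilon> u)"
          using sum_mono_inv[of "\<lambda>t. r t w" "{k..B}" "\<lambda>t. r t (w + sT \<epsilon> u)"] le t by auto
        then show ?thesis by simp
      qed
      obtain c' :: "'a poly" and \<Phi> where c': "poly c' 0 \<noteq> 0"
        and \<Phi>: "\<And>x. poly (\<Phi> x) 0 = poly c' 0 * \<phi> x" "\<And>y. y \<in> K v i (Suc t) \<Longrightarrow> \<Phi> (P w y) = - (pCons 0 1 * \<Phi> (P u y))"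
      proof (rule V.pencil[OF P_linear[of w] P_linear[of u] subspace_K[of v i "Suc t"] fin[of w t]], goal_cases)
        case (1 c)
        have "\<exists>\<Phi>. (\<forall>x. poly (\<Phi> x) 0 = poly c 0 * \<phi> x) \<and> (\<forall>u'\<in>K v i (Suc t). \<Phi> (P w u') = - (pCons 0 1 * \<Phi> (P u u')))"
          by (rule 1(4)[OF \<phi>(1) _ C0]) (use \<phi>(3) C fin infinite_UNIV_char_0 in \<open>auto simp: comb r_def\<close>)
        then show ?case using 1(1,2) by blast
      qed
      have pow: "\<Phi> ((P w ^^ p) y) = (- pCons 0 1) ^ p * \<Phi> ((P u ^^ p) y)" if "y \<in> K v i (t + p)" for p y
        using that
      proof (induction p arbitrary: y)
        case (Suc p)
        have "P w y \<in> K v i (t + p)" using derivation_mem[OF K_derivation, of y v i "t + p" w] Suc.prems by simp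
        then have "\<Phi> ((P w ^^ Suc p) y) = (- pCons 0 1) ^ p * \<Phi> ((P u ^^ p) (P w y))"
          using Suc.IH by (simp add: funpow_Suc_right del: funpow.simps)
        also have "(P u ^^ p) (P w y) = P w ((P u ^^ p) y)" by (rule funpow_commute[OF Suc.prems])
        also have "\<Phi> (P w ((P u ^^ p) y)) = - (pCons 0 1 * \<Phi> ((P u ^^ Suc p) y))"
          using \<Phi>(2)[of "(P u ^^ p) y"] K_funpow[of y v i "Suc t" p u] Suc.prems by simp
        finally show ?case by (simp add: mult_ac)
      qed simp
      \<comment> \<open>The plateau supplies one more factor \<open>P w\<close>, hence one factor
        \<open>\<epsilon>\<close> more than the \<open>m\<close> that cancel. What remains vanishes
        at 0, where \<open>\<Phi>\<close> is a nonzero multiple of \<open>\<phi>\<close>.\<close>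
      obtain y' where y': "y' \<in> K v i (t + Suc m)" "(P w ^^ m) y = (P w ^^ Suc m) y'" using m(2) y by blast
      have "(- pCons 0 1) ^ m * \<Phi> ((P u ^^ m) y) = (- pCons 0 1) ^ m * (- pCons 0 1 * \<Phi> ((P u ^^ Suc m) y'))"
        using pow[OF y] pow[OF y'(1)] y'(2) by (simp add: mult_ac)
      then have "\<Phi> ((P u ^^ m) y) = - pCons 0 1 * \<Phi> ((P u ^^ Suc m) y')"
        by (subst (asm) mult_left_cancel) auto
      then have "poly (\<Phi> ((P u ^^ m) y)) 0 = 0" by simp
      then show ?thesis using \<Phi>(1) c' by simp
    qed
    have "\<phi> x = 0"
    proof (rule functional_zero_from_products[OF \<phi>(1) _ _ x(1), of m])
      fix t' assume t': "t \<le> t'" "t' < t + m"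
      have "m \<le> V.dim (g t)" using m(1) V.dim_subset_fin_dim[OF fin_dim_g, of "K v i t" t] K_subset V.span_superset
        by (meson le_trans subset_trans)
      also have "\<dots> \<le> (\<Sum>t\<le>B. V.dim (g t))" using t by (intro member_le_sum) auto
      finally have "exact_at v i t'" using t t' by (intro ex) auto
      then show "K v i t' \<subseteq> V.span (\<Union>y. P y ` K v i (Suc t'))" by (rule socle[OF v i])
    next
      fix us :: "'t list" and y assume us: "length us = m" and y: "y \<in> K v i (t + m)"
      \<comment> \<open>The exponent is 0, so \<open>v 0\<close> is a mere placeholder.\<close>
      have "\<phi> ((P (v 0) ^^ (m - length us)) (foldr P us y)) = 0"
        by (rule polarization[OF \<phi>(1) pw y]) (use us in auto)
      then show "\<phi> (foldr P us y) = 0" using us by simp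
    qed
    then show False using \<phi>(2) by simp
  qed
  then show ?thesis using w(1) by blast
qed

lemma quasi_regular_basis:
  "i \<le> n \<Longrightarrow> \<exists>v e. dual_bases n v e \<and> (\<forall>t. k \<le> t \<longrightarrow> t \<le> B \<longrightarrow> exact_at v i t) \<and>
    (\<forall>i'<i. \<forall>t. k \<le> t \<longrightarrow> t \<le> B \<longrightarrow> surj_at v i' t)"
proof (induction i arbitrary: B)
  case 0
  then show ?case using ex_dual_bases P_exact unfolding exact_at_def by (auto simp: horizontal_0 K_0)
next
  case (Suc i)
  \<comment> \<open>Surjectivity is wanted up to \<open>Suc B\<close>, because
    \<open>exact_at_Suc\<close> in degree \<open>t\<close> uses it in degree \<open>t + 1\<close>.
    For that bound \<open>generic_surjective\<close> asks for exactness up to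
    \<open>C\<close>.\<close>
  define C where "C = Suc B + (\<Sum>t\<le>Suc B. V.dim (g t))"
  obtain v e where v: "dual_bases n v e" "\<And>t. k \<le> t \<Longrightarrow> t \<le> C \<Longrightarrow> exact_at v i t"
    "\<And>i' t. i' < i \<Longrightarrow> k \<le> t \<Longrightarrow> t \<le> C \<Longrightarrow> surj_at v i' t"
    using Suc.IH[of C] Suc.prems by auto
  obtain w where w: "e i w \<noteq> 0" "\<And>t. k \<le> t \<Longrightarrow> t \<le> Suc B \<Longrightarrow> P w ` K v i (Suc t) = K v i t"
    using generic_surjective[OF v(1), of i "Suc B"] v(2) Suc.prems unfolding C_def by auto
  define v' where "v' = v(i := w)"
  obtain e' where e': "dual_bases n v' e'"
    using dual_bases_update[OF v(1) _ w(1)] Suc.prems unfolding v'_def by auto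
  have agree: "\<And>a. a < i' \<Longrightarrow> v a = v' a" if "i' \<le> i" for i' using that by (simp add: v'_def)
  have Keq: "K v' i' t = K v i' t" if "i' \<le> i" for i' t by (rule K_cong) (use agree[OF that] in simp)
  have surj: "surj_at v' i' t" if "i' < Suc i" "k \<le> t" "t \<le> Suc B" for i' t
  proof (cases "i' = i")
    case True
    then show ?thesis using w(2)[OF that(2,3)] by (simp add: surj_at_def Keq) (simp add: v'_def)
  next
    case False
    then have "surj_at v i' t" using v(3) that by (auto simp: C_def)
    then show ?thesis using False that by (simp add: surj_at_def Keq) (simp add: v'_def)
  qed
  have "exact_at v' (Suc i) t" if "k \<le> t" "t \<le> B" for t
  proof (rule exact_at_Suc)
    show "exact_at v' i t" using v(2)[of t] exact_at_cong[of i v v' t] agree that by (auto simp: C_def)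
    show "surj_at v' i (Suc t)" using surj that by simp
  qed
  then show ?case using e' surj by (intro exI[of _ v'] exI[of _ e']) auto
qed

section \<open>Dimensions of the kernels along a basis\<close>

lemma dim_K_le: "V.dim (K v i (Suc t)) \<le> V.dim (K v (Suc i) (Suc t)) + V.dim (K v i t)"
proof -
  have "P (v i) ` K v i (Suc t) \<subseteq> V.span (K v i t)" using derivation_mem[OF K_derivation] V.span_base by blast
  then have "V.dim (P (v i) ` K v i (Suc t)) \<le> V.dim (K v i t)" using V.dim_subset_fin_dim[OF fin_dim_K'] by blast
  then show ?thesis
    using VV.rank_nullity_fin_dim[OF P_linear[of "v i"] subspace_K fin_dim_K', of v i "Suc t"] by (simp add: K_Suc)
qed

lemma dim_K_Suc:
  "surj_at v i t \<Longrightarrow> V.dim (K v i (Suc t)) = V.dim (K v (Suc i) (Suc t)) + V.dim (K v i t)"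
  using VV.rank_nullity_fin_dim[OF P_linear[of "v i"] subspace_K fin_dim_K', of v i "Suc t"]
  by (simp add: K_Suc surj_at_def)

end


subsection \<open>Dimensions of the cohomology\<close>

context spencer_module
begin

definition Z :: "nat \<Rightarrow> nat \<Rightarrow> ('t list \<Rightarrow> 'v) set" where
  "Z t j = {f \<in> Alt j (g t). dd P f = 0}"

definition Bd :: "nat \<Rightarrow> nat \<Rightarrow> ('t list \<Rightarrow> 'v) set" where
  "Bd t j = (case j of 0 \<Rightarrow> {0} | Suc j' \<Rightarrow> dd P ` Alt j' (g (Suc t)))"

lemma dim_alt: "F.fin_dim (Alt j (g t))" "F.dim (Alt j (g t)) = V.dim (g t) * (n choose j)"
proof -
  obtain v e where "dual_bases n v e" using ex_dual_bases by blast
  from dim_horizontal[OF this g_subspace fin_dim_g, of 0 j t]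
  show "F.fin_dim (Alt j (g t))" "F.dim (Alt j (g t)) = V.dim (g t) * (n choose j)"
    by (auto simp: horizontal_0)
qed

lemma linear_dd_P: "lin (fun_scale sV) (fun_scale sV) (dd P)"
  by (rule linear_dd[OF P_derivation[of 0]])

lemma Z_0: "Z 0 j = Alt j (g 0)"
  using dd_eq_0[of "g 0" P] P_g_0 by (auto simp: Z_def alt_tensors_def)

lemma subspace_Z: "F.subspace (Z t j)"
proof -
  interpret d: Vector_Spaces.linear "fun_scale sV" "fun_scale sV" "dd P" by (rule linear_dd_P)
  note ss = subspace_alt[OF g_subspace]
  show ?thesis
    by (rule F.subspaceI)
       (auto simp: Z_def d.zero d.add d.scale F.subspace_0[OF ss] F.subspace_add[OF ss] F.subspace_scale[OF ss]
          simp del: dd.simps)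
qed

lemma subspace_Bd: "F.subspace (Bd t j)"
proof -
  interpret d: Vector_Spaces.linear "fun_scale sV" "fun_scale sV" "dd P" by (rule linear_dd_P)
  show ?thesis by (cases j) (auto simp: Bd_def intro!: d.subspace_image subspace_alt g_subspace)
qed

lemma fin_dim_Z: "F.fin_dim (Z t j)"
  by (rule F.fin_dim_subset[OF dim_alt(1)]) (auto simp: Z_def)

lemma Bd_subset_Z: "Bd t j \<subseteq> Z t j"
proof (cases j)
  case 0
  then show ?thesis using F.subspace_0[OF subspace_Z] by (auto simp: Bd_def)
next
  case (Suc j')
  have "dd P f \<in> Z t j" if f: "f \<in> Alt j' (g (Suc t))" for f
    using dd_alt[OF P_derivation[of t] g_subspace f] dd_dd_g[of f t] f by (auto simp: Z_def Suc alt_tensors_def)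
  then show ?thesis by (auto simp: Bd_def Suc)
qed

lemma quotient_dim_Z_Bd:
  "int (quotient_dim (fun_scale sV) (Z t j) (Bd t j)) = int (F.dim (Z t j)) - int (F.dim (Bd t j))"
proof -
  have "F.dim (Bd t j) \<le> F.dim (Z t j)"
    by (rule F.dim_subset_fin_dim[OF fin_dim_Z]) (use Bd_subset_Z F.span_superset in blast)
  then show ?thesis
    using F.quotient_dim_eq[OF subspace_Z fin_dim_Z subspace_Bd Bd_subset_Z, of t j] by simp
qed

text \<open>The complex of total degree \<open>m\<close> ends in coefficient degree 0, where all
  forms are closed; so the last term, \<open>j = m\<close>, has no boundaries to add. Forms of
  degree above \<open>n\<close> are covered by vanishing binomial coefficients.\<close>

lemma euler_characteristic:
  "(\<Sum>j\<le>m. (-1) ^ j * int (n choose j) * int (V.dim (g (m - j))))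
   = (\<Sum>j\<le>m. (-1) ^ j * (int (F.dim (Z (m - j) j)) - int (F.dim (Bd (m - j) j))))"
proof -
  let ?z = "\<lambda>j. int (F.dim (Z (m - j) j))" and ?b = "\<lambda>j. int (F.dim (Bd (m - j) j))"
  have rn: "int (n choose j) * int (V.dim (g (m - j))) = ?z j + (if j < m then ?b (Suc j) else 0)" if "j \<le> m" for j
  proof (cases "j < m")
    case True
    then obtain t where t: "m - j = Suc t" "m - Suc j = t" by (metis Suc_diff_Suc)
    have "F.dim (Alt j (g (Suc t))) = F.dim (Z (Suc t) j) + F.dim (Bd t (Suc j))"
      using FF.rank_nullity_fin_dim[OF linear_dd_P subspace_alt[OF g_subspace] dim_alt(1), of j "Suc t"]
      by (simp add: Z_def Bd_def)
    then show ?thesis using True t dim_alt(2)[of j "Suc t"]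
      by (simp add: mult.commute flip: of_nat_mult of_nat_add)
  next
    case False
    then have "m - j = 0" using that by simp
    then show ?thesis using False dim_alt(2)[of j 0] Z_0[of j]
      by (simp add: mult.commute flip: of_nat_mult of_nat_add)
  qed
  have "(\<Sum>j\<le>m. (-1) ^ j * int (n choose j) * int (V.dim (g (m - j))))
      = (\<Sum>j\<le>m. (-1) ^ j * ?z j) + (\<Sum>j\<le>m. (-1) ^ j * (if j < m then ?b (Suc j) else 0))"
    using rn by (simp add: mult.assoc distrib_left sum.distrib[symmetric])
  also have "(\<Sum>j\<le>m. (-1) ^ j * (if j < m then ?b (Suc j) else 0)) = (\<Sum>j<m. (-1) ^ j * ?b (Suc j))"
    by (rule sum.mono_neutral_cong_right) auto
  also have "\<dots> = - (\<Sum>j\<le>m. (-1) ^ j * ?b j)"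
  proof -
    have "(\<Sum>j\<le>m. (-1) ^ j * ?b j) = ?b 0 + (\<Sum>j<m. (-1) ^ Suc j * ?b (Suc j))"
      using sum.lessThan_Suc_shift[of "\<lambda>j. (-1) ^ j * ?b j" m] by (simp add: lessThan_Suc_atMost)
    then show ?thesis by (simp add: Bd_def F.dim_zero sum_negf)
  qed
  finally show ?thesis by (simp add: sum_subtractf right_diff_distrib)
qed

lemma Z_Suc_0: "Z (Suc t) 0 = {0}"
proof -
  have "f = 0" if f: "f \<in> Z (Suc t) 0" for f
  proof
    have "f [] = 0"
    proof (rule P_nondegenerate[of _ t])
      show "f [] \<in> g (Suc t)" using f by (simp add: Z_def alt_tensors_def)
      have "dd P f [y] = 0" for y using f by (simp add: Z_def del: dd.simps)
      then show "P y (f []) = 0" for y by simp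
    qed
    moreover have "f xs = 0" if "xs \<noteq> []" for xs
      using f that by (auto simp: Z_def alt_tensors_def multilinear_maps_def)
    ultimately show "f xs = 0 xs" for xs by (cases "xs = []") auto
  qed
  then show ?thesis using F.subspace_0[OF subspace_Z] by auto
qed

lemma euler_acyclic:
  assumes acyclic: "\<And>t j. t \<noteq> k - 1 \<Longrightarrow> t + j > 0 \<Longrightarrow> Z t j = Bd t j" and m: "m \<ge> 1"
  shows "(\<Sum>j\<le>m. (-1) ^ j * int (n choose j) * int (V.dim (g (m - j)))) =
    (if k \<le> m then (-1) ^ (m - (k - 1)) *
       (int (F.dim (Z (k - 1) (m - (k - 1)))) - int (F.dim (Bd (k - 1) (m - (k - 1))))) else 0)"
proof -
  have zero: "int (F.dim (Z (m - j) j)) - int (F.dim (Bd (m - j) j)) = 0"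
    if "j \<le> m" "k \<le> m \<Longrightarrow> j \<noteq> m - (k - 1)" for j
  proof (cases "m - j = k - 1")
    case True
    \<comment> \<open>The place \<open>(k - 1, 0)\<close> is not covered by \<open>acyclic\<close>.
      It is met only for \<open>m = k - 1\<close>, and there nondegeneracy gives exactness.\<close>
    have "\<not> k \<le> m" using True that by auto
    then have "j = 0" "k - 1 = m" using True that(1) m by auto
    then have "Z (m - j) j = Bd (m - j) j" using m Z_Suc_0[of "m - 1"] by (simp add: Bd_def)
    then show ?thesis by simp
  next
    case False
    then have "Z (m - j) j = Bd (m - j) j" using that(1) m by (intro acyclic) auto
    then show ?thesis by simp
  qed
  show ?thesis
  proof (cases "k \<le> m")
    case True
    have "(\<Sum>j\<le>m. (-1) ^ j * (int (F.dim (Z (m - j) j)) - int (F.dim (Bd (m - j) j))))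
      = (\<Sum>j\<in>{m - (k - 1)}. (-1) ^ j * (int (F.dim (Z (m - j) j)) - int (F.dim (Bd (m - j) j))))"
      by (rule sum.mono_neutral_right) (use True zero in auto)
    then show ?thesis unfolding euler_characteristic using True by simp
  next
    case False
    then show ?thesis unfolding euler_characteristic
      by (simp, intro sum.neutral ballI) (use zero in auto)
  qed
qed

text \<open>The differences on the left still depend on \<open>v\<close>; they are identified with
  the Cartan characters in \<open>cartan_character_eq\<close>.\<close>

lemma quasi_regular_formula:
  assumes acyclic: "\<And>t j. t \<noteq> k - 1 \<Longrightarrow> t + j > 0 \<Longrightarrow> Z t j = Bd t j"
    and v: "dual_bases n v e" and surj: "\<And>i t. i < n \<Longrightarrow> k \<le> t \<Longrightarrow> t \<le> k + n \<Longrightarrow> surj_at v i t"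
    and h0: "h 0 = int (V.dim (g 0))"
    and h: "\<And>i. 1 \<le> i \<Longrightarrow> i \<le> n \<Longrightarrow> h i = int (quotient_dim (fun_scale sV) (Z (k - 1) i) (Bd (k - 1) i))"
    and l: "l \<in> {1..n}"
  shows "int (V.dim (K v (l - 1) k)) - int (V.dim (K v l k)) =
      int ((n + k - l - 1) choose (k - 1)) * h 0 +
       (\<Sum>i = n - l + 1..n. (-1) ^ (i - (n - l)) * int ((i - 1) choose (n - l)) * h i)"
proof (rule characters_from_euler[OF k_pos _ _ _ _ l, where D = "\<lambda>t. int (V.dim (g t))"
      and s = "\<lambda>l. int (V.dim (K v (l - 1) k)) - int (V.dim (K v l k))"])
  show "int (V.dim (g 0)) = h 0" using h0 by simp
  show "(\<Sum>j\<le>m. (-1) ^ j * int (n choose j) * int (V.dim (g (m - j)))) = 0" if "1 \<le> m" "m < k" for m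
    using euler_acyclic[OF acyclic that(1)] that by simp
  show "(\<Sum>j\<le>k - 1 + i. (-1) ^ j * int (n choose j) * int (V.dim (g (k - 1 + i - j)))) = (-1) ^ i * h i"
    if "1 \<le> i" "i \<le> n" for i
  proof -
    have "1 \<le> k - 1 + i" "k \<le> k - 1 + i" using that k_pos by auto
    then show ?thesis
      using euler_acyclic[OF acyclic, of "k - 1 + i"] h[OF that] by (simp add: quotient_dim_Z_Bd)
  qed
  fix u assume u: "u < n"
  have "int (V.dim (K v 0 (k + u))) = (\<Sum>l=Suc 0..n. (int (V.dim (K v (l - 1) (k + 0))) - int (V.dim (K v l (k + 0))))
      * int ((u + l - Suc 0) choose (l - Suc 0)))"
  proof (rule pascal_array[of n n "\<lambda>i m. int (V.dim (K v i (k + m)))" 0 u])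
    show "int (V.dim (K v i (k + Suc m))) = int (V.dim (K v (Suc i) (k + Suc m))) + int (V.dim (K v i (k + m)))"
      if "i < n" "m < n" for i m
      using dim_K_Suc[OF surj[of i "k + m"]] that by simp
    show "int (V.dim (K v n (k + m))) = 0" for m
      using K_n[OF v, of "k + m - 1"] k_pos by (simp add: V.dim_zero)
  qed (use u in auto)
  then show "int (V.dim (g (k + u))) = (\<Sum>l = 1..n. (int (V.dim (K v (l - 1) k)) - int (V.dim (K v l k))) *
       int (u + l - 1 choose (l - 1)))"
    by (simp add: K_0)
qed

section \<open>Cartan's test\<close>

lemma cartan_inequality:
  assumes "dual_bases n v e"
  shows "V.dim (g (Suc k)) \<le> (\<Sum>i<n. V.dim (K v i k))"
proof -
  have "i \<le> n \<Longrightarrow> V.dim (g (Suc k)) \<le> V.dim (K v i (Suc k)) + (\<Sum>i<i. V.dim (K v i k))" for i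
  proof (induction i)
    case (Suc i)
    then show ?case using dim_K_le[of v i k] by simp
  qed (simp add: K_0)
  from this[of n] show ?thesis using K_n[OF assms, of k] by (simp add: V.dim_zero)
qed

lemma cartan_equality:
  assumes "dual_bases n v e" "\<And>i. i < n \<Longrightarrow> surj_at v i k"
  shows "V.dim (g (Suc k)) = (\<Sum>i<n. V.dim (K v i k))"
proof -
  have "i \<le> n \<Longrightarrow> V.dim (g (Suc k)) = V.dim (K v i (Suc k)) + (\<Sum>i<i. V.dim (K v i k))" for i
  proof (induction i)
    case (Suc i)
    then show ?case using dim_K_Suc[OF assms(2)[of i]] by simp
  qed (simp add: K_0)
  from this[of n] show ?thesis using K_n[OF assms(1), of k] by (simp add: V.dim_zero)
qed

lemma quasi_regular_minimal:
  assumes "dual_bases n v e" "\<And>i. i < n \<Longrightarrow> surj_at v i k" "dual_bases n v' e'"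
    and le: "\<And>i. i < n \<Longrightarrow> V.dim (K v' i k) \<le> V.dim (K v i k)" and "i \<le> n"
  shows "V.dim (K v' i k) = V.dim (K v i k)"
proof (cases "i = n")
  case True
  then show ?thesis using K_n[OF assms(1), of "k - 1"] K_n[OF assms(3), of "k - 1"] k_pos by simp
next
  case False
  have "(\<Sum>i<n. V.dim (K v' i k)) = (\<Sum>i<n. V.dim (K v i k))"
    using cartan_inequality[OF assms(3)] cartan_equality[OF assms(1,2)] sum_mono[of "{..<n}" "\<lambda>i. V.dim (K v' i k)"] le
    by (intro antisym) auto
  then show ?thesis using sum_mono_inv[of "\<lambda>i. V.dim (K v' i k)" "{..<n}" "\<lambda>i. V.dim (K v i k)" i] le False assms(5) by auto
qed

end


subsection \<open>Symmetric tensors\<close>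

lemma sum_fun_apply: "(\<Sum>x\<in>X. G x) y = (\<Sum>x\<in>X. G x y)" for G :: "'x \<Rightarrow> 'y \<Rightarrow> 'z::comm_monoid_add"
  by (induction X rule: infinite_finite_induct) auto

context tensor_spaces
begin

lemma sym_multilinear: "f \<in> Sym m W \<Longrightarrow> f \<in> Mult m"
  unfolding sym_tensors_def by (elim CollectE conjE)

lemma sym_mset:
  assumes "f \<in> Sym m W" "mset xs = mset ys"
  shows "f xs = f ys"
proof -
  have "\<forall>xs ys. mset xs = mset ys \<longrightarrow> f xs = f ys"
    using assms(1) unfolding sym_tensors_def by (elim CollectE conjE)
  then show ?thesis using assms(2) by (elim allE impE)
qed

lemma symI:
  assumes "f \<in> Mult m" "\<And>xs. f xs \<in> W" "\<And>xs ys. mset xs = mset ys \<Longrightarrow> f xs = f ys"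
  shows "f \<in> Sym m W"
  unfolding sym_tensors_def by (intro CollectI conjI allI impI) (rule assms, assumption?)+

lemma sym_mem:
  assumes "f \<in> Sym m W"
  shows "f xs \<in> W"
proof -
  have "\<forall>xs. f xs \<in> W" using assms unfolding sym_tensors_def by (elim CollectE conjE)
  then show ?thesis ..
qed

lemma subspace_sym:
  assumes "V.subspace W"
  shows "F.subspace (Sym m W)"
proof (rule F.subspaceI)
  note ml = F.subspace_0[OF subspace_multilinear] F.subspace_add[OF subspace_multilinear] F.subspace_scale[OF subspace_multilinear]
  show "0 \<in> Sym m W" 
    by (rule symI[OF ml(1)]) (simp_all add: V.subspace_0[OF assms])
  show "f + g \<in> Sym m W" if f: "f \<in> Sym m W" and g: "g \<in> Sym m W" for f g
  proof (rule symI)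
    show "f + g \<in> Mult m" using f g by (intro ml sym_multilinear)
    show "(f + g) xs \<in> W" for xs using V.subspace_add[OF assms sym_mem[OF f] sym_mem[OF g]] by simp
    show "(f + g) xs = (f + g) ys" if "mset xs = mset ys" for xs ys
      unfolding plus_fun_def using sym_mset[OF f that] sym_mset[OF g that] by (rule arg_cong2)
  qed
  show "fun_scale sV c f \<in> Sym m W" if f: "f \<in> Sym m W" for c f
  proof (rule symI)
    show "fun_scale sV c f \<in> Mult m" using f by (intro ml sym_multilinear)
    show "fun_scale sV c f xs \<in> W" for xs using V.subspace_scale[OF assms sym_mem[OF f]] by (simp add: fun_scale_def)
    show "fun_scale sV c f xs = fun_scale sV c f ys" if "mset xs = mset ys" for xs ys
      unfolding fun_scale_def using sym_mset[OF f that] by (rule arg_cong)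
  qed
qed

lemma sym_zero_if_head_zero:
  assumes f: "f \<in> Sym m W" and "\<And>xs. f (x # xs) = 0" "x \<in> set xs"
  shows "f xs = 0"
proof -
  have "mset xs = mset (x # remove1 x xs)" using assms(3) by simp
  then have "f xs = f (x # remove1 x xs)" by (rule sym_mset[OF f])
  then show ?thesis using assms(2) by simp
qed

lemma sym_contract:
  assumes "f \<in> Sym (Suc m) W"
  shows "(\<lambda>xs. f (y # xs)) \<in> Sym m W"
proof -
  note ml = sym_multilinear[OF assms]
  have "(\<lambda>xs. f (y # xs)) \<in> Mult m"
    by (rule multilinearI) (use multilinear_length[OF ml] linear_slot[OF ml, of "y # _"] in auto)
  moreover have "f (y # xs) = f (y # ys)" if "mset xs = mset ys" for xs ys
    by (rule sym_mset[OF assms]) (simp add: that)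
  ultimately show ?thesis by (intro symI sym_mem[OF assms])
qed

text \<open>Tensors without arguments are both symmetric and alternating, so
  \<open>zero_forms\<close> also yields the dimension of \<open>g 0\<close>.\<close>

lemma sym_0_eq_alt_0: "Sym 0 W = Alt 0 W"
proof
  show "Sym 0 W \<subseteq> Alt 0 W"
  proof
    fix f assume f: "f \<in> Sym 0 W"
    have "f xs = 0" if "\<not> distinct xs" for xs
      using multilinear_length[OF sym_multilinear[OF f], of xs] that by (cases xs) auto
    then show "f \<in> Alt 0 W"
      using sym_multilinear[OF f] sym_mem[OF f] by (simp add: alt_tensors_def)
  qed
  show "Alt 0 W \<subseteq> Sym 0 W"
  proof
    fix f assume f: "f \<in> Alt 0 W"
    then have ml: "f \<in> Mult 0" by (simp add: alt_tensors_def)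
    show "f \<in> Sym 0 W"
    proof (rule symI[OF ml])
      show "f xs \<in> W" for xs using f by (simp add: alt_tensors_def)
      show "f xs = f ys" if "mset xs = mset ys" for xs ys
        using multilinear_length[OF ml, of xs] multilinear_length[OF ml, of ys] that
        by (cases "xs = []"; cases "ys = []") auto
    qed
  qed
qed

text \<open>The permanent of the matrix of values of the \<open>p b\<close> at the arguments, times
  \<open>v\<close>: the symmetric product without the factor \<open>1 / k!\<close>.\<close>

definition sym_prod :: "nat \<Rightarrow> (nat \<Rightarrow> 't \<Rightarrow> 'a) \<Rightarrow> 'v \<Rightarrow> 't list \<Rightarrow> 'v" where
  "sym_prod k p v = (\<lambda>xs. if length xs = k
     then sV (\<Sum>\<sigma> | \<sigma> permutes {..<k}. \<Prod>a<k. p (\<sigma> a) (xs ! a)) v else 0)"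

lemma sym_power_of_eq: "sym_power_of sV k U = F.span {sym_prod k p v | p v. \<forall>a<k. p a \<in> U}"
  unfolding sym_power_of_def sym_prod_def ..

lemma sym_prod_sym:
  assumes p: "\<And>a. a < k \<Longrightarrow> lin sT (*) (p a)"
  shows "sym_prod k p v \<in> Sym k UNIV"
proof -
  have "lin sT sV (\<lambda>x. sym_prod k p v (us @ x # vs))" if len: "length us + 1 + length vs = k" for us vs
  proof -
    let ?j = "length us"
    have j: "?j \<in> {..<k}" using len by simp
    \<comment> \<open>The factors that do not contain \<open>x\<close>. Position \<open>?j\<close>
      is left out of the product, so the entry 0 put there is arbitrary.\<close>
    define c where "c = (\<lambda>\<sigma>. \<Prod>a\<in>{..<k} - {?j}. p (\<sigma> a) ((us @ 0 # vs) ! a))"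
    have "(\<Prod>a<k. p (\<sigma> a) ((us @ x # vs) ! a)) = p (\<sigma> ?j) x * c \<sigma>" for \<sigma> x
    proof -
      have "(\<Prod>a<k. p (\<sigma> a) ((us @ x # vs) ! a))
          = p (\<sigma> ?j) x * (\<Prod>a\<in>{..<k} - {?j}. p (\<sigma> a) ((us @ x # vs) ! a))"
        using j by (subst prod.remove[of _ ?j]) auto
      also have "(\<Prod>a\<in>{..<k} - {?j}. p (\<sigma> a) ((us @ x # vs) ! a)) = c \<sigma>"
        unfolding c_def by (intro prod.cong refl) (auto simp: nth_append nth_Cons')
      finally show ?thesis .
    qed
    then have eq: "sym_prod k p v (us @ x # vs) = sV (\<Sum>\<sigma> | \<sigma> permutes {..<k}. p (\<sigma> ?j) x * c \<sigma>) v" for x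
      using len by (simp add: sym_prod_def)
    have lin: "p (\<sigma> ?j) (x + y) = p (\<sigma> ?j) x + p (\<sigma> ?j) y" "p (\<sigma> ?j) (sT t x) = t * p (\<sigma> ?j) x"
      if "\<sigma> permutes {..<k}" for \<sigma> x y t
      using p[of "\<sigma> ?j"] permutes_in_image[OF that, of ?j] j by (auto simp: lin_iff)
    show ?thesis unfolding eq lin_iff
    proof (intro conjI allI T.vector_space_axioms V.vector_space_axioms)
      fix x y t
      show "sV (\<Sum>\<sigma> | \<sigma> permutes {..<k}. p (\<sigma> ?j) (x + y) * c \<sigma>) v
        = sV (\<Sum>\<sigma> | \<sigma> permutes {..<k}. p (\<sigma> ?j) x * c \<sigma>) v + sV (\<Sum>\<sigma> | \<sigma> permutes {..<k}. p (\<sigma> ?j) y * c \<sigma>) v"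
        by (simp add: lin distrib_right sum.distrib V.scale_left_distrib)
      show "sV (\<Sum>\<sigma> | \<sigma> permutes {..<k}. p (\<sigma> ?j) (sT t x) * c \<sigma>) v
        = sV t (sV (\<Sum>\<sigma> | \<sigma> permutes {..<k}. p (\<sigma> ?j) x * c \<sigma>) v)"
        by (simp add: lin mult.assoc sum_distrib_left[symmetric])
    qed
  qed
  then have ml: "sym_prod k p v \<in> Mult k"
    by (intro multilinearI) (auto simp: sym_prod_def)
  have "sym_prod k p v xs = sym_prod k p v ys" if m: "mset xs = mset ys" for xs ys
  proof (cases "length ys = k")
    case True
    obtain \<pi> where \<pi>: "\<pi> permutes {..<length ys}" "permute_list \<pi> ys = xs"
      using mset_eq_permutation[OF m] by blast
    have nth: "xs ! a = ys ! \<pi> a" if "a < k" for a using \<pi> that True by (auto simp: permute_list_def)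
    have \<pi>k: "\<pi> permutes {..<k}" using \<pi>(1) True by simp
    have "(\<Sum>\<sigma> | \<sigma> permutes {..<k}. \<Prod>a<k. p (\<sigma> a) (xs ! a))
        = (\<Sum>\<sigma> | \<sigma> permutes {..<k}. \<Prod>a<k. p (\<sigma> a) (ys ! \<pi> a))"
      by (intro sum.cong prod.cong refl) (simp add: nth)
    also have "\<dots> = (\<Sum>\<sigma> | \<sigma> permutes {..<k}. \<Prod>a<k. p ((\<sigma> \<circ> \<pi>) a) (ys ! \<pi> a))"
      by (rule sum_permutations_compose_right[OF \<pi>k])
    also have "\<dots> = (\<Sum>\<sigma> | \<sigma> permutes {..<k}. \<Prod>a<k. p (\<sigma> a) (ys ! a))"
    proof (intro sum.cong refl)
      fix \<sigma>
      show "(\<Prod>a<k. p ((\<sigma> \<circ> \<pi>) a) (ys ! \<pi> a)) = (\<Prod>a<k. p (\<sigma> a) (ys ! a))"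
        using prod.permute[OF \<pi>k, of "\<lambda>a. p (\<sigma> a) (ys ! a)"] by (simp add: comp_def)
    qed
    finally show ?thesis using True mset_eq_length[OF m] by (simp add: sym_prod_def)
  next
    case False
    then show ?thesis using mset_eq_length[OF m] by (simp add: sym_prod_def)
  qed
  with ml show ?thesis by (rule symI[OF _ UNIV_I])
qed

lemma sym_prod_head_zero:
  assumes "k \<ge> 1" "\<And>a. a < k \<Longrightarrow> p a x = 0"
  shows "sym_prod k p v (x # xs) = 0"
proof -
  have "(\<Prod>a<k. p (\<sigma> a) ((x # xs) ! a)) = 0" if "\<sigma> permutes {..<k}" for \<sigma>
  proof (rule prod_zero)
    have "\<sigma> 0 < k" using permutes_in_image[OF that, of 0] assms(1) by simp
    then show "\<exists>a\<in>{..<k}. p (\<sigma> a) ((x # xs) ! a) = 0" using assms by (intro bexI[of _ 0]) auto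
  qed simp
  then have "(\<Sum>\<sigma> | \<sigma> permutes {..<k}. \<Prod>a<k. p (\<sigma> a) ((x # xs) ! a)) = 0" by (intro sum.neutral) auto
  then show ?thesis by (simp add: sym_prod_def)
qed

lemma sym_prod_dual_basis:
  assumes v: "dual_bases n v e" and as: "set as \<subseteq> {..<n}" "length as = k" and bs: "set bs \<subseteq> {..<n}" "length bs = k"
  shows "sym_prod k (\<lambda>j. e (as ! j)) w (map v bs)
    = (\<Sum>\<sigma> | \<sigma> permutes {..<k}. if permute_list \<sigma> as = bs then w else 0)"
proof -
  have "(\<Prod>a<k. e (as ! \<sigma> a) (map v bs ! a)) = (if permute_list \<sigma> as = bs then 1 else 0)" if \<sigma>: "\<sigma> permutes {..<k}" for \<sigma>
  proof -
    have lt: "\<sigma> a < k" if "a < k" for a using permutes_in_image[OF \<sigma>, of a] that by simp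
    have "(\<Prod>a<k. e (as ! \<sigma> a) (map v bs ! a)) = (\<Prod>a<k. if as ! \<sigma> a = bs ! a then 1 else 0)"
    proof (intro prod.cong refl)
      fix a assume "a \<in> {..<k}"
      then have a: "a < k" by simp
      have "as ! \<sigma> a < n" "bs ! a < n" 
        using as bs lt[OF a] a nth_mem[of "\<sigma> a" as] nth_mem[of a bs] by (metis lessThan_iff subsetD)+
      then show "e (as ! \<sigma> a) (map v bs ! a) = (if as ! \<sigma> a = bs ! a then 1 else 0)"
        using dual_bases_eval[OF v] bs a by simp
    qed
    also have "\<dots> = (if \<forall>a<k. as ! \<sigma> a = bs ! a then 1 else 0)"
      by (auto intro!: prod_zero)
    also have "(\<forall>a<k. as ! \<sigma> a = bs ! a) \<longleftrightarrow> permute_list \<sigma> as = bs"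
      using as bs by (auto simp: permute_list_def list_eq_iff_nth_eq)
    finally show ?thesis .
  qed
  then have "(\<Sum>\<sigma> | \<sigma> permutes {..<k}. \<Prod>a<k. e (as ! \<sigma> a) (map v bs ! a))
      = (\<Sum>\<sigma> | \<sigma> permutes {..<k}. if permute_list \<sigma> as = bs then 1 else 0)" by (intro sum.cong) auto
  then have "sym_prod k (\<lambda>j. e (as ! j)) w (map v bs)
      = sV (\<Sum>\<sigma> | \<sigma> permutes {..<k}. if permute_list \<sigma> as = bs then 1 else 0) w" using bs by (simp add: sym_prod_def)
  also have "\<dots> = (\<Sum>\<sigma> | \<sigma> permutes {..<k}. if permute_list \<sigma> as = bs then w else 0)"
    unfolding V.scale_sum_left by (intro sum.cong) auto
  finally show ?thesis .
qed

end

locale tensor_spaces_char_0 = tensor_spaces sT sV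
  for sT :: "'a::field_char_0 \<Rightarrow> 't::ab_group_add \<Rightarrow> 't" and sV :: "'a \<Rightarrow> 'v::ab_group_add \<Rightarrow> 'v"
begin

text \<open>Both sides are compared on lists of basis vectors. The sum runs over lists and not
  multisets: each permutation carries exactly one list to \<open>bs\<close>, so the value at
  \<open>bs\<close> occurs \<open>k!\<close> times, which explains the factor.\<close>

lemma sym_expand:
  assumes v: "dual_bases n v e" and f: "f \<in> Sym k UNIV"
  shows "f = (\<Sum>as | set as \<subseteq> {..<n} \<and> length as = k.
      fun_scale sV (1 / fact k) (sym_prod k (\<lambda>j. e (as ! j)) (f (map v as))))"
    (is "f = ?h")
proof -
  let ?A = "{as. set as \<subseteq> {..<n} \<and> length as = k}"
  have finA: "finite ?A" by (rule finite_lists_length_eq) simp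
  have "sym_prod k (\<lambda>j. e (as ! j)) w \<in> Sym k UNIV" if "as \<in> ?A" for as w
  proof (rule sym_prod_sym)
    fix a assume "a < k"
    then have "as ! a < n" using that nth_mem[of a as] by blast
    then show "lin sT (*) (e (as ! a))" by (rule dual_bases_linear[OF v])
  qed
  then have "?h \<in> Sym k UNIV"
    by (intro F.subspace_sum F.subspace_scale subspace_sym) auto
  then have "f - ?h \<in> Sym k UNIV" using f by (intro F.subspace_diff subspace_sym) auto
  then have ml: "f - ?h \<in> Mult k" by (rule sym_multilinear)
  have z: "(f - ?h) xs = 0" for xs
  proof (rule multilinear_zero_on_basis[OF v ml])
    fix bs assume bs: "set bs \<subseteq> {..<n}"
    show "(f - ?h) (map v bs) = 0"
    proof (cases "length bs = k")
      case False
      then show ?thesis using multilinear_length[OF ml, of "map v bs"] by simp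
    next
      case len: True
      have "?h (map v bs) = (\<Sum>as\<in>?A. sV (1 / fact k) (sym_prod k (\<lambda>j. e (as ! j)) (f (map v as)) (map v bs)))"
        by (simp add: sum_fun_apply fun_scale_def)
      also have "\<dots> = sV (1 / fact k) (\<Sum>as\<in>?A. \<Sum>\<sigma> | \<sigma> permutes {..<k}. if permute_list \<sigma> as = bs then f (map v as) else 0)"
        unfolding V.scale_sum_right[symmetric]
        by (intro arg_cong2[where f = sV] refl sum.cong sym_prod_dual_basis[OF v]) (use bs len in auto)
      also have "(\<Sum>as\<in>?A. \<Sum>\<sigma> | \<sigma> permutes {..<k}. if permute_list \<sigma> as = bs then f (map v as) else 0)
          = (\<Sum>\<sigma> | \<sigma> permutes {..<k}. \<Sum>as\<in>?A. if permute_list \<sigma> as = bs then f (map v as) else 0)"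
        by (rule sum.swap)
      also have "\<dots> = (\<Sum>\<sigma> | \<sigma> permutes {..<k}. f (map v bs))"
      proof (intro sum.cong refl)
        fix \<sigma> assume "\<sigma> \<in> {\<sigma>. \<sigma> permutes {..<k}}"
        then have \<sigma>: "\<sigma> permutes {..<k}" by simp
        define a0 where "a0 = permute_list (inv \<sigma>) bs"
        have i: "inv \<sigma> permutes {..<k}" by (rule permutes_inv[OF \<sigma>])
        have m0: "mset a0 = mset bs" unfolding a0_def using i len by (intro mset_permute_list) simp
        have a0: "a0 \<in> ?A" using m0 bs len by (metis (mono_tags, lifting) mem_Collect_eq mset_eq_setD size_mset)
        have "permute_list \<sigma> as = bs \<longleftrightarrow> as = a0" if as: "as \<in> ?A" for as
        proof
          have lenas: "length as = k" using as by simp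
          show "as = a0" if "permute_list \<sigma> as = bs"
          proof -
            have "permute_list (inv \<sigma>) (permute_list \<sigma> as) = permute_list (\<sigma> \<circ> inv \<sigma>) as"
              using i lenas by (intro permute_list_compose[symmetric]) simp
            then show ?thesis using that permutes_inv_o(1)[OF \<sigma>] by (simp add: a0_def)
          qed
          show "permute_list \<sigma> as = bs" if "as = a0"
          proof -
            have "permute_list \<sigma> (permute_list (inv \<sigma>) bs) = permute_list (inv \<sigma> \<circ> \<sigma>) bs"
              using \<sigma> len by (intro permute_list_compose[symmetric]) simp
            then show ?thesis using that permutes_inv_o(2)[OF \<sigma>] by (simp add: a0_def)
          qed
        qed
        then have "(\<Sum>as\<in>?A. if permute_list \<sigma> as = bs then f (map v as) else 0)
            = (\<Sum>as\<in>?A. if as = a0 then f (map v as) else 0)" by (intro sum.cong) auto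
        also have "\<dots> = f (map v a0)" using finA a0 by simp
        also have "\<dots> = f (map v bs)" by (rule sym_mset[OF f]) (simp add: m0)
        finally show "(\<Sum>as\<in>?A. if permute_list \<sigma> as = bs then f (map v as) else 0) = f (map v bs)" .
      qed
      also have "\<dots> = sV (fact k) (f (map v bs))"
        using card_permutations[of "{..<k}" k] by (simp add: V.sum_constant_scale)
      finally show ?thesis by simp
    qed
  qed
  have "f - ?h = 0" by (rule ext) (simp only: z zero_fun_def)
  then show ?thesis by (simp only: right_minus_eq)
qed

text \<open>The span of \<open>e_i, ..., e_{n-1}\<close> is the annihilator of
  \<open>v_0, ..., v_{i-1}\<close>. A tensor killed by these vectors has zero coefficient at every
  term of its expansion with an index below \<open>i\<close>. This turns the flag spaces of the
  Cartan characters into common kernels of contractions.\<close>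

lemma sym_power_of_flag:
  assumes v: "dual_bases n v e" and "i \<le> n" "k \<ge> 1"
  shows "sym_power_of sV k (module.span (fun_scale (*)) (e ` {i..<n}))
    = {f \<in> Sym k UNIV. \<forall>a<i. \<forall>xs. f (v a # xs) = 0}" (is "_ = ?R")
proof
  interpret D: lin_space "fun_scale (*) :: 'a \<Rightarrow> ('t \<Rightarrow> 'a) \<Rightarrow> 't \<Rightarrow> 'a"
    unfolding lin_space_def by (rule vector_space.vector_space_fun_scale[OF vector_space_mult])
  let ?U = "D.span (e ` {i..<n})"
  have "lin sT (*) p \<and> (\<forall>a<i. p (v a) = 0)" if "p \<in> ?U" for p
    using that
  proof (induction rule: D.span_induct_alt)
    case base
    show ?case using T.vector_space_axioms vector_space_mult by (simp add: lin_iff)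
  next
    case (step c x y)
    then obtain b where b: "x = e b" "i \<le> b" "b < n" by auto
    show ?case using step(2) dual_bases_linear[OF v b(3)] dual_bases_eval[OF v b(3)] b assms(2)
      by (auto simp: lin_iff fun_scale_def algebra_simps)
  qed
  then have U: "lin sT (*) p" "a < i \<Longrightarrow> p (v a) = 0" if "p \<in> ?U" for p a
    using that by auto
  have ss: "F.subspace ?R"
  proof (rule F.subspaceI)
    note sym = F.subspace_0[OF subspace_sym] F.subspace_add[OF subspace_sym] F.subspace_scale[OF subspace_sym]
    show "0 \<in> ?R" using sym by simp
    show "f + g \<in> ?R" if "f \<in> ?R" "g \<in> ?R" for f g using that sym by simp
    show "fun_scale sV c f \<in> ?R" if "f \<in> ?R" for c f using that sym by (simp add: fun_scale_def)
  qed
  show "sym_power_of sV k ?U \<subseteq> ?R"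
    unfolding sym_power_of_eq
  proof (rule F.span_minimal[OF _ ss])
    show "{sym_prod k p w |p w. \<forall>a<k. p a \<in> ?U} \<subseteq> ?R"
      using sym_prod_sym sym_prod_head_zero[OF assms(3)] U by fastforce
  qed
  show "?R \<subseteq> sym_power_of sV k ?U"
  proof
    fix f assume f: "f \<in> ?R"
    then have fs: "f \<in> Sym k UNIV" by simp
    have "sym_prod k (\<lambda>j. e (as ! j)) (f (map v as)) \<in> sym_power_of sV k ?U"
      if as: "set as \<subseteq> {..<n}" "length as = k" for as
    proof (cases "set as \<subseteq> {i..<n}")
      case True
      then have "\<forall>j<k. e (as ! j) \<in> ?U" using as nth_mem by (intro allI impI D.span_base imageI) blast
      then show ?thesis unfolding sym_power_of_eq by (intro F.span_base) blast
    next
      case False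
      then obtain a where a: "a \<in> set as" "a < i" using as by (force simp: not_less)
      have "f (map v as) = 0" by (rule sym_zero_if_head_zero[OF fs, of "v a"]) (use f a in auto)
      then have "sym_prod k (\<lambda>j. e (as ! j)) (f (map v as)) = 0" by (auto simp: sym_prod_def)
      then show ?thesis unfolding sym_power_of_eq using F.span_zero by simp
    qed
    then have "(\<Sum>as | set as \<subseteq> {..<n} \<and> length as = k.
      fun_scale sV (1 / fact k) (sym_prod k (\<lambda>j. e (as ! j)) (f (map v as)))) \<in> sym_power_of sV k ?U"
      unfolding sym_power_of_eq by (intro F.span_sum F.span_scale) auto
    then show "f \<in> sym_power_of sV k ?U" using sym_expand[OF v fs] by simp
  qed
qed

end


subsection \<open>Coframes and generic flags\<close>

lemma fun_algebra_coframe_polys: "fun_algebra (coframe_polys n)"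
  unfolding fun_algebra_def by (auto intro: coframe_polys.intros)

lemma coframe_polys_line:
  assumes "Q \<in> coframe_polys n"
  shows "\<exists>q. \<forall>\<epsilon>. Q (\<lambda>a x. e1 a x + \<epsilon> * (e2 a x - e1 a x)) = poly q \<epsilon>"
  using assms
proof induction
  case (const c)
  then show ?case by (intro exI[of _ "[:c:]"]) simp
next
  case (coord a x)
  then show ?case by (intro exI[of _ "[:e1 a x, e2 a x - e1 a x:]"]) simp
next
  case (add Q1 Q2)
  then obtain q1 q2 where "\<forall>\<epsilon>. Q1 (\<lambda>a x. e1 a x + \<epsilon> * (e2 a x - e1 a x)) = poly q1 \<epsilon>"
    "\<forall>\<epsilon>. Q2 (\<lambda>a x. e1 a x + \<epsilon> * (e2 a x - e1 a x)) = poly q2 \<epsilon>" by blast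
  then show ?case by (intro exI[of _ "q1 + q2"]) simp
next
  case (mult Q1 Q2)
  then obtain q1 q2 where "\<forall>\<epsilon>. Q1 (\<lambda>a x. e1 a x + \<epsilon> * (e2 a x - e1 a x)) = poly q1 \<epsilon>"
    "\<forall>\<epsilon>. Q2 (\<lambda>a x. e1 a x + \<epsilon> * (e2 a x - e1 a x)) = poly q2 \<epsilon>" by blast
  then show ?case by (intro exI[of _ "q1 * q2"]) simp
qed

locale coframe_spaces = tensor_spaces_char_0 sT sV
  for sT :: "'a::field_char_0 \<Rightarrow> 't::ab_group_add \<Rightarrow> 't" and sV :: "'a \<Rightarrow> 'v::ab_group_add \<Rightarrow> 'v" +
  fixes BT :: "'t set" and n :: nat
  assumes fin_T: "finite_dimensional_vector_space sT BT" and n_eq: "n = T.dim UNIV"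
begin

lemma fin_dim_T: "T.fin_dim UNIV"
proof -
  interpret FT: finite_dimensional_vector_space sT BT by (rule fin_T)
  show ?thesis unfolding T.fin_dim_def using FT.finite_Basis FT.span_Basis by blast
qed

text \<open>The functionals read off coefficients, so the vectors are independent. There are
  \<open>dim T\<close> of them, hence they span, and the expansion follows.\<close>

lemma dual_basesI:
  assumes lin: "\<And>a. a < n \<Longrightarrow> lin sT (*) (e a)"
    and ev: "\<And>a b. a < n \<Longrightarrow> b < n \<Longrightarrow> e a (v b) = (if a = b then 1 else 0)"
  shows "dual_bases n v e"
proof -
  have app: "e a (\<Sum>j<n. sT (t j) (v j)) = t a" if "a < n" for a t
  proof -
    interpret l: Vector_Spaces.linear sT "(*)" "e a" by (rule lin[OF that])
    have "e a (\<Sum>j<n. sT (t j) (v j)) = (\<Sum>j<n. t j * e a (v j))" by (simp add: l.sum l.scale)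
    also have "\<dots> = (\<Sum>j<n. if j = a then t j else 0)"
      by (intro sum.cong refl) (use ev that in auto)
    finally show ?thesis using that by simp
  qed
  have "e a 0 = 0" if "a < n" for a
    using app[OF that, of "\<lambda>_. 0"] by simp
  then have ind: "T.indep_family n v"
    unfolding T.indep_family_def using app by metis
  have "x = (\<Sum>a<n. sT (e a x) (v a))" for x
  proof -
    have "x \<in> T.span (v ` {..<n})"
      using T.indep_family_span[OF ind fin_dim_T] n_eq by blast
    then obtain t where t: "x = (\<Sum>j<n. sT (t j) (v j))" unfolding T.span_image_lessThan by blast
    then have "e a x = t a" if "a < n" for a using app[OF that, of t] by simp
    then show ?thesis using t by simp
  qed
  then show ?thesis using lin ev unfolding dual_bases_def by blast
qed

lemma exists_dual_bases: "\<exists>v e. dual_bases n v e"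
proof -
  interpret FT: finite_dimensional_vector_space sT BT by (rule fin_T)
  have card: "card BT = n" unfolding n_eq by (rule FT.dim_UNIV[symmetric])
  obtain v where v: "T.indep_family n v"
    using T.indep_family_of_set[OF FT.finite_Basis FT.independent_Basis] card by blast
  have "\<exists>f. lin sT (*) f \<and> f (v a) = 1 \<and> (\<forall>b<n. b \<noteq> a \<longrightarrow> f (v b) = 0)" if a: "a < n" for a
  proof -
    have inj: "inj_on v {..<n}" and ind: "T.independent (v ` {..<n})" using v by (auto simp: T.indep_family_iff)
    have "v a \<notin> T.span (v ` {..<n} - {v a})" using ind a unfolding T.dependent_def by blast
    then obtain f where f: "lin sT (*) f" "f (v a) = 1" "\<forall>y\<in>T.span (v ` {..<n} - {v a}). f y = 0"
      using T.exists_functional[OF T.subspace_span] by blast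
    have "f (v b) = 0" if "b < n" "b \<noteq> a" for b
    proof -
      have "v b \<noteq> v a" using inj a that by (auto simp: inj_on_def)
      then show ?thesis using f(3) that by (auto intro!: T.span_base)
    qed
    then show ?thesis using f by blast
  qed
  then obtain e where e: "\<And>a. a < n \<Longrightarrow> lin sT (*) (e a) \<and> e a (v a) = 1 \<and> (\<forall>b<n. b \<noteq> a \<longrightarrow> e a (v b) = 0)"
    by metis
  have "dual_bases n v e" by (rule dual_basesI) (use e in auto)
  then show ?thesis by blast
qed

lemma dual_bases_unique:
  assumes "dual_bases n v e" "dual_bases n v' e" "a < n"
  shows "v' a = v a"
proof -
  have "v' a = (\<Sum>b<n. sT (e b (v' a)) (v b))" by (rule dual_bases_expand[OF assms(1)])
  also have "\<dots> = (\<Sum>b<n. if b = a then v a else 0)"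
    by (intro sum.cong refl) (use assms(3) dual_bases_eval[OF assms(2)] in auto)
  finally show ?thesis using assms(3) by simp
qed

lemma lin_space_dual: "lin_space (fun_scale (*) :: 'a \<Rightarrow> ('t \<Rightarrow> 'a) \<Rightarrow> 't \<Rightarrow> 'a)"
  unfolding lin_space_def by (rule vector_space.vector_space_fun_scale[OF vector_space_mult])

lemma dual_bases_coframe:
  assumes "dual_bases n v e"
  shows "coframe sT e"
proof -
  interpret D: lin_space "fun_scale (*) :: 'a \<Rightarrow> ('t \<Rightarrow> 'a) \<Rightarrow> 't \<Rightarrow> 'a" by (rule lin_space_dual)
  have "D.indep_family n e"
    unfolding D.indep_family_def
  proof (intro allI impI)
    fix t j assume t: "(\<Sum>j<n. fun_scale (*) (t j) (e j)) = 0" and j: "j < n"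
    have "0 = (\<Sum>i<n. t i * e i (v j))"
      using fun_cong[OF t, of "v j"] by (simp add: sum_fun_apply fun_scale_def)
    also have "\<dots> = (\<Sum>i<n. if i = j then t i else 0)"
      by (intro sum.cong refl) (use dual_bases_eval[OF assms _ j] in auto)
    finally show "t j = 0" using j by simp
  qed
  then have ind: "inj_on e {..<n}" "D.independent (e ` {..<n})" by (auto simp: D.indep_family_iff)
  have "D.span (e ` {..<n}) = dual_space sT"
  proof
    have "D.subspace (dual_space sT)"
      unfolding dual_space_def using T.vector_space_axioms vector_space_mult
      by (intro D.subspaceI) (auto simp: lin_iff fun_scale_def distrib_left mult.left_commute)
    then show "D.span (e ` {..<n}) \<subseteq> dual_space sT"
      using dual_bases_linear[OF assms] by (intro D.span_minimal) (auto simp: dual_space_def)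
    show "dual_space sT \<subseteq> D.span (e ` {..<n})"
    proof
      fix p assume p: "p \<in> dual_space sT"
      interpret p: Vector_Spaces.linear sT "(*)" p using p by (simp add: dual_space_def)
      have "p = (\<Sum>a<n. fun_scale (*) (p (v a)) (e a))"
      proof
        fix x
        have "p x = p (\<Sum>a<n. sT (e a x) (v a))" using dual_bases_expand[OF assms, of x] by simp
        also have "\<dots> = (\<Sum>a<n. e a x * p (v a))" by (simp only: p.sum p.scale)
        finally show "p x = (\<Sum>a<n. fun_scale (*) (p (v a)) (e a)) x"
          by (simp only: sum_fun_apply fun_scale_def mult.commute)
      qed
      then show "p \<in> D.span (e ` {..<n})" unfolding D.span_image_lessThan by (rule exI[of _ "\<lambda>a. p (v a)"])
    qed
  qed
  then show ?thesis unfolding coframe_def n_eq[symmetric] Let_def using ind by simp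
qed

lemma coframe_linear:
  assumes "coframe sT e" "a < n"
  shows "lin sT (*) (e a)"
proof -
  interpret D: lin_space "fun_scale (*) :: 'a \<Rightarrow> ('t \<Rightarrow> 'a) \<Rightarrow> 't \<Rightarrow> 'a" by (rule lin_space_dual)
  have "D.span (e ` {..<n}) = dual_space sT" using assms(1) by (simp add: coframe_def n_eq Let_def)
  then have "e a \<in> dual_space sT" using assms(2) D.span_base[of "e a" "e ` {..<n}"] by auto
  then show ?thesis by (simp add: dual_space_def)
qed

text \<open>Cramer's rule: near a given coframe, the dual basis is a rational function of the coframe.\<close>

lemma coframe_minors:
  assumes "coframe sT e0"
  shows "\<exists>c b X. finite X \<and> c \<in> coframe_polys n \<and> c e0 \<noteq> 0 \<and>
    (\<forall>j<n. \<forall>x\<in>X. (\<lambda>e. b j e x) \<in> coframe_polys n) \<and>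
    (\<forall>e. (\<forall>a<n. lin sT (*) (e a)) \<longrightarrow> c e \<noteq> 0 \<longrightarrow>
       dual_bases n (\<lambda>j. sT (1 / c e) (\<Sum>x\<in>X. sT (b j e x) x)) e)"
proof -
  interpret D: lin_space "fun_scale (*) :: 'a \<Rightarrow> ('t \<Rightarrow> 'a) \<Rightarrow> 't \<Rightarrow> 'a" by (rule lin_space_dual)
  have ind: "D.indep_family n e0" using assms by (simp add: coframe_def n_eq Let_def D.indep_family_iff)
  have "\<exists>c b X. finite X \<and> X \<subseteq> UNIV \<and> c \<in> coframe_polys n \<and> c e0 \<noteq> 0 \<and>
    (\<forall>j<n. \<forall>x\<in>X. (\<lambda>e. b j e x) \<in> coframe_polys n) \<and>
    (\<forall>e. \<forall>i<n. \<forall>j<n. (\<Sum>x\<in>X. b j e x * e i x) = (if i = j then c e else 0))"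
  proof (rule dual_minors[OF fun_algebra_coframe_polys, of n UNIV "\<lambda>j e x. e j x"])
    show "(\<lambda>e. e j x) \<in> coframe_polys n" if "j < n" for j x using that by (rule coframe_polys.coord)
    fix t assume t: "\<And>x. x \<in> UNIV \<Longrightarrow> (\<Sum>j<n. t j * e0 j x) = 0"
    have "(\<Sum>j<n. fun_scale (*) (t j) (e0 j)) = 0"
      by (rule ext) (use t in \<open>simp add: sum_fun_apply fun_scale_def\<close>)
    then show "\<forall>j<n. t j = 0" using ind unfolding D.indep_family_def by blast
  qed
  then obtain c b X where X: "finite X" and c: "c \<in> coframe_polys n" "c e0 \<noteq> 0"
    and b: "\<forall>j<n. \<forall>x\<in>X. (\<lambda>e. b j e x) \<in> coframe_polys n"
    and dual: "\<forall>e. \<forall>i<n. \<forall>j<n. (\<Sum>x\<in>X. b j e x * e i x) = (if i = j then c e else 0)"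
    by (elim exE conjE) rule
  have "dual_bases n (\<lambda>j. sT (1 / c e) (\<Sum>x\<in>X. sT (b j e x) x)) e"
    if lin: "\<forall>a<n. lin sT (*) (e a)" and "c e \<noteq> 0" for e
  proof (rule dual_basesI)
    fix i j assume ij: "i < n" "j < n"
    interpret l: Vector_Spaces.linear sT "(*)" "e i" using lin ij by blast
    have "e i (sT (1 / c e) (\<Sum>x\<in>X. sT (b j e x) x)) = 1 / c e * (\<Sum>x\<in>X. b j e x * e i x)"
      by (simp only: l.scale l.sum)
    then show "e i (sT (1 / c e) (\<Sum>x\<in>X. sT (b j e x) x)) = (if i = j then 1 else 0)"
      using dual ij \<open>c e \<noteq> 0\<close> by simp
  qed (use lin in blast)
  then show ?thesis using X c b by blast
qed

lemma coframe_dual_bases: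
  assumes "coframe sT e"
  shows "\<exists>v. dual_bases n v e"
  using coframe_minors[OF assms] coframe_linear[OF assms] by blast

text \<open>Two nonempty open sets of coframes meet on the line joining a point of each, because
  nonzero polynomials in one variable have a common non-root. The polynomial \<open>c\<close>
  ensures that the point found is again a coframe. This gives uniqueness in the definition of the
  Cartan characters.\<close>

lemma common_generic_flag:
  assumes "for_generic_flag sT Q1" "for_generic_flag sT Q2"
  shows "\<exists>V. Q1 V \<and> Q2 V"
proof -
  obtain F1 e1 where F1: "F1 \<in> coframe_polys n" "coframe sT e1" "F1 e1 \<noteq> 0"
      "\<And>e. coframe sT e \<Longrightarrow> F1 e \<noteq> 0 \<Longrightarrow> Q1 (flag_of sT e)"
    using assms(1) unfolding for_generic_flag_def n_eq[symmetric] by blast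
  obtain F2 e2 where F2: "F2 \<in> coframe_polys n" "coframe sT e2" "F2 e2 \<noteq> 0"
      "\<And>e. coframe sT e \<Longrightarrow> F2 e \<noteq> 0 \<Longrightarrow> Q2 (flag_of sT e)"
    using assms(2) unfolding for_generic_flag_def n_eq[symmetric] by blast
  obtain c where c: "c \<in> coframe_polys n" "c e1 \<noteq> 0"
    "\<And>e. \<forall>a<n. lin sT (*) (e a) \<Longrightarrow> c e \<noteq> 0 \<Longrightarrow> coframe sT e"
  proof -
    from coframe_minors[OF F1(2)] obtain c b X where c: "c \<in> coframe_polys n" "c e1 \<noteq> 0"
      and dual: "\<forall>e. (\<forall>a<n. lin sT (*) (e a)) \<longrightarrow> c e \<noteq> 0 \<longrightarrow>
        dual_bases n (\<lambda>j. sT (1 / c e) (\<Sum>x\<in>X. sT (b j e x) x)) e"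
      by (elim exE conjE) rule
    show ?thesis
    proof (rule that[OF c])
      show "coframe sT e" if "\<forall>a<n. lin sT (*) (e a)" "c e \<noteq> 0" for e
        by (rule dual_bases_coframe[OF dual[rule_format, OF that(1)[rule_format] that(2)]])
    qed
  qed
  define l where "l = (\<lambda>\<epsilon> a x. e1 a x + \<epsilon> * (e2 a x - e1 a x))"
  obtain q1 where q1: "\<And>\<epsilon>. F1 (l \<epsilon>) = poly q1 \<epsilon>" using coframe_polys_line[OF F1(1), of e1 e2] unfolding l_def by blast
  obtain q2 where q2: "\<And>\<epsilon>. F2 (l \<epsilon>) = poly q2 \<epsilon>" using coframe_polys_line[OF F2(1), of e1 e2] unfolding l_def by blast
  obtain q3 where q3: "\<And>\<epsilon>. c (l \<epsilon>) = poly q3 \<epsilon>" using coframe_polys_line[OF c(1), of e1 e2] unfolding l_def by blast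
  have l01: "l 0 = e1" "l 1 = e2" by (auto simp: l_def fun_eq_iff)
  have "poly q1 0 \<noteq> 0" "poly q2 1 \<noteq> 0" "poly q3 0 \<noteq> 0"
    using F1(3) F2(3) c(2) l01 q1[of 0] q2[of 1] q3[of 0] by auto
  then have "q1 \<noteq> 0 \<and> q2 \<noteq> 0 \<and> q3 \<noteq> 0" by auto
  then have "q1 * q2 * q3 \<noteq> 0" by simp
  then have "finite {\<epsilon>. poly (q1 * q2 * q3) \<epsilon> = 0}" by (rule poly_roots_finite)
  then obtain \<epsilon> where "poly (q1 * q2 * q3) \<epsilon> \<noteq> 0"
    using infinite_UNIV_char_0[where ?'a = 'a] by (metis (mono_tags, lifting) UNIV_eq_I mem_Collect_eq)
  then have nz: "F1 (l \<epsilon>) \<noteq> 0" "F2 (l \<epsilon>) \<noteq> 0" "c (l \<epsilon>) \<noteq> 0" using q1 q2 q3 by auto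
  have "lin sT (*) (l \<epsilon> a)" if "a < n" for a
    using coframe_linear[OF F1(2) that] coframe_linear[OF F2(2) that]
    by (auto simp: l_def lin_iff algebra_simps)
  then have "coframe sT (l \<epsilon>)" using c(3) nz(3) by blast
  then show ?thesis using F1(4) F2(4) nz by blast
qed

section \<open>Semicontinuity of the kernels\<close>

definition killed :: "('t list \<Rightarrow> 'v) set \<Rightarrow> (nat \<Rightarrow> 't) \<Rightarrow> nat \<Rightarrow> ('t list \<Rightarrow> 'v) set" where
  "killed G v i = {f \<in> G. \<forall>a<i. \<forall>xs. f (v a # xs) = 0}"

lemma subspace_killed:
  assumes "F.subspace G"
  shows "F.subspace (killed G v i)"
proof (rule F.subspaceI)
  show "0 \<in> killed G v i" using F.subspace_0[OF assms] by (simp add: killed_def)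
  show "f + h \<in> killed G v i" if "f \<in> killed G v i" "h \<in> killed G v i" for f h
    using F.subspace_add[OF assms] that by (simp add: killed_def)
  show "fun_scale sV c f \<in> killed G v i" if f: "f \<in> killed G v i" for c f
  proof -
    have "fun_scale sV c f \<in> G" by (rule F.subspace_scale[OF assms]) (use f in \<open>simp add: killed_def\<close>)
    then show ?thesis using f by (simp add: killed_def fun_scale_def)
  qed
qed

text \<open>A basis of \<open>G\<close> modulo \<open>killed G v0 i\<close> remains independent
  modulo \<open>killed G v i\<close> as long as a minor is nonzero, so the codimension cannot drop
  near \<open>e0\<close>. The minor is polynomial in the coframe by Cramer's rule.\<close>

lemma dim_killed_semicontinuous:
  assumes G: "F.subspace G" "F.fin_dim G" "G \<subseteq> Mult k"
    and v0: "dual_bases n v0 e0" and i: "i \<le> n"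
  shows "\<exists>Q \<in> coframe_polys n. Q e0 \<noteq> 0 \<and>
    (\<forall>v e. dual_bases n v e \<longrightarrow> Q e \<noteq> 0 \<longrightarrow> F.dim (killed G v i) \<le> F.dim (killed G v0 i))"
proof -
  note R = fun_algebra_coframe_polys[of n]
  have sub: "killed G v i \<subseteq> G" for v by (auto simp: killed_def)
  obtain C where C: "finite C" "card C = F.dim G - F.dim (killed G v0 i)" "C \<subseteq> G"
    "\<And>a. (\<Sum>f\<in>C. fun_scale sV (a f) f) \<in> killed G v0 i \<Longrightarrow> \<forall>f\<in>C. a f = 0"
    using F.quotient_basis[OF G(1,2) subspace_killed[OF G(1), of v0 i] sub[of v0]] by blast
  define r where "r = card C"
  obtain u where "bij_betw u {0..<card C} C" using ex_bij_betw_nat_finite[OF C(1)] by blast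
  then have u: "inj_on u {..<r}" "u ` {..<r} = C" by (auto simp: r_def bij_betw_def lessThan_atLeast0)
  have uG: "u j \<in> G" if "j < r" for j using u(2) C(3) that by blast
  have sumC: "(\<Sum>f\<in>C. fun_scale sV (a f) f) = (\<Sum>j<r. fun_scale sV (a (u j)) (u j))" for a
    unfolding u(2)[symmetric] by (simp add: sum.reindex[OF u(1)])
  have ind0: "\<forall>j<r. t j = 0" if t: "(\<Sum>j<r. fun_scale sV (t j) (u j)) \<in> killed G v0 i" for t
  proof -
    define a where "a = (\<lambda>f. t (inv_into {..<r} u f))"
    have "(\<Sum>f\<in>C. fun_scale sV (a f) f) = (\<Sum>j<r. fun_scale sV (t j) (u j))"
      unfolding sumC by (intro sum.cong refl) (simp add: a_def u(1))
    then have "\<forall>f\<in>C. a f = 0" using C(4) t by simp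
    then have "\<forall>j<r. a (u j) = 0" using u(2) by blast
    then show ?thesis by (simp add: a_def u(1))
  qed
  obtain c b X where X: "finite X" and c: "c \<in> coframe_polys n" "c e0 \<noteq> 0"
    and b: "\<forall>j<n. \<forall>x\<in>X. (\<lambda>e. b j e x) \<in> coframe_polys n"
    and dual: "\<forall>e. (\<forall>a<n. lin sT (*) (e a)) \<longrightarrow> c e \<noteq> 0 \<longrightarrow>
       dual_bases n (\<lambda>j. sT (1 / c e) (\<Sum>x\<in>X. sT (b j e x) x)) e"
    using coframe_minors[OF dual_bases_coframe[OF v0]] by (elim exE conjE) rule
  \<comment> \<open>The dual basis with its denominator cleared: \<open>w a e\<close> is
    \<open>c e\<close> times the dual vector. It depends polynomially on \<open>e\<close> and
    imposes the same conditions wherever \<open>c e\<close> is nonzero.\<close>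
  define w where "w = (\<lambda>j e. \<Sum>x\<in>X. sT (b j e x) x)"
  have w: "w a e = sT (c e) (v a)" if "dual_bases n v e" "c e \<noteq> 0" "a < n" for v e a
  proof -
    have "dual_bases n (\<lambda>j. sT (1 / c e) (w j e)) e"
      using dual dual_bases_linear[OF that(1)] that(2) unfolding w_def by blast
    then have "sT (1 / c e) (w a e) = v a" by (rule dual_bases_unique[OF that(1) _ that(3)])
    then have "sT (c e) (sT (1 / c e) (w a e)) = sT (c e) (v a)" by simp
    then show ?thesis using that(2) by simp
  qed
  \<comment> \<open>One index for each scalar condition \<open>l (f (w a e # xs)) = 0\<close>;
    together they express that \<open>f\<close> is killed by the first \<open>i\<close> vectors.
    There may be infinitely many, and \<open>dual_minors\<close> selects finitely many of
    them.\<close>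
  define I where "I = {(a, xs :: 't list, l :: 'v \<Rightarrow> 'a) | a xs l. a < i \<and> lin sV (*) l}"
  define A where "A = (\<lambda>j e (a, xs, l). \<Sum>x\<in>X. b a e x * l (u j (x # xs)))"
  have A: "A j e (a, xs, l) = l (u j (w a e # xs))" if "j < r" "(a, xs, l) \<in> I" for j e a xs l
  proof -
    interpret l: Vector_Spaces.linear sV "(*)" l using that(2) by (simp add: I_def)
    have "u j \<in> Mult k" using uG[OF that(1)] G(3) by blast
    from linear_slot[OF this, of "[]" xs] interpret s: Vector_Spaces.linear sT sV "\<lambda>x. u j (x # xs)" by simp
    show ?thesis unfolding A_def w_def prod.case s.sum s.scale l.sum l.scale ..
  qed
  have sumA: "(\<Sum>j<r. t j * A j e (a, xs, l)) = l ((\<Sum>j<r. fun_scale sV (t j) (u j)) (w a e # xs))"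
    if "(a, xs, l) \<in> I" for t e a xs l
  proof -
    interpret l: Vector_Spaces.linear sV "(*)" l using that by (simp add: I_def)
    have "(\<Sum>j<r. t j * A j e (a, xs, l)) = (\<Sum>j<r. t j * l (u j (w a e # xs)))"
      by (intro sum.cong refl arg_cong2[where f = "(*)"] A) (use that in auto)
    then show ?thesis by (simp only: sum_fun_apply fun_scale_def l.sum l.scale)
  qed
  have scaled: "f (w a e # xs) = sV (c e) (f (v a # xs))"
    if "f \<in> G" "dual_bases n v e" "c e \<noteq> 0" "a < i" for f v e a xs
    using slot_scale[of f k "[]"] that G(3) w[of v e a] i by auto
  have comb: "(\<Sum>j<r. fun_scale sV (t j) (u j)) \<in> G" for t
    using uG by (intro F.subspace_sum[OF G(1)] F.subspace_scale[OF G(1)]) auto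
  have "\<exists>c' b' X'. finite X' \<and> X' \<subseteq> I \<and> c' \<in> coframe_polys n \<and> c' e0 \<noteq> 0 \<and>
    (\<forall>j<r. \<forall>x\<in>X'. (\<lambda>e. b' j e x) \<in> coframe_polys n) \<and>
    (\<forall>e. \<forall>i<r. \<forall>j<r. (\<Sum>x\<in>X'. b' j e x * A i e x) = (if i = j then c' e else 0))"
  proof (rule dual_minors[OF R])
    fix j x assume j: "j < r" and "x \<in> I"
    then obtain a xs l where x: "x = (a, xs, l)" "a < i" by (auto simp: I_def)
    show "(\<lambda>e. A j e x) \<in> coframe_polys n"
      unfolding A_def x prod.case
    proof (intro fun_algebra_sum[OF R] fun_algebra_mult[OF R] fun_algebra_const[OF R])
      show "(\<lambda>e. b a e y) \<in> coframe_polys n" if "y \<in> X" for y using b that x i by simp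
    qed
  next
    fix t assume t: "\<And>x. x \<in> I \<Longrightarrow> (\<Sum>j<r. t j * A j e0 x) = 0"
    let ?f = "\<Sum>j<r. fun_scale sV (t j) (u j)"
    have "?f (v0 a # xs) = 0" if a: "a < i" for a xs
    proof -
      have "?f (w a e0 # xs) = 0"
      proof (rule ccontr)
        assume "?f (w a e0 # xs) \<noteq> 0"
        then obtain l where l: "lin sV (*) l" "l (?f (w a e0 # xs)) = 1"
          using V.exists_functional[OF V.subspace_single_0, of "?f (w a e0 # xs)"] by blast
        then have "(a, xs, l) \<in> I" using a by (simp add: I_def)
        then show False using t[of "(a, xs, l)"] sumA[of a xs l t e0] l(2) by simp
      qed
      then show ?thesis using scaled[OF comb v0 c(2) a] c(2) by simp
    qed
    then have "?f \<in> killed G v0 i" using comb by (simp add: killed_def)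
    then show "\<forall>j<r. t j = 0" by (rule ind0)
  qed
  then obtain c' b' X' where X': "X' \<subseteq> I" and c': "c' \<in> coframe_polys n" "c' e0 \<noteq> 0"
    and dual': "\<forall>e. \<forall>i<r. \<forall>j<r. (\<Sum>x\<in>X'. b' j e x * A i e x) = (if i = j then c' e else 0)"
    by (elim exE conjE) rule
  have "F.dim (killed G v i) \<le> F.dim (killed G v0 i)" if v: "dual_bases n v e" and nz: "c e * c' e \<noteq> 0" for v e
  proof -
    have ce: "c e \<noteq> 0" "c' e \<noteq> 0" using nz by auto
    have "\<forall>f\<in>C. a f = 0" if "(\<Sum>f\<in>C. fun_scale sV (a f) f) \<in> killed G v i" for a
    proof -
      define t where "t = (\<lambda>j. a (u j))"
      let ?f = "\<Sum>j<r. fun_scale sV (t j) (u j)"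
      have f: "?f \<in> killed G v i" using that unfolding sumC t_def .
      have zero: "(\<Sum>j<r. t j * A j e x) = 0" if x: "x \<in> I" for x
      proof -
        obtain a xs l where x': "x = (a, xs, l)" "a < i" "lin sV (*) l" using x by (auto simp: I_def)
        interpret l: Vector_Spaces.linear sV "(*)" l by (rule x'(3))
        have "?f (w a e # xs) = 0" using scaled[OF comb v ce(1) x'(2), of t xs] f x'(2) by (simp add: killed_def)
        then show ?thesis using sumA[of a xs l t e] x x'(1) l.zero by simp
      qed
      have "t j = 0" if j: "j < r" for j
      proof -
        have "0 = (\<Sum>x\<in>X'. b' j e x * (\<Sum>i<r. t i * A i e x))"
          using zero X' by (intro sum.neutral[symmetric]) auto
        also have "\<dots> = (\<Sum>i<r. t i * (\<Sum>x\<in>X'. b' j e x * A i e x))"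
          unfolding sum_distrib_left by (subst sum.swap) (simp add: mult.left_commute)
        also have "\<dots> = (\<Sum>i<r. if i = j then t i * c' e else 0)"
          by (intro sum.cong refl) (use dual' j in auto)
        finally show ?thesis using j ce(2) by simp
      qed
      then show ?thesis using u(2) unfolding t_def by blast
    qed
    then have "card C + F.dim (killed G v i) \<le> F.dim G"
      by (rule F.independent_mod_card[OF G(2) subspace_killed[OF G(1)] sub C(1,3)])
    moreover have "F.dim (killed G v0 i) \<le> F.dim G"
      using F.dim_subset_fin_dim[OF G(2)] sub[of v0] F.span_superset by blast
    ultimately show ?thesis using C(2) by simp
  qed
  moreover have "(\<lambda>e. c e * c' e) \<in> coframe_polys n" by (rule coframe_polys.mult[OF c(1) c'(1)])
  ultimately show ?thesis using c(2) c'(2) by (intro bexI[of _ "\<lambda>e. c e * c' e"]) auto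
qed

end


subsection \<open>Symbolic systems\<close>

definition contract :: "'t \<Rightarrow> ('t list \<Rightarrow> 'v) \<Rightarrow> 't list \<Rightarrow> 'v" where
  "contract y f = (\<lambda>xs. f (y # xs))"

locale sym_system = coframe_spaces sT sV BT n
  for sT :: "'a::field_char_0 \<Rightarrow> 't::ab_group_add \<Rightarrow> 't" and sV :: "'a \<Rightarrow> 'v::ab_group_add \<Rightarrow> 'v"
    and BT :: "'t set" and n :: nat +
  fixes k :: nat and g :: "nat \<Rightarrow> ('t list \<Rightarrow> 'v) set"
  assumes system: "symbolic_system sT sV k g" and k_pos: "k \<ge> 1"
    and fin_V: "V.fin_dim UNIV"
begin

sublocale W: tensor_spaces sT "fun_scale sV"
  by unfold_locales

text \<open>Linearity and symmetry in the first \<open>r\<close> arguments are inherited from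
  \<open>f\<close>, so only the values of the split map remain to be tested.\<close>

lemma prolongation_iff:
  assumes "F.subspace W"
  shows "f \<in> prolongation sT sV r m W \<longleftrightarrow>
    f \<in> Sym (r + m) UNIV \<and> (\<forall>us. length us = r \<longrightarrow> (\<lambda>xs. f (us @ xs)) \<in> W)"
proof -
  let ?f = "\<lambda>us. if length us = r then (\<lambda>xs. f (us @ xs)) else 0"
  have "?f \<in> W.Sym r W"
    if f: "f \<in> Sym (r + m) UNIV" and W: "\<And>us. length us = r \<Longrightarrow> (\<lambda>xs. f (us @ xs)) \<in> W"
  proof (rule W.symI)
    show "?f \<in> W.Mult r"
    proof (rule W.multilinearI)
      fix us vs :: "'t list" assume len: "length us + 1 + length vs = r"
      show "lin sT (fun_scale sV) (\<lambda>x. ?f (us @ x # vs))"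
        unfolding lin_iff
        using len T.vector_space_axioms F.vector_space_axioms
          slot_add[OF sym_multilinear[OF f]] slot_scale[OF sym_multilinear[OF f]]
        by (auto simp: fun_eq_iff fun_scale_def)
    qed simp
    show "?f us \<in> W" for us using W F.subspace_0[OF assms] by simp
    show "?f us = ?f vs" if m: "mset us = mset vs" for us vs
      using mset_eq_length[OF m] sym_mset[OF f, of "us @ _" "vs @ _"] m by auto
  qed
  moreover have "(\<lambda>xs. f (us @ xs)) \<in> W" if "?f \<in> W.Sym r W" "length us = r" for us
    using W.sym_mem[OF that(1), of us] that(2) by simp
  ultimately show ?thesis unfolding prolongation_def by blast
qed

lemma subspace_g_k: "F.subspace (g k)"
  using system by (simp add: symbolic_system_def)

lemma g_above: "k < t \<Longrightarrow> g t = prolongation sT sV (t - k) k (g k)"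
  using system by (simp add: symbolic_system_def)

lemma g_below: "t < k \<Longrightarrow> g t = Sym t UNIV"
  using system by (simp add: symbolic_system_def)

lemma g_sym: "g t \<subseteq> Sym t UNIV"
proof -
  consider "t < k" | "t = k" | "k < t" by linarith
  then show ?thesis
  proof cases
    case 3
    then show ?thesis unfolding g_above[OF 3] prolongation_def by auto
  qed (use system in \<open>auto simp: symbolic_system_def\<close>)
qed

lemma g_multilinear: "f \<in> g t \<Longrightarrow> f \<in> Mult t"
  using g_sym sym_multilinear by blast

lemma subspace_g: "F.subspace (g t)"
proof -
  consider "t < k" | "t = k" | "k < t" by linarith
  then show ?thesis
  proof cases
    case 1
    then show ?thesis using g_below subspace_sym by simp
  next
    case 2
    then show ?thesis using subspace_g_k by simp
  next
    case 3
    note iff = prolongation_iff[OF subspace_g_k, of _ "t - k" k]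
    note sym = F.subspace_0[OF subspace_sym] F.subspace_add[OF subspace_sym] F.subspace_scale[OF subspace_sym]
    show ?thesis unfolding g_above[OF 3]
    proof (rule F.subspaceI)
      show "0 \<in> prolongation sT sV (t - k) k (g k)"
        unfolding iff using sym F.subspace_0[OF subspace_g_k] by (simp add: zero_fun_def)
      show "f + h \<in> prolongation sT sV (t - k) k (g k)"
        if "f \<in> prolongation sT sV (t - k) k (g k)" "h \<in> prolongation sT sV (t - k) k (g k)" for f h
        using that sym F.subspace_add[OF subspace_g_k] unfolding iff by (simp add: plus_fun_def)
      show "fun_scale sV c f \<in> prolongation sT sV (t - k) k (g k)"
        if "f \<in> prolongation sT sV (t - k) k (g k)" for c f
        using that sym F.subspace_scale[OF subspace_g_k] unfolding iff by (simp add: fun_scale_def)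
    qed
  qed
qed

lemma contract_g:
  assumes f: "f \<in> g (Suc t)"
  shows "contract y f \<in> g t"
proof -
  have sym: "contract y f \<in> Sym t UNIV"
    using sym_contract[of f t UNIV y] f g_sym[of "Suc t"] by (auto simp: contract_def)
  consider "t < k" | "t = k" | "k < t" by linarith
  then show ?thesis
  proof cases
    case 1
    then show ?thesis using sym g_below by simp
  next
    case 2
    have "f \<in> prolongation sT sV 1 k (g k)" using f 2 g_above[of "Suc t"] by simp
    then have "(\<lambda>xs. f ([y] @ xs)) \<in> g k" unfolding prolongation_iff[OF subspace_g_k] by (elim conjE allE[of _ "[y]"] impE) auto
    then show ?thesis using 2 by (simp add: contract_def)
  next
    case 3
    have "f \<in> prolongation sT sV (Suc t - k) k (g k)" using f 3 g_above[of "Suc t"] by simp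
    then have "(\<lambda>xs. f ((y # us) @ xs)) \<in> g k" if "length us = t - k" for us
      using that 3 unfolding prolongation_iff[OF subspace_g_k] by (elim conjE allE[of _ "y # us"] impE) auto
    then show ?thesis
      using sym 3 unfolding g_above[OF 3] prolongation_iff[OF subspace_g_k] by (simp add: contract_def)
  qed
qed

text \<open>The factor \<open>i\<close> is all that separates the two differentials. For
  \<open>i > 0\<close> it is invertible, so kernels and images agree; for \<open>i = 0\<close> both
  differentials vanish on forms with coefficients in \<open>g 0\<close>.\<close>

lemma spencer_delta_dd:
  "spencer_delta sV i f = fun_scale (fun_scale sV) (of_nat i) (dd contract f)"
proof (intro ext)
  fix ys xs
  have "(\<Sum>a<length ys. sV ((-1) ^ a) (f (take a ys @ drop (Suc a) ys) (ys ! a # xs))) = dd contract f ys xs"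
  proof (induction ys arbitrary: f)
    case (Cons y ys)
    have "(\<Sum>a<length (y # ys). sV ((-1) ^ a) (f (take a (y # ys) @ drop (Suc a) (y # ys)) ((y # ys) ! a # xs)))
      = f ys (y # xs) - (\<Sum>a<length ys. sV ((-1) ^ a) (f (y # (take a ys @ drop (Suc a) ys)) (ys ! a # xs)))"
      by (simp add: sum.lessThan_Suc_shift sum_negf del: sum.lessThan_Suc)
    then show ?case using Cons[of "\<lambda>zs. f (y # zs)"] by (simp add: contract_def)
  qed simp
  then show "spencer_delta sV i f ys xs = fun_scale (fun_scale sV) (of_nat i) (dd contract f) ys xs"
    by (simp add: spencer_delta_def fun_scale_def)
qed

lemma derivation_contract: "W.derivation contract (g (Suc t)) (g t)"
  unfolding W.derivation_def
proof (intro conjI allI ballI)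
  show "lin (fun_scale sV) (fun_scale sV) (contract y)" for y :: 't
    by (rule linear_funI) (auto simp: contract_def fun_scale_def)
  show "contract y w \<in> g t" if "w \<in> g (Suc t)" for y w using contract_g[OF that] .
  show "lin sT (fun_scale sV) (\<lambda>y. contract y w)" if w: "w \<in> g (Suc t)" for w
    unfolding lin_iff
    using T.vector_space_axioms F.vector_space_axioms
      slot_add[OF g_multilinear[OF w], of "[]"] slot_scale[OF g_multilinear[OF w], of "[]"]
    by (auto simp: contract_def fun_eq_iff fun_scale_def)
qed

lemma contract_g_0: "w \<in> g 0 \<Longrightarrow> contract y w = 0"
  using multilinear_length[OF g_multilinear, of w 0] by (auto simp: contract_def)

lemma spencer_cocycles_eq:
  "spencer_cocycles sT sV g t j = {f \<in> W.Alt j (g t). dd contract f = 0}"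
proof (cases t)
  case 0
  have "dd contract f = 0" if "f \<in> W.Alt j (g t)" for f
    using that 0 contract_g_0 by (intro W.dd_eq_0[of "g 0"]) (auto simp: alt_tensors_def)
  then show ?thesis
    by (auto simp: spencer_cocycles_def spencer_term_def spencer_delta_dd 0 fun_scale_def fun_eq_iff)
next
  case (Suc u)
  then have "(of_nat t :: 'a) \<noteq> 0" by (simp del: of_nat_Suc)
  then have "fun_scale (fun_scale sV) (of_nat t) (dd contract f) = 0 \<longleftrightarrow> dd contract f = 0" for f
    using W.F.scale_eq_0_iff by blast
  then show ?thesis by (auto simp: spencer_cocycles_def spencer_term_def spencer_delta_dd)
qed

lemma spencer_coboundaries_eq:
  "spencer_coboundaries sT sV g t j =
     (case j of 0 \<Rightarrow> {0} | Suc j' \<Rightarrow> dd contract ` W.Alt j' (g (Suc t)))"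
proof (cases j)
  case 0
  then show ?thesis by (simp add: spencer_coboundaries_def)
next
  case (Suc j')
  interpret d: Vector_Spaces.linear "fun_scale (fun_scale sV)" "fun_scale (fun_scale sV)"
    "dd (contract :: 't \<Rightarrow> ('t list \<Rightarrow> 'v) \<Rightarrow> 't list \<Rightarrow> 'v)"
    by (rule W.linear_dd[OF derivation_contract])
  let ?A = "W.Alt j' (g (Suc t))"
  have ss: "W.F.subspace ?A" by (rule W.subspace_alt[OF subspace_g])
  let ?c = "of_nat (Suc t) :: 'a"
  have c: "?c \<noteq> 0" by (simp only: of_nat_eq_0_iff)
  have "spencer_delta sV (Suc t) f = dd contract (fun_scale (fun_scale sV) ?c f)"
    for f :: "'t list \<Rightarrow> 't list \<Rightarrow> 'v"
    by (simp only: spencer_delta_dd d.scale)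
  then have 1: "spencer_delta sV (Suc t) ` ?A \<subseteq> dd contract ` ?A"
    using W.F.subspace_scale[OF ss] by auto
  have "dd contract f = spencer_delta sV (Suc t) (fun_scale (fun_scale sV) (1 / ?c) f)"
    for f :: "'t list \<Rightarrow> 't list \<Rightarrow> 'v"
    unfolding spencer_delta_dd d.scale W.F.scale_scale using c by simp
  then have "dd contract ` ?A \<subseteq> spencer_delta sV (Suc t) ` ?A"
    using W.F.subspace_scale[OF ss] by auto
  then show ?thesis using 1 Suc by (simp add: spencer_coboundaries_def spencer_term_def subset_antisym)
qed

lemma g_0: "g 0 = Alt 0 UNIV"
  using g_below[of 0] k_pos sym_0_eq_alt_0 by simp

lemma dim_g_0: "F.fin_dim (g 0)" "F.dim (g 0) = V.dim UNIV"
  using zero_forms[OF V.subspace_UNIV fin_V, of undefined 0] unfolding g_0 horizontal_0 by auto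

lemma spencer_module:
  assumes "involutive sT sV k g"
  shows "spencer_module sT (fun_scale sV) n k contract g"
proof unfold_locales
  show "\<exists>v e. W.dual_bases n v e" by (rule exists_dual_bases)
  show "1 \<le> k" by (rule k_pos)
  show "F.subspace (g t)" for t by (rule subspace_g)
  show "F.fin_dim (g 0)" by (rule dim_g_0)
  show "W.derivation contract (g (Suc t)) (g t)" for t by (rule derivation_contract)
  show "contract y w = 0" if "w \<in> g 0" for w y using contract_g_0[OF that] .
  show "contract x (contract y w) = contract y (contract x w)" if "w \<in> g t" for w t x y
  proof
    fix xs
    have "w \<in> Sym t UNIV" using g_sym that by blast
    then show "contract x (contract y w) xs = contract y (contract x w) xs"
      unfolding contract_def by (rule sym_mset) simp
  qed
  show "w = 0" if w: "w \<in> g (Suc t)" and z: "\<And>y. contract y w = 0" for w t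
  proof
    show "w xs = 0 xs" for xs
    proof (cases xs)
      case Nil
      then show ?thesis using multilinear_length[OF g_multilinear[OF w]] by simp
    next
      case (Cons y ys)
      then show ?thesis using fun_cong[OF z[of y], of ys] by (simp add: contract_def)
    qed
  qed
  show "f \<in> dd contract ` W.Alt j (g (Suc t))"
    if "k \<le> t" "f \<in> W.Alt (Suc j) (g t)" "dd contract f = 0" for f t j
  proof -
    have "spencer_cocycles sT sV g t (Suc j) = spencer_coboundaries sT sV g t (Suc j)"
      using assms that(1) k_pos by (auto simp: involutive_def)
    then show ?thesis using that by (auto simp: spencer_cocycles_eq spencer_coboundaries_eq)
  qed
qed

section \<open>Cartan characters as differences of kernel dimensions\<close>

lemma flag_intersection:
  assumes v: "dual_bases n v e" and "i \<le> n"
  shows "g k \<inter> sym_power_of sV k (flag_of sT e i) = killed (g k) v i"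
  using sym_power_of_flag[OF assms k_pos] g_sym[of k]
  by (auto simp: flag_of_def n_eq[symmetric] killed_def)

lemma cartan_character_eq:
  assumes inv: "involutive sT sV k g"
    and v: "dual_bases n v e" and surj: "\<And>i. i < n \<Longrightarrow> spencer_module.surj_at contract g v i k"
    and i: "1 \<le> i" "i \<le> n"
  shows "cartan_character sT sV k g i = int (F.dim (killed (g k) v (i - 1))) - int (F.dim (killed (g k) v i))"
proof -
  interpret S: spencer_module sT "fun_scale sV" n k contract g by (rule spencer_module[OF inv])
  have SK: "S.K v' i' k = killed (g k) v' i'" for v' i'
    by (auto simp: S.K_def killed_def contract_def fun_eq_iff)
  have ml: "g k \<subseteq> Mult k" using g_multilinear by blast
  have "\<forall>i'\<le>n. \<exists>Q \<in> coframe_polys n. Q e \<noteq> 0 \<and>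
    (\<forall>v' e'. dual_bases n v' e' \<longrightarrow> Q e' \<noteq> 0 \<longrightarrow> F.dim (killed (g k) v' i') \<le> F.dim (killed (g k) v i'))"
    using dim_killed_semicontinuous[OF subspace_g S.fin_dim_g ml v] by blast
  then obtain Q where Q: "\<And>i'. i' \<le> n \<Longrightarrow> Q i' \<in> coframe_polys n" "\<And>i'. i' \<le> n \<Longrightarrow> Q i' e \<noteq> 0"
    "\<And>i' v' e'. i' \<le> n \<Longrightarrow> dual_bases n v' e' \<Longrightarrow> Q i' e' \<noteq> 0 \<Longrightarrow>
      F.dim (killed (g k) v' i') \<le> F.dim (killed (g k) v i')"
    by metis
  \<comment> \<open>One open set for all indices up to \<open>n\<close>: a character involves only
    two dimensions, but minimality comes from comparing the sums of all of them.\<close>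
  define Q' where "Q' = (\<lambda>e. \<Prod>i'\<le>n. Q i' e)"
  have Q': "Q' \<in> coframe_polys n" unfolding Q'_def
    by (rule fun_algebra_prod[OF fun_algebra_coframe_polys]) (use Q(1) in simp)
  have dims: "F.dim (g k \<inter> sym_power_of sV k (flag_of sT e' i')) = F.dim (killed (g k) v i')"
    if e': "coframe sT e'" "Q' e' \<noteq> 0" and i': "i' \<le> n" for e' i'
  proof -
    obtain v' where v': "dual_bases n v' e'" using coframe_dual_bases[OF e'(1)] by blast
    have nz: "Q i' e' \<noteq> 0" if "i' \<le> n" for i' using e'(2) that by (auto simp: Q'_def)
    have "F.dim (killed (g k) v' i') = F.dim (killed (g k) v i')"
      using S.quasi_regular_minimal[OF v surj v' _ i'] Q(3)[OF _ v' nz] by (simp add: SK)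
    then show ?thesis using flag_intersection[OF v' i'] by simp
  qed
  let ?c = "int (F.dim (killed (g k) v (i - 1))) - int (F.dim (killed (g k) v i))"
  let ?Q = "\<lambda>c V. c = int (F.dim (g k \<inter> sym_power_of sV k (V (i - 1)))) - int (F.dim (g k \<inter> sym_power_of sV k (V i)))"
  have gen: "for_generic_flag sT (?Q ?c)"
    unfolding for_generic_flag_def n_eq[symmetric]
  proof (intro bexI[OF _ Q'] conjI exI allI impI)
    show "coframe sT e" by (rule dual_bases_coframe[OF v])
    show "Q' e \<noteq> 0" unfolding Q'_def using Q(2) by simp
    show "?Q ?c (flag_of sT e')" if "coframe sT e' \<and> Q' e' \<noteq> 0" for e'
      using dims[of e'] that i by simp
  qed
  show ?thesis unfolding cartan_character_def
  proof (rule the_equality)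
    show "for_generic_flag sT (?Q ?c)" by (rule gen)
    fix c assume "for_generic_flag sT (?Q c)"
    from common_generic_flag[OF this gen] show "c = ?c" by auto
  qed
qed

lemma character_formula:
  fixes h :: "nat \<Rightarrow> int"
  assumes inv: "involutive sT sV k g"
    and h0: "h 0 = int (V.dim UNIV)"
    and h: "\<And>i. 1 \<le> i \<Longrightarrow> i \<le> n \<Longrightarrow> h i = int (spencer_dim sT sV g (k - 1) i)"
    and l: "l \<in> {1..n}"
  shows "cartan_character sT sV k g l = int ((n + k - l - 1) choose (k - 1)) * h 0 +
       (\<Sum>i = n - l + 1..n. (-1) ^ (i - (n - l)) * int ((i - 1) choose (n - l)) * h i)"
proof -
  interpret S: spencer_module sT "fun_scale sV" n k contract g by (rule spencer_module[OF inv])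
  have Z: "spencer_cocycles sT sV g t j = S.Z t j" for t j
    by (simp add: spencer_cocycles_eq S.Z_def)
  have Bd: "spencer_coboundaries sT sV g t j = S.Bd t j" for t j
    by (simp add: spencer_coboundaries_eq S.Bd_def)
  \<comment> \<open>This range contains the degrees \<open>k + u\<close> with \<open>u < n\<close>
    that enter the generating function, and degree \<open>k\<close>, where the Cartan characters are
    read off.\<close>
  obtain v e where v: "dual_bases n v e"
    and surj: "\<And>i t. i < n \<Longrightarrow> k \<le> t \<Longrightarrow> t \<le> k + n \<Longrightarrow> S.surj_at v i t"
    using S.quasi_regular_basis[of n "k + n"] by blast
  have SK: "S.K v i k = killed (g k) v i" for i
    by (auto simp: S.K_def killed_def contract_def fun_eq_iff)
  have "cartan_character sT sV k g l = int (F.dim (S.K v (l - 1) k)) - int (F.dim (S.K v l k))"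
    unfolding SK by (rule cartan_character_eq[OF inv v]) (use surj l in auto)
  also have "\<dots> = int ((n + k - l - 1) choose (k - 1)) * h 0 +
       (\<Sum>i = n - l + 1..n. (-1) ^ (i - (n - l)) * int ((i - 1) choose (n - l)) * h i)"
  proof (rule S.quasi_regular_formula[OF _ v surj _ _ l])
    show "S.Z t j = S.Bd t j" if "t \<noteq> k - 1" "0 < t + j" for t j
      using inv that unfolding involutive_def Z Bd by blast
    show "h 0 = int (F.dim (g 0))" using h0 dim_g_0 by simp
    show "h i = int (quotient_dim (fun_scale (fun_scale sV)) (S.Z (k - 1) i) (S.Bd (k - 1) i))"
      if "1 \<le> i" "i \<le> n" for i
      using h[OF that] by (simp add: spencer_dim_def Z Bd)
  qed
  finally show ?thesis .
qed

lemma spencer_dim_0: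
  assumes inv: "involutive sT sV k g"
  shows "spencer_dim sT sV g 0 0 = V.dim UNIV"
proof -
  interpret S: spencer_module sT "fun_scale sV" n k contract g by (rule spencer_module[OF inv])
  have "spencer_dim sT sV g 0 0 = quotient_dim (fun_scale (fun_scale sV)) (S.Z 0 0) (S.Bd 0 0)"
    by (simp add: spencer_dim_def spencer_cocycles_eq spencer_coboundaries_eq S.Z_def S.Bd_def)
  moreover have "int (quotient_dim (fun_scale (fun_scale sV)) (S.Z 0 0) (S.Bd 0 0)) = int (F.dim (g 0))"
    unfolding S.quotient_dim_Z_Bd using S.dim_alt(2)[of 0 0] W.F.dim_zero by (simp add: S.Z_0 S.Bd_def)
  ultimately show ?thesis using dim_g_0 by simp
qed

end

theorem proposition2:
  fixes scaleT :: "'a::field_char_0 \<Rightarrow> 't::ab_group_add \<Rightarrow> 't"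
    and scaleN :: "'a \<Rightarrow> 'n::ab_group_add \<Rightarrow> 'n"
    and BT :: "'t set" and BN :: "'n set"
    and n k :: nat
    and g :: "nat \<Rightarrow> ('t list \<Rightarrow> 'n) set"
    and s h :: "nat \<Rightarrow> int"
  assumes "finite_dimensional_vector_space scaleT BT"
    and "finite_dimensional_vector_space scaleN BN"
    and "n = vector_space.dim scaleT (UNIV :: 't set)"
    and "k \<ge> 1"
    and "symbolic_system scaleT scaleN k g"
    and "involutive scaleT scaleN k g"
    and "s 0 = int (vector_space.dim scaleN (UNIV :: 'n set))"
    and "\<And>i. 1 \<le> i \<Longrightarrow> i \<le> n \<Longrightarrow> s i = cartan_character scaleT scaleN k g i"
    and "h 0 = int (spencer_dim scaleT scaleN g 0 0)"
    and "\<And>i. 1 \<le> i \<Longrightarrow> i \<le> n \<Longrightarrow> h i = int (spencer_dim scaleT scaleN g (k - 1) i)"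
  shows "s 0 = h 0 \<and>
    (\<forall>l\<in>{1..n}. s l = int ((n + k - l - 1) choose (k - 1)) * h 0 +
       (\<Sum>i = n - l + 1..n. (-1) ^ (i - (n - l)) * int ((i - 1) choose (n - l)) * h i))"
proof -
  interpret T: finite_dimensional_vector_space scaleT BT by fact
  interpret N: finite_dimensional_vector_space scaleN BN by fact
  interpret N': lin_space scaleN by unfold_locales
  have "N'.fin_dim UNIV"
    unfolding N'.fin_dim_def using N.finite_Basis N.span_Basis by blast
  then interpret sym_system scaleT scaleN BT n k g
    using assms(1,3,4,5) by unfold_locales auto
  have h0: "h 0 = int (N.dim UNIV)" using assms(9) spencer_dim_0[OF assms(6)] by simp
  show ?thesis
    using assms(7,8) h0 character_formula[OF assms(6) h0 assms(10)] by auto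
qed

end
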